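(* Let $A \subseteq \mathbb{R}^2$ be locally finite, coarsely dense, and generic, and let $k \geq 1$. Then 1. $\alpha(M_k(A)) \geq \alpha(M_{k+1}(A))$ for each $M \in \{\mathrm{Del}, \mathrm{Igl}, \mathrm{Bri}\}$; 2. $\omega(M_k(A)) \leq \omega(M_{k+1}(A))$ for each $M \in \{\mathrm{Vor}, \mathrm{Bri}, \mathrm{Igl}\}$. Furthermore, $\alpha(\mathrm{Bri}_k(A)) \geq \alpha(\mathrm{Bri}_{k+1}(A))$ and $\omega(\mathrm{Igl}_k(A)) \leq \omega(\mathrm{Igl}_{k+1}(A))$ hold even without the requirement that $A$ be generic (i.e., for all locally finite, coarsely dense $A$).
   Context: $A$ is locally finite if every disk contains finitely many points of $A$, coarsely dense if every half-plane contains infinitely many points of $A$, and generic if no four points of $A$ lie on a common circle. For a tiling $T$ of the plane by convex polygons, $\alpha(T)$ and $\omega(T)$ denote the infimum and supremum of the interior angles at vertices of its tiles. Order-$k$ Voronoi tessellation $\mathrm{Vor}_k(A)$: for finite $B\subseteq A$ let $\mathrm{dom}(B)=\{x\in\mathbb{R}^2: \|x-b\|\le\|x-a\| \ \forall b\in B, a\in A\setminus B\}$; $\mathrm{Vor}_k(A)$ consists of all $\mathrm{dom}(B)$ with $|B|=k$ with their edges and vertices. Order-$k$ Brillouin tessellation $\mathrm{Bri}_k(A)$: the overlay of $\mathrm{Vor}_{k-1}(A)$ and $\mathrm{Vor}_k(A)$ (their edges do not cross), i.e., the tiling whose vertices and edges are those of both ($\mathrm{Vor}_0(A)$ is the trivial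 tiling, so $\mathrm{Bri}_1=\mathrm{Vor}_1$); equivalently its tiles are the $k$-th Brillouin zones (regions where a given point of $A$ is the $k$-th closest). Order-$k$ Delaunay mosaic $\mathrm{Del}_k(A)$: the vertical projection to $\mathbb{R}^2$ of the lower boundary complex of the convex hull in $\mathbb{R}^3$ of the points $\big(\tfrac1k\sum_{a\in B}a,\ \tfrac1k\sum_{a\in B}\|a\|^2\big)$ over all $B\subseteq A$, $|B|=k$. Order-$k$ Iglesias mosaic $\mathrm{Igl}_k(A)$: the vertical projection of the lower boundary complex of the convex hull of the points $\big(\tfrac{1}{2k-1}b+\tfrac{2}{2k-1}\sum_{a\in B\setminus\{b\}}a,\ \tfrac{1}{2k-1}\|b\|^2+\tfrac{2}{2k-1}\sum_{a\in B\setminus\{b\}}\|a\|^2\big)$ over all $B\subseteq A$, $|B|=k$, $b\in B$. $\mathrm{Del}_k(A)$ is an orthogonal dual of $\mathrm{Vor}_k(A)$ and $\mathrm{Igl}_k(A)$ an orthogonal dual of $\mathrm{Bri}_k(A)$. *)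

theory Defs
  imports "HOL-Analysis.Analysis"
begin

type_synonym plane = "real^2"

definition locally_finite :: "plane set \<Rightarrow> bool" where
  "locally_finite A \<longleftrightarrow> (\<forall>c r. finite (A \<inter> cball c r))"

definition coarsely_dense :: "plane set \<Rightarrow> bool" where
  "coarsely_dense A \<longleftrightarrow> (\<forall>u c. u \<noteq> 0 \<longrightarrow> infinite (A \<inter> {x. u \<bullet> x \<le> c}))"

definition generic :: "plane set \<Rightarrow> bool" where
  "generic A \<longleftrightarrow> \<not> (\<exists>S c r. S \<subseteq> A \<and> card S = 4 \<and> r > 0 \<and> S \<subseteq> sphere c r)"

text \<open>A tiling or mosaic is given by the set of its two-dimensional tiles; the edges and
  vertices are the faces of these.\<close>

definition vangle :: "plane \<Rightarrow> plane \<Rightarrow> real" where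
  "vangle u v = arccos ((u \<bullet> v) / (norm u * norm v))"

text \<open>In a convex polygon the interior angle at a vertex \<open>v\<close> is less than \<open>\<pi>\<close>, so it is the
  unoriented angle between the two edges that meet at \<open>v\<close>.\<close>

definition interior_angles :: "plane set \<Rightarrow> real set" where
  "interior_angles P = {vangle (p - v) (q - v) | v p q.
     v extreme_point_of P \<and> p \<noteq> q \<and>
     closed_segment v p edge_of P \<and> closed_segment v q edge_of P}"

definition min_angle :: "plane set set \<Rightarrow> real" (\<open>\<alpha>\<close>) where
  "\<alpha> T = Inf (\<Union>P\<in>T. interior_angles P)"

definition max_angle :: "plane set set \<Rightarrow> real" (\<open>\<omega>\<close>) where
  "\<omega> T = Sup (\<Union>P\<in>T. interior_angles P)"

definition vdom :: "plane set \<Rightarrow> plane set \<Rightarrow> plane set" where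
  "vdom A B = {x. \<forall>b\<in>B. \<forall>a\<in>A - B. norm (x - b) \<le> norm (x - a)}"

text \<open>When \<open>A\<close> is not generic, \<open>vdom A B\<close> can be a single vertex or edge; only the
  two-dimensional regions are tiles. For \<open>k = 0\<close> the whole plane is the only tile.\<close>

definition Vor :: "nat \<Rightarrow> plane set \<Rightarrow> plane set set" where
  "Vor k A = {vdom A B | B. B \<subseteq> A \<and> finite B \<and> card B = k \<and> interior (vdom A B) \<noteq> {}}"

definition overlay :: "plane set set \<Rightarrow> plane set set \<Rightarrow> plane set set" where
  "overlay S T = {P \<inter> Q | P Q. P \<in> S \<and> Q \<in> T \<and> interior (P \<inter> Q) \<noteq> {}}"

definition Bri :: "nat \<Rightarrow> plane set \<Rightarrow> plane set set" where
  "Bri k A = overlay (Vor (k - 1) A) (Vor k A)"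

definition lift :: "plane \<Rightarrow> plane \<times> real" where
  "lift a = (a, (norm a)\<^sup>2)"

text \<open>Lower facets are those with a supporting plane that is not vertical and bounds the set
  from below, i.e. whose outer normal can be scaled to \<open>(u, -1)\<close>.\<close>

definition lower_facet :: "(plane \<times> real) set \<Rightarrow> (plane \<times> real) set \<Rightarrow> bool" where
  "lower_facet C F \<longleftrightarrow> aff_dim F = 2 \<and>
     (\<exists>u c. C \<subseteq> {y. (u, -1) \<bullet> y \<le> c} \<and> F = C \<inter> {y. (u, -1) \<bullet> y = c})"

definition lower_projection :: "(plane \<times> real) set \<Rightarrow> plane set set" where
  "lower_projection X = {fst ` F | F. lower_facet (convex hull X) F}"

definition Del :: "nat \<Rightarrow> plane set \<Rightarrow> plane set set" where
  "Del k A = lower_projection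
     {(1 / real k) *\<^sub>R (\<Sum>a\<in>B. lift a) | B. B \<subseteq> A \<and> finite B \<and> card B = k}"

definition Igl :: "nat \<Rightarrow> plane set \<Rightarrow> plane set set" where
  "Igl k A = lower_projection
     {(1 / (2 * real k - 1)) *\<^sub>R lift b + (2 / (2 * real k - 1)) *\<^sub>R (\<Sum>a\<in>B - {b}. lift a) | B b.
        B \<subseteq> A \<and> finite B \<and> card B = k \<and> b \<in> B}"

end

theory Submission
  imports Defs
begin

text \<open>
  Locally at a point \<open>x\<close>, all four tessellations are governed by the circles around \<open>x\<close>: if such a
  circle encloses \<open>n\<close> points of \<open>A\<close> and passes through the points of \<open>S\<close>, then the tiles of order \<open>k\<close>
  with corner \<open>x\<close> and the corners of the dual tile of \<open>x\<close> correspond to ways of choosing \<open>k - n\<close> points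
  of \<open>S\<close>, and their angles are supplementary. For \<open>Bri\<close> they are bounded below by inscribed
  angles of \<open>S\<close>, and the least inscribed angle occurs as soon as \<open>2 \<le> k - n < card S\<close>; in the
  generic case, where \<open>S\<close> is a triangle, all of them are angles of this triangle or supplements.

  To go from \<open>k\<close> to \<open>k + 1\<close>, take an inscribed angle over a chord \<open>ab\<close> and move the center of the
  circle through \<open>a\<close> and \<open>b\<close> to the side of the angle. The angle decreases, and because every
  half-plane contains infinitely many points of \<open>A\<close>, the number of enclosed points tends to infinity.
  Stopping as soon as it is large enough gives an inscribed angle that is not larger and belongs
  to order \<open>k + 1\<close>.
\<close>

section \<open>Angles and cones in the plane\<close>

text \<open>Only two sets of angles have to be compared. The angles of \<open>Igl\<close> are
  \<open>zone_angles\<close> and those of \<open>Bri\<close> their supplements; \<open>Del\<close>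
  and \<open>Vor\<close> are related to \<open>cell_angles\<close> in the same way. Supplements
  exchange infimum and supremum, so it suffices to find for each angle of order \<open>k\<close> one
  of order \<open>k + 1\<close> that is at least as large (zones) or at most as large (zones and
  cells). The sets must also be shown to be nonempty.

  For larger zone angles, arbitrary circles can be handled: a zone angle lies between two chords at
  \<open>b\<close>, so it is an inscribed angle or the supplement of one, and since two angles of a
  triangle add up to at most \<pi>, in both cases it is bounded by the supplement of an inscribed
  angle. For smaller angles it matters which of the two occurs, and here genericity leaves a short
  list of cases, one for each number of points chosen from a triangle.

  The circles through \<open>a\<close> and \<open>b\<close> are parametrized by the cotangent of the
  inscribed angle. Enclosure of a point is then an affine condition on the parameter, and
  comparisons of angles become polynomial inequalities.\<close>

definition cross :: "plane \<Rightarrow> plane \<Rightarrow> real" where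
  "cross u v = u $ 1 * v $ 2 - u $ 2 * v $ 1"

definition rot :: "plane \<Rightarrow> plane" where
  "rot u = vector [- u $ 2, u $ 1]"

definition cone2 :: "plane \<Rightarrow> plane \<Rightarrow> plane set" where
  "cone2 u v = {s *\<^sub>R u + t *\<^sub>R v | s t. s \<ge> 0 \<and> t \<ge> 0}"

lemma inner_plane: "u \<bullet> v = u $ 1 * v $ 1 + u $ 2 * v $ 2" for u v :: plane
  by (simp add: inner_vec_def sum_2)

lemma rot_nth [simp]: "rot u $ 1 = - u $ 2" "rot u $ 2 = u $ 1"
  by (simp_all add: rot_def)

lemma inner_rot: "rot u \<bullet> v = cross u v"
  by (simp add: inner_plane cross_def)

lemma plane_eq_iff: "u = v \<longleftrightarrow> u $ 1 = v $ 1 \<and> u $ 2 = v $ 2" for u v :: plane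
  by (simp add: vec_eq_iff forall_2)

lemma rot_eq_0_iff [simp]: "rot u = 0 \<longleftrightarrow> u = 0"
  by (auto simp: plane_eq_iff)

lemma cross_self [simp]: "cross u u = 0"
  by (simp add: cross_def)

lemma cross_zero [simp]: "cross 0 u = 0" "cross u 0 = 0"
  by (simp_all add: cross_def)

lemma cross_commute: "cross v u = - cross u v"
  by (simp add: cross_def)

lemma cross_minus [simp]: "cross (- u) v = - cross u v" "cross u (- v) = - cross u v"
  by (simp_all add: cross_def)

lemma cross_scaleR [simp]: "cross (s *\<^sub>R u) v = s * cross u v" "cross u (s *\<^sub>R v) = s * cross u v"
  by (simp_all add: cross_def algebra_simps)

lemma cross_add: "cross (u + u') v = cross u v + cross u' v" "cross u (v + v') = cross u v + cross u v'"
  by (simp_all add: cross_def algebra_simps)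

lemma cross_diff: "cross (u - u') v = cross u v - cross u' v" "cross u (v - v') = cross u v - cross u v'"
  by (simp_all add: cross_def algebra_simps)

text \<open>Cramer's rule.\<close>

lemma cross_decomposition:
  assumes "cross u v \<noteq> 0"
  shows "w = (cross w v / cross u v) *\<^sub>R u + (cross u w / cross u v) *\<^sub>R v"
proof -
  have "cross u v *\<^sub>R w = cross w v *\<^sub>R u + cross u w *\<^sub>R v"
    by (simp add: plane_eq_iff cross_def algebra_simps)
  then have "w = (1 / cross u v) *\<^sub>R (cross w v *\<^sub>R u + cross u w *\<^sub>R v)"
    using assms by (metis divide_self_if scaleR_one scaleR_scaleR times_divide_eq_left mult_1)
  then show ?thesis
    by (simp add: scaleR_add_right)
qed

text \<open>Lagrange's identity: \<open>u \<bullet> v\<close> and \<open>cross u v\<close> are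
  proportional to the cosine and the sine.\<close>

lemma inner_cross_squares: "(u \<bullet> v)\<^sup>2 + (cross u v)\<^sup>2 = (norm u)\<^sup>2 * (norm v)\<^sup>2"
  unfolding power2_norm_eq_inner
  by (simp add: inner_plane cross_def power2_eq_square algebra_simps)

lemma mem_cone2_iff:
  assumes "cross u v > 0"
  shows "w \<in> cone2 u v \<longleftrightarrow> cross w v \<ge> 0 \<and> cross u w \<ge> 0"
proof
  assume "w \<in> cone2 u v"
  then obtain s t where "s \<ge> 0" "t \<ge> 0" "w = s *\<^sub>R u + t *\<^sub>R v"
    by (auto simp: cone2_def)
  then show "cross w v \<ge> 0 \<and> cross u w \<ge> 0"
    using assms by (simp add: cross_add)
next
  assume "cross w v \<ge> 0 \<and> cross u w \<ge> 0"
  then show "w \<in> cone2 u v"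
    unfolding cone2_def using cross_decomposition[of u v w] assms
    by (intro CollectI exI[of _ "cross w v / cross u v"] exI[of _ "cross u w / cross u v"]) auto
qed

lemma cone2_zero: "0 \<in> cone2 u v"
  unfolding cone2_def by (intro CollectI exI[of _ 0]) simp

lemma cone2_add: "x \<in> cone2 u v \<Longrightarrow> y \<in> cone2 u v \<Longrightarrow> x + y \<in> cone2 u v"
  unfolding cone2_def
proof clarify
  fix s t s' t' :: real
  assume "0 \<le> s" "0 \<le> t" "0 \<le> s'" "0 \<le> t'"
  then show "\<exists>sa ta. s *\<^sub>R u + t *\<^sub>R v + (s' *\<^sub>R u + t' *\<^sub>R v) = sa *\<^sub>R u + ta *\<^sub>R v \<and> 0 \<le> sa \<and> 0 \<le> ta"
    by (intro exI[of _ "s + s'"] exI[of _ "t + t'"]) (simp add: algebra_simps)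
qed

lemma cone2_scaleR: "x \<in> cone2 u v \<Longrightarrow> c \<ge> 0 \<Longrightarrow> c *\<^sub>R x \<in> cone2 u v"
  unfolding cone2_def
proof clarify
  fix s t :: real
  assume "0 \<le> c" "0 \<le> s" "0 \<le> t"
  then show "\<exists>sa ta. c *\<^sub>R (s *\<^sub>R u + t *\<^sub>R v) = sa *\<^sub>R u + ta *\<^sub>R v \<and> 0 \<le> sa \<and> 0 \<le> ta"
    by (intro exI[of _ "c * s"] exI[of _ "c * t"]) (simp add: algebra_simps)
qed

lemma convex_cone_cone2: "convex_cone (cone2 u v)"
  unfolding convex_cone_iff by (auto intro: cone2_zero cone2_add cone2_scaleR)

lemma convex_cone2: "convex (cone2 u v)"
  using convex_cone_cone2 by (simp add: convex_cone_def)

lemma cone2_commute: "cone2 u v = cone2 v u"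
proof -
  have "cone2 u v \<subseteq> cone2 v u" for u v
    unfolding cone2_def
  proof clarify
    fix s t :: real
    assume "s \<ge> 0" "t \<ge> 0"
    then show "\<exists>s' t'. s *\<^sub>R u + t *\<^sub>R v = s' *\<^sub>R v + t' *\<^sub>R u \<and> 0 \<le> s' \<and> 0 \<le> t'"
      by (intro exI[of _ t] exI[of _ s]) (simp add: add.commute)
  qed
  then show ?thesis
    by blast
qed

section \<open>Unoriented angles and their comparison\<close>

lemma vangle_cos_abs_le: "\<bar>(u \<bullet> v) / (norm u * norm v)\<bar> \<le> 1"
  using Cauchy_Schwarz_ineq2[of u v] by (simp add: divide_le_eq)

lemma vangle_bounds: "0 \<le> vangle u v" "vangle u v \<le> pi"
  using vangle_cos_abs_le[of u v] unfolding vangle_def abs_le_iff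
  by (auto intro!: arccos_lbound arccos_ubound)

lemma vangle_commute: "vangle u v = vangle v u"
  by (simp add: vangle_def inner_commute mult.commute)

lemma vangle_minus_left: "vangle (- u) v = pi - vangle u v"
  using vangle_cos_abs_le[of u v] unfolding vangle_def abs_le_iff
  by (simp add: arccos_minus)

lemma vangle_minus_right: "vangle u (- v) = pi - vangle u v"
  using vangle_minus_left[of v u] by (simp add: vangle_commute)

lemma vangle_scaleR: "s > 0 \<Longrightarrow> t > 0 \<Longrightarrow> vangle (s *\<^sub>R u) (t *\<^sub>R v) = vangle u v"
  by (simp add: vangle_def)

lemma vangle_rot: "vangle (rot u) (rot v) = vangle u v"
proof -
  have "rot u \<bullet> rot v = u \<bullet> v" for u v
    by (simp add: inner_plane)
  then show ?thesis
    by (simp add: vangle_def norm_eq_sqrt_inner)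
qed

text \<open>The quotient is the cotangent of the angle. As arctan is strictly increasing, comparing
  two angles means comparing two quotients, which \<open>vangle_mono\<close> and
  \<open>vangle_strict_mono\<close> state without denominators.\<close>

lemma vangle_eq_arctan:
  assumes "cross u v \<noteq> 0"
  shows "vangle u v = pi / 2 - arctan ((u \<bullet> v) / \<bar>cross u v\<bar>)"
proof -
  define t where "t = (u \<bullet> v) / \<bar>cross u v\<bar>"
  have "norm u * norm v = sqrt ((u \<bullet> v)\<^sup>2 + (cross u v)\<^sup>2)"
    by (simp add: inner_cross_squares real_sqrt_mult)
  also have "(u \<bullet> v)\<^sup>2 + (cross u v)\<^sup>2 = (cross u v)\<^sup>2 * (1 + t\<^sup>2)"
    using assms by (simp add: t_def field_simps power2_eq_square)
  also have "sqrt \<dots> = \<bar>cross u v\<bar> * sqrt (1 + t\<^sup>2)"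
    by (simp add: real_sqrt_mult)
  finally have "(u \<bullet> v) / (norm u * norm v) = t / sqrt (1 + t\<^sup>2)"
    by (simp add: t_def)
  also have "\<dots> = cos (pi / 2 - arctan t)"
    by (simp add: sin_arctan cos_diff)
  finally show ?thesis
    unfolding vangle_def t_def[symmetric] using arctan_bounded[of t] by (simp add: arccos_cos)
qed

lemma vangle_mono:
  assumes "cross u v \<noteq> 0" "cross u' v' \<noteq> 0"
    and "(u' \<bullet> v') * \<bar>cross u v\<bar> \<le> (u \<bullet> v) * \<bar>cross u' v'\<bar>"
  shows "vangle u v \<le> vangle u' v'"
  using assms by (simp add: vangle_eq_arctan arctan_le_iff field_simps)

lemma vangle_strict_mono:
  assumes "cross u v \<noteq> 0" "cross u' v' \<noteq> 0"
    and "(u' \<bullet> v') * \<bar>cross u v\<bar> < (u \<bullet> v) * \<bar>cross u' v'\<bar>"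
  shows "vangle u v < vangle u' v'"
  using assms by (simp add: vangle_eq_arctan arctan_less_iff field_simps)

text \<open>Negating \<open>c - a\<close> turns the angle at \<open>a\<close> into the exterior
  angle. It has the same \<open>cross\<close> as the angle at \<open>c\<close>, and the inner
  products differ by the squared length of \<open>a - c\<close>.\<close>

lemma triangle_two_angles_le:
  assumes "cross (a - c) (b - c) \<noteq> 0"
  shows "vangle (a - c) (b - c) \<le> pi - vangle (c - a) (b - a)"
proof -
  have "vangle (a - c) (b - c) \<le> vangle (- (c - a)) (b - a)"
  proof (rule vangle_mono)
    have *: "cross (- (c - a)) (b - a) = cross (a - c) (b - c)"
      by (simp add: cross_def algebra_simps)
    show "cross (- (c - a)) (b - a) \<noteq> 0"
      using assms * by simp
    have "(a - c) \<bullet> (b - c) = (- (c - a)) \<bullet> (b - a) + (a - c) \<bullet> (a - c)"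
      by (simp add: inner_plane algebra_simps)
    then have "(- (c - a)) \<bullet> (b - a) \<le> (a - c) \<bullet> (b - c)"
      by simp
    then show "(- (c - a)) \<bullet> (b - a) * \<bar>cross (a - c) (b - c)\<bar>
        \<le> (a - c) \<bullet> (b - c) * \<bar>cross (- (c - a)) (b - a)\<bar>"
      unfolding * by (intro mult_right_mono) auto
  qed (use assms in simp)
  then show ?thesis
    by (simp only: vangle_minus_left)
qed

text \<open>The angle of the cone spanned by \<open>E\<close>; the set is empty if this cone is not proper.\<close>

definition extreme_angles :: "plane set \<Rightarrow> real set" where
  "extreme_angles E = {vangle e f | e f. e \<in> E \<and> f \<in> E \<and> cross e f \<noteq> 0 \<and> E \<subseteq> cone2 e f}"

lemma extreme_anglesE:
  assumes "\<theta> \<in> extreme_angles E"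
  obtains e f where "e \<in> E" "f \<in> E" "cross e f > 0" "E \<subseteq> cone2 e f" "\<theta> = vangle e f"
proof -
  obtain e f where ef: "e \<in> E" "f \<in> E" "cross e f \<noteq> 0" "E \<subseteq> cone2 e f" "\<theta> = vangle e f"
    using assms unfolding extreme_angles_def by blast
  show ?thesis
  proof (cases "cross e f > 0")
    case True
    then show ?thesis
      using that ef by blast
  next
    case False
    then have "cross f e > 0"
      using ef(3) cross_commute[of e f] by simp
    then show ?thesis
      using that[of f e] ef cone2_commute[of e f] vangle_commute[of e f] by simp
  qed
qed

lemma extreme_angles_uminus: "extreme_angles (uminus ` E) \<subseteq> extreme_angles E"
proof
  fix \<theta>
  assume "\<theta> \<in> extreme_angles (uminus ` E)"
  then obtain e f where ef: "e \<in> E" "f \<in> E" "cross e f \<noteq> 0" "uminus ` E \<subseteq> cone2 (- e) (- f)"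
      "\<theta> = vangle (- e) (- f)"
    unfolding extreme_angles_def by auto
  have "E \<subseteq> cone2 e f"
  proof
    fix x
    assume "x \<in> E"
    then have "- x \<in> cone2 (- e) (- f)"
      using ef by auto
    then obtain s t where "s \<ge> 0" "t \<ge> 0" "- x = s *\<^sub>R - e + t *\<^sub>R - f"
      unfolding cone2_def by blast
    then have "- x = - (s *\<^sub>R e + t *\<^sub>R f)"
      by simp
    then have "x = s *\<^sub>R e + t *\<^sub>R f"
      by (simp only: neg_equal_iff_equal)
    then show "x \<in> cone2 e f"
      unfolding cone2_def using \<open>s \<ge> 0\<close> \<open>t \<ge> 0\<close> by blast
  qed
  then show "\<theta> \<in> extreme_angles E"
    unfolding extreme_angles_def using ef by (auto simp: vangle_minus_left vangle_minus_right)
qed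

lemma finite_argmin:
  fixes f :: "'a \<Rightarrow> real"
  assumes "finite S" "S \<noteq> {}"
  shows "\<exists>x\<in>S. \<forall>y\<in>S. f x \<le> f y"
  using arg_min_if_finite(1)[OF assms] arg_min_least[OF assms] by blast

lemma finite_argmax:
  fixes f :: "'a \<Rightarrow> real"
  assumes "finite S" "S \<noteq> {}"
  shows "\<exists>x\<in>S. \<forall>y\<in>S. f y \<le> f x"
  using finite_argmin[OF assms, of "\<lambda>x. - f x"] by simp

text \<open>All of \<open>E\<close> lies in the open half-plane around \<open>d\<close>, so its
  directions are linearly ordered: \<open>\<kappa> e\<close> is the tangent of the signed angle from
  \<open>d\<close> to \<open>e\<close>. Vectors with least and greatest \<open>\<kappa>\<close> span
  the cone, and a nonparallel pair makes these values differ.\<close>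

lemma extreme_angles_exist:
  assumes "finite E" and d: "\<And>e. e \<in> E \<Longrightarrow> d \<bullet> e > 0"
    and e0: "e0 \<in> E" "f0 \<in> E" "cross e0 f0 \<noteq> 0"
  shows "\<exists>e f. e \<in> E \<and> f \<in> E \<and> cross e f > 0 \<and> E \<subseteq> cone2 e f"
proof -
  define \<kappa> where "\<kappa> e = cross d e / (d \<bullet> e)" for e
  have key: "cross e f * (d \<bullet> d) = (d \<bullet> e) * (d \<bullet> f) * (\<kappa> f - \<kappa> e)" if "e \<in> E" "f \<in> E" for e f
  proof -
    have "(d \<bullet> e) * (d \<bullet> f) * (\<kappa> f - \<kappa> e) = (d \<bullet> e) * cross d f - cross d e * (d \<bullet> f)"
      using d[OF that(1)] d[OF that(2)] by (simp add: \<kappa>_def field_simps)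
    then show ?thesis
      by (simp add: inner_plane cross_def algebra_simps)
  qed
  have dd: "d \<bullet> d > 0"
    using d[OF e0(1)] by (metis inner_gt_zero_iff inner_zero_left less_irrefl)
  have nonneg: "cross e f \<ge> 0" if "e \<in> E" "f \<in> E" "\<kappa> e \<le> \<kappa> f" for e f
  proof -
    have "cross e f * (d \<bullet> d) \<ge> 0"
      unfolding key[OF that(1,2)] using d[OF that(1)] d[OF that(2)] that(3) by simp
    then show ?thesis
      using dd by (simp add: zero_le_mult_iff)
  qed
  obtain e where e: "e \<in> E" "\<And>x. x \<in> E \<Longrightarrow> \<kappa> e \<le> \<kappa> x"
    using finite_argmin[of E \<kappa>] assms(1) e0(1) by blast
  obtain f where f: "f \<in> E" "\<And>x. x \<in> E \<Longrightarrow> \<kappa> x \<le> \<kappa> f"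
    using finite_argmax[of E \<kappa>] assms(1) e0(1) by blast
  have "\<kappa> e0 \<noteq> \<kappa> f0"
    using key[OF e0(1,2)] e0(3) dd by auto
  then have "\<kappa> e < \<kappa> f"
    using e(2)[OF e0(1)] e(2)[OF e0(2)] f(2)[OF e0(1)] f(2)[OF e0(2)] by linarith
  then have "cross e f * (d \<bullet> d) > 0"
    unfolding key[OF e(1) f(1)] using d[OF e(1)] d[OF f(1)] by simp
  then have "cross e f > 0"
    using dd by (simp add: zero_less_mult_iff)
  moreover have "E \<subseteq> cone2 e f"
    using nonneg e f by (auto simp: mem_cone2_iff[OF \<open>cross e f > 0\<close>])
  ultimately show ?thesis
    using e f by blast
qed

section \<open>Corners of convex sets\<close>

definition angles_at :: "plane set \<Rightarrow> plane \<Rightarrow> real set" where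
  "angles_at P v = {vangle (p - v) (q - v) | p q. v extreme_point_of P \<and> p \<noteq> q \<and>
     closed_segment v p edge_of P \<and> closed_segment v q edge_of P}"

lemma interior_angles_eq_Union: "interior_angles P = (\<Union>v. angles_at P v)"
  unfolding interior_angles_def angles_at_def by blast

text \<open>The line through \<open>v\<close> with normal \<open>n\<close> supports \<open>P\<close>
  and cuts it in a part of the ray. Closedness and the excluded point at \<open>m\<close> make this
  part a segment, the point at \<open>s\<close> makes it nondegenerate. \<open>P\<close> is not
  assumed to be a polyhedron, because the regions of the tilings arise as intersections of
  infinitely many half-planes.\<close>

lemma ray_edge:
  assumes "convex P" "closed P" "v \<in> P" and "e \<noteq> 0"
    and "s > 0" "v + s *\<^sub>R e \<in> P" and "m > 0" "v + m *\<^sub>R e \<notin> P"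
    and supp: "\<And>y. y \<in> P \<Longrightarrow> n \<bullet> (y - v) \<ge> 0"
    and ray: "\<And>y. y \<in> P \<Longrightarrow> n \<bullet> (y - v) = 0 \<Longrightarrow> \<exists>r\<ge>0. y = v + r *\<^sub>R e"
    and ne: "n \<bullet> e = 0"
  shows "\<exists>t>0. closed_segment v (v + t *\<^sub>R e) edge_of P"
proof -
  define Q where "Q = {r. r \<ge> 0 \<and> v + r *\<^sub>R e \<in> P}"
  have conv: "r \<in> Q" if "0 \<le> r" "r \<le> r'" "v + r' *\<^sub>R e \<in> P" for r r'
  proof (cases "r' = 0")
    case False
    then have "v + r *\<^sub>R e = (1 - r / r') *\<^sub>R v + (r / r') *\<^sub>R (v + r' *\<^sub>R e)"
      by (simp add: algebra_simps)
    also have "\<dots> \<in> P"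
      using that False \<open>convex P\<close> \<open>v \<in> P\<close> by (intro convexD) (auto simp: field_simps)
    finally show ?thesis
      using that by (simp add: Q_def)
  qed (use that in \<open>auto simp: Q_def\<close>)
  have "Q \<subseteq> {0..m}"
  proof
    fix r
    assume "r \<in> Q"
    then have "\<not> m \<le> r"
      using conv[of m r] \<open>m > 0\<close> \<open>v + m *\<^sub>R e \<notin> P\<close> by (auto simp: Q_def)
    then show "r \<in> {0..m}"
      using \<open>r \<in> Q\<close> by (simp add: Q_def)
  qed
  moreover have "closed Q"
  proof -
    have "Q = {0..} \<inter> (\<lambda>r. v + r *\<^sub>R e) -` P"
      by (auto simp: Q_def)
    moreover have "closed ((\<lambda>r. v + r *\<^sub>R e) -` P)"
      by (intro continuous_closed_vimage \<open>closed P\<close> continuous_intros)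
    ultimately show ?thesis
      by auto
  qed
  ultimately have "compact Q"
    using compact_eq_bounded_closed bounded_subset bounded_closed_interval by blast
  moreover have "s \<in> Q"
    using assms by (simp add: Q_def)
  ultimately obtain t where t: "t \<in> Q" "\<And>r. r \<in> Q \<Longrightarrow> r \<le> t"
    using compact_attains_sup[of Q] by blast
  then have "t > 0"
    using \<open>s \<in> Q\<close> \<open>s > 0\<close> by force
  have seg: "closed_segment v (v + t *\<^sub>R e) = P \<inter> {y. n \<bullet> y = n \<bullet> v}"
  proof (intro equalityI subsetI)
    fix y
    assume "y \<in> closed_segment v (v + t *\<^sub>R e)"
    then obtain u where u: "0 \<le> u" "u \<le> 1" "y = (1 - u) *\<^sub>R v + u *\<^sub>R (v + t *\<^sub>R e)"
      by (auto simp: in_segment)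
    then have "y = v + (u * t) *\<^sub>R e"
      by (simp add: algebra_simps)
    moreover have "u * t \<in> Q"
      using conv[of "u * t" t] u t(1) \<open>t > 0\<close> by (auto simp: Q_def mult_left_le_one_le)
    ultimately show "y \<in> P \<inter> {y. n \<bullet> y = n \<bullet> v}"
      using ne by (simp add: Q_def inner_add_right)
  next
    fix y
    assume "y \<in> P \<inter> {y. n \<bullet> y = n \<bullet> v}"
    then obtain r where r: "r \<ge> 0" "y = v + r *\<^sub>R e" "y \<in> P"
      using ray[of y] by (auto simp: inner_diff_right)
    then have "r \<le> t"
      by (intro t(2)) (simp add: Q_def)
    moreover have "y = (1 - r / t) *\<^sub>R v + (r / t) *\<^sub>R (v + t *\<^sub>R e)"
      using r(2) \<open>t > 0\<close> by (simp add: algebra_simps)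
    ultimately show "y \<in> closed_segment v (v + t *\<^sub>R e)"
      unfolding in_segment using r(1) \<open>t > 0\<close> by (intro exI[of _ "r / t"]) auto
  qed
  have "closed_segment v (v + t *\<^sub>R e) face_of P"
    unfolding seg using supp
    by (intro face_of_Int_supporting_hyperplane_ge \<open>convex P\<close>) (auto simp: inner_diff_right)
  moreover have "aff_dim (closed_segment v (v + t *\<^sub>R e)) = 1"
    using \<open>t > 0\<close> \<open>e \<noteq> 0\<close> by (simp add: segment_convex_hull aff_dim_convex_hull)
  ultimately show ?thesis
    using \<open>t > 0\<close> unfolding edge_of_def by auto
qed

text \<open>Of two different endpoints on a ray, the nearer one lies inside the longer segment; the
  face property of the shorter segment then forces the farther endpoint into it.\<close>

lemma edge_same_ray_unique:
  assumes "closed_segment v p edge_of P" "closed_segment v q edge_of P"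
    and "p = v + s *\<^sub>R e" "q = v + t *\<^sub>R e" "0 < s" "0 < t" "e \<noteq> 0"
  shows "p = q"
proof -
  have False if "0 < s" "s < t" "p = v + s *\<^sub>R e" "q = v + t *\<^sub>R e"
    "closed_segment v p face_of P" "closed_segment v q face_of P" for s t p q
  proof -
    have "p = (1 - s / t) *\<^sub>R v + (s / t) *\<^sub>R q"
      using that by (simp add: algebra_simps)
    moreover have "v \<noteq> q"
      using that \<open>e \<noteq> 0\<close> by simp
    ultimately have "p \<in> open_segment v q"
      unfolding in_segment using that(1,2) by (intro conjI exI[of _ "s / t"]) auto
    moreover have "v \<in> P" "q \<in> P"
      using face_of_imp_subset[OF that(6)] by auto
    ultimately have "q \<in> closed_segment v p"
      using face_ofD[OF that(5)] by (metis ends_in_segment(2))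
    then obtain u where u: "0 \<le> u" "u \<le> 1" "q = (1 - u) *\<^sub>R v + u *\<^sub>R p"
      by (auto simp: in_segment)
    then have "t *\<^sub>R e = (u * s) *\<^sub>R e"
      using that(3,4) by (simp add: algebra_simps)
    then have "t = u * s"
      using \<open>e \<noteq> 0\<close> by simp
    also have "\<dots> \<le> s"
      using u that(1) by (simp add: mult_left_le_one_le)
    finally show False
      using that by simp
  qed
  then show ?thesis
    using assms unfolding edge_of_def by (metis linorder_neqE_linordered_idom)
qed

lemma edge_in_corner:
  assumes "cross e f \<noteq> 0" and sub: "P \<subseteq> (+) v ` cone2 e f"
    and P: "0 < s" "v + s *\<^sub>R e \<in> P" "0 < t" "v + t *\<^sub>R f \<in> P"
    and "convex P" "v \<in> P" "closed_segment v p edge_of P"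
  shows "\<exists>r>0. p = v + r *\<^sub>R e \<or> p = v + r *\<^sub>R f"
proof -
  have face: "closed_segment v p face_of P"
    using assms by (simp add: edge_of_def)
  have "aff_dim (closed_segment v p) = 1"
    using assms by (simp add: edge_of_def)
  then have "v \<noteq> p"
    by auto
  have "p \<in> P"
    using face_of_imp_subset[OF face] by auto
  then obtain c d where cd: "c \<ge> 0" "d \<ge> 0" "p = v + (c *\<^sub>R e + d *\<^sub>R f)"
    using sub by (auto simp: cone2_def)
  show ?thesis
  proof (cases "c = 0 \<or> d = 0")
    case True
    then show ?thesis
      using cd \<open>v \<noteq> p\<close> by (metis add.right_neutral add_0 less_eq_real_def scaleR_zero_left)
  next
    case False
    then have "c > 0" "d > 0"
      using cd by auto
    \<comment> \<open>\<open>p - v\<close> is \<open>l\<close> times the convex combination of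
      \<open>s *\<^sub>R e\<close> and \<open>t *\<^sub>R f\<close> with weight \<open>w\<close> on
      the latter. Scaling by \<open>\<delta>\<close> keeps the chord from \<open>x\<close> to
      \<open>y\<close> inside \<open>P\<close> (\<open>\<delta> * l \<le> 1\<close>) and its
      crossing point on the edge (\<open>\<delta> \<le> 1\<close>).\<close>
    define l where "l = c / s + d / t"
    have "l > 0"
      using P \<open>c > 0\<close> \<open>d > 0\<close> by (simp add: l_def add_pos_pos)
    define \<delta> where "\<delta> = min 1 (1 / l)"
    have \<delta>: "0 < \<delta>" "\<delta> \<le> 1" "\<delta> * l \<le> 1"
      using \<open>l > 0\<close> by (auto simp: \<delta>_def min_def field_simps)
    define x where "x = v + (\<delta> * l * s) *\<^sub>R e"
    define y where "y = v + (\<delta> * l * t) *\<^sub>R f"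
    have "x = (1 - \<delta> * l) *\<^sub>R v + (\<delta> * l) *\<^sub>R (v + s *\<^sub>R e)" "y = (1 - \<delta> * l) *\<^sub>R v + (\<delta> * l) *\<^sub>R (v + t *\<^sub>R f)"
      by (simp_all add: x_def y_def algebra_simps)
    then have xy: "x \<in> P" "y \<in> P"
      using P \<delta> \<open>l > 0\<close> \<open>convex P\<close> \<open>v \<in> P\<close> by (auto intro!: convexD)
    define w where "w = (d / t) / l"
    have "c / s > 0" "d / t > 0"
      using P \<open>c > 0\<close> \<open>d > 0\<close> by simp_all
    moreover have "0 < y / (x + y) \<and> y / (x + y) < 1" if "0 < x" "0 < y" for x y :: real
      using that by (simp add: add_pos_pos)
    ultimately have w: "0 < w" "w < 1"
      unfolding w_def l_def by blast+
    have wl: "w * l * t = d" "(1 - w) * l * s = c"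
    proof -
      have "w * l = d / t"
        using \<open>l > 0\<close> by (simp add: w_def)
      moreover have "(1 - w) * l = c / s"
        using calculation left_diff_distrib[of 1 w l] by (simp add: l_def)
      ultimately show "w * l * t = d" "(1 - w) * l * s = c"
        using P by simp_all
    qed
    have z: "(1 - w) *\<^sub>R x + w *\<^sub>R y = v + \<delta> *\<^sub>R (p - v)"
    proof -
      have "(1 - w) *\<^sub>R x + w *\<^sub>R y = v + \<delta> *\<^sub>R (((1 - w) * l * s) *\<^sub>R e + (w * l * t) *\<^sub>R f)"
        unfolding x_def y_def by (simp add: algebra_simps)
      then show ?thesis
        unfolding wl using cd(3) by simp
    qed
    have "x \<noteq> y"
    proof
      assume "x = y"
      then have "(\<delta> * l * s) *\<^sub>R e = (\<delta> * l * t) *\<^sub>R f"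
        by (simp add: x_def y_def)
      then have "cross ((\<delta> * l * s) *\<^sub>R e) f = cross ((\<delta> * l * t) *\<^sub>R f) f"
        by simp
      then show False
        using \<open>cross e f \<noteq> 0\<close> \<delta> \<open>l > 0\<close> P by simp
    qed
    then have "v + \<delta> *\<^sub>R (p - v) \<in> open_segment x y"
      unfolding in_segment z[symmetric] using w by blast
    moreover have "v + \<delta> *\<^sub>R (p - v) \<in> closed_segment v p"
      unfolding in_segment using \<delta> by (intro exI[of _ \<delta>]) (simp add: algebra_simps)
    ultimately have "x \<in> closed_segment v p"
      using face_ofD[OF face _ xy] by blast
    then obtain u where "x = (1 - u) *\<^sub>R v + u *\<^sub>R p"
      by (auto simp: in_segment)
    then have eq: "(\<delta> * l * s) *\<^sub>R e = (u * c) *\<^sub>R e + (u * d) *\<^sub>R f"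
      using cd(3) by (simp add: x_def algebra_simps)
    have "cross e ((\<delta> * l * s) *\<^sub>R e) = u * d * cross e f"
      unfolding eq by (simp add: cross_add)
    then have "u = 0"
      using \<open>d > 0\<close> \<open>cross e f \<noteq> 0\<close> by simp
    then have "cross ((\<delta> * l * s) *\<^sub>R e) f = 0"
      unfolding eq by simp
    then show ?thesis
      using \<open>cross e f \<noteq> 0\<close> \<delta> \<open>l > 0\<close> P by simp
  qed
qed

text \<open>Serves the hulls of the mosaics and the regions of the tilings alike: \<open>P\<close>
  lies in a cone, meets both of its boundary rays and eventually leaves each of them, so exactly two
  edges start at \<open>v\<close>.\<close>

lemma angles_at_corner:
  assumes "convex P" "closed P" "cross e f > 0" "v \<in> P" and sub: "P \<subseteq> (+) v ` cone2 e f"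
    and s: "0 < s" "v + s *\<^sub>R e \<in> P" and t: "0 < t" "v + t *\<^sub>R f \<in> P"
    and m: "m > 0" "v + m *\<^sub>R e \<notin> P" and n: "n > 0" "v + n *\<^sub>R f \<notin> P"
  shows "angles_at P v = {vangle e f}"
proof -
  have [simp]: "e \<noteq> 0" "f \<noteq> 0"
    using assms(3) by auto
  have coords: "cross e (y - v) \<ge> 0 \<and> cross (y - v) f \<ge> 0" if "y \<in> P" for y
    using that sub by (auto simp: mem_cone2_iff[OF assms(3)])
  have decomp: "y = v + ((cross (y - v) f / cross e f) *\<^sub>R e + (cross e (y - v) / cross e f) *\<^sub>R f)" for y
    using cross_decomposition[of e f "y - v"] assms(3) by (simp add: algebra_simps)
  obtain p where p: "p > 0" "closed_segment v (v + p *\<^sub>R e) edge_of P"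
  proof -
    have "\<exists>t>0. closed_segment v (v + t *\<^sub>R e) edge_of P"
    proof (rule ray_edge[where n = "rot e"])
      show "\<exists>r\<ge>0. y = v + r *\<^sub>R e" if "y \<in> P" "rot e \<bullet> (y - v) = 0" for y
        using coords[OF that(1)] that(2) decomp[of y] assms(3) unfolding inner_rot
        by (intro exI[of _ "cross (y - v) f / cross e f"]) simp
    qed (use assms coords in \<open>auto simp: inner_rot\<close>)
    then show ?thesis using that by blast
  qed
  obtain q where q: "q > 0" "closed_segment v (v + q *\<^sub>R f) edge_of P"
  proof -
    have "\<exists>t>0. closed_segment v (v + t *\<^sub>R f) edge_of P"
    proof (rule ray_edge[where n = "- rot f"])
      show "\<exists>r\<ge>0. y = v + r *\<^sub>R f" if "y \<in> P" "- rot f \<bullet> (y - v) = 0" for y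
      proof -
        have "cross (y - v) f = 0"
          using that(2) cross_commute[of f "y - v"] by (simp add: inner_rot)
        then show ?thesis
          using coords[OF that(1)] decomp[of y] assms(3)
          by (intro exI[of _ "cross e (y - v) / cross e f"]) simp
      qed
      show "- rot f \<bullet> (y - v) \<ge> 0" if "y \<in> P" for y
        using coords[OF that] cross_commute[of f "y - v"] by (simp add: inner_rot)
    qed (use assms in \<open>auto simp: inner_rot\<close>)
    then show ?thesis using that by blast
  qed
  \<comment> \<open>The two edges meet only in \<open>v\<close>, and an intersection of faces is a
    face; hence \<open>v\<close> is an extreme point.\<close>
  have "closed_segment v (v + p *\<^sub>R e) \<inter> closed_segment v (v + q *\<^sub>R f) = {v}"
  proof (intro equalityI subsetI)
    fix y
    assume "y \<in> closed_segment v (v + p *\<^sub>R e) \<inter> closed_segment v (v + q *\<^sub>R f)"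
    then obtain i j where "y = (1 - i) *\<^sub>R v + i *\<^sub>R (v + p *\<^sub>R e)" "y = (1 - j) *\<^sub>R v + j *\<^sub>R (v + q *\<^sub>R f)"
      unfolding Int_iff in_segment by blast
    then have y: "y = v + (i * p) *\<^sub>R e" "y = v + (j * q) *\<^sub>R f"
      by (simp_all add: algebra_simps)
    then have "cross ((i * p) *\<^sub>R e) f = cross ((j * q) *\<^sub>R f) f"
      by (metis add_left_cancel)
    then have "i * p = 0"
      using assms(3) by simp
    then show "y \<in> {v}"
      using y by (metis add.right_neutral scaleR_zero_left singletonI)
  qed auto
  moreover have "closed_segment v (v + p *\<^sub>R e) \<inter> closed_segment v (v + q *\<^sub>R f) face_of P"
    using p q by (intro face_of_Int) (simp_all add: edge_of_def)
  ultimately have ext: "v extreme_point_of P"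
    by (simp add: face_of_singleton)
  have "v + p *\<^sub>R e \<noteq> v + q *\<^sub>R f"
  proof
    assume "v + p *\<^sub>R e = v + q *\<^sub>R f"
    then have "cross (p *\<^sub>R e) f = cross (q *\<^sub>R f) f"
      by simp
    then show False
      using p assms(3) by simp
  qed
  moreover have "vangle (v + p *\<^sub>R e - v) (v + q *\<^sub>R f - v) = vangle e f"
    using p q by (simp add: vangle_scaleR)
  ultimately have "vangle e f \<in> angles_at P v"
    unfolding angles_at_def using p q ext
    by (intro CollectI exI[of _ "v + p *\<^sub>R e"] exI[of _ "v + q *\<^sub>R f"]) auto
  moreover have "\<theta> = vangle e f" if \<theta>_in: "\<theta> \<in> angles_at P v" for \<theta>
  proof -
    obtain p' q' where pq: "p' \<noteq> q'" "closed_segment v p' edge_of P" "closed_segment v q' edge_of P"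
      and \<theta>: "\<theta> = vangle (p' - v) (q' - v)"
      using \<theta>_in unfolding angles_at_def by blast
    have ne: "cross e f \<noteq> 0"
      using assms(3) by simp
    obtain a where a: "a > 0" "p' = v + a *\<^sub>R e \<or> p' = v + a *\<^sub>R f"
      using edge_in_corner[OF ne sub s t assms(1,4) pq(2)] by blast
    obtain b where b: "b > 0" "q' = v + b *\<^sub>R e \<or> q' = v + b *\<^sub>R f"
      using edge_in_corner[OF ne sub s t assms(1,4) pq(3)] by blast
    have "\<not> (p' = v + a *\<^sub>R u \<and> q' = v + b *\<^sub>R u)" if "u \<noteq> 0" for u
      using edge_same_ray_unique[OF pq(2,3) _ _ a(1) b(1) that] pq(1) by blast
    from this[of e] this[of f] a(2) b(2) consider "p' = v + a *\<^sub>R e" "q' = v + b *\<^sub>R f" | "p' = v + a *\<^sub>R f" "q' = v + b *\<^sub>R e"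
      using \<open>e \<noteq> 0\<close> \<open>f \<noteq> 0\<close> by blast
    then show ?thesis
      using a(1) b(1) unfolding \<theta> by cases (simp_all add: vangle_scaleR vangle_commute)
  qed
  ultimately show ?thesis
    by blast
qed

section \<open>Angles of polygons and of regions cut out by bisectors\<close>

lemma affine_hull_corner:
  assumes "cross e f \<noteq> 0" "s \<noteq> 0" "t \<noteq> 0"
  shows "affine hull {v, v + s *\<^sub>R e, v + t *\<^sub>R f} = UNIV"
proof -
  have "x \<in> affine hull {v, v + s *\<^sub>R e, v + t *\<^sub>R f}" for x
  proof -
    define i j where "i = cross (x - v) f / cross e f / s" and "j = cross e (x - v) / cross e f / t"
    have "x - v = (i * s) *\<^sub>R e + (j * t) *\<^sub>R f"
      using cross_decomposition[OF assms(1), of "x - v"] assms by (simp add: i_def j_def)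
    then have "x = v + ((i * s) *\<^sub>R e + (j * t) *\<^sub>R f)"
      by (simp add: algebra_simps)
    then have "x = (1 - i - j) *\<^sub>R v + i *\<^sub>R (v + s *\<^sub>R e) + j *\<^sub>R (v + t *\<^sub>R f)"
      by (simp add: algebra_simps)
    then show ?thesis
      unfolding affine_hull_3 by (intro CollectI exI conjI) auto
  qed
  then show ?thesis
    by blast
qed

text \<open>\<open>gen\<close> keeps the hull inside the cone of \<open>E\<close>,
  \<open>exch\<close> makes it reach every direction of \<open>E\<close>, in particular
  \<open>e\<close> and \<open>f\<close>, and boundedness makes it leave both rays. In the mosaics,
  \<open>E\<close> will consist of the directions of elementary exchanges of points.\<close>

lemma angles_at_convex_hull_corner:
  assumes "finite V" "v \<in> V"
    and gen: "\<And>w. w \<in> V \<Longrightarrow> w - v \<in> convex_cone hull E"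
    and exch: "\<And>e. e \<in> E \<Longrightarrow> \<exists>s>0. v + s *\<^sub>R e \<in> V"
    and ef: "e \<in> E" "f \<in> E" "cross e f > 0" "E \<subseteq> cone2 e f"
  shows "angles_at (convex hull V) v = {vangle e f}"
proof -
  obtain s where s: "s > 0" "v + s *\<^sub>R e \<in> V"
    using exch ef by blast
  obtain t where t: "t > 0" "v + t *\<^sub>R f \<in> V"
    using exch ef by blast
  have "V \<subseteq> (+) v ` cone2 e f"
  proof
    fix w
    assume "w \<in> V"
    then have "w - v \<in> convex_cone hull E"
      by (rule gen)
    also have "\<dots> \<subseteq> cone2 e f"
      using ef(4) by (intro hull_minimal convex_cone_cone2)
    finally have "w - v \<in> cone2 e f" .
    then show "w \<in> (+) v ` cone2 e f"
      by (intro image_eqI[of _ _ "w - v"]) simp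
  qed
  then have sub: "convex hull V \<subseteq> (+) v ` cone2 e f"
    by (intro hull_minimal convex_translation convex_cone2)
  have comp: "compact (convex hull V)"
    using \<open>finite V\<close> by (simp add: finite_imp_compact_convex_hull)
  have out: "\<exists>m>0. v + m *\<^sub>R u \<notin> convex hull V" if "u \<noteq> 0" for u
  proof -
    obtain B where B: "\<And>x. x \<in> convex hull V \<Longrightarrow> norm x \<le> B"
      using compact_imp_bounded[OF comp] bounded_iff by metis
    define m where "m = (\<bar>B\<bar> + norm v + 1) / norm u"
    have "m > 0"
      using that by (simp add: m_def add_nonneg_pos)
    have "norm (m *\<^sub>R u) = \<bar>B\<bar> + norm v + 1"
      using that by (simp add: m_def)
    then have "norm (v + m *\<^sub>R u) > B"
      using norm_triangle_ineq2[of "m *\<^sub>R u" "- v"] by (simp add: add.commute)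
    then show ?thesis
      using B \<open>m > 0\<close> by force
  qed
  have "e \<noteq> 0" "f \<noteq> 0"
    using ef(3) by auto
  obtain m n where "m > 0" "v + m *\<^sub>R e \<notin> convex hull V" "n > 0" "v + n *\<^sub>R f \<notin> convex hull V"
    using out[OF \<open>e \<noteq> 0\<close>] out[OF \<open>f \<noteq> 0\<close>] by blast
  then show ?thesis
    using sub s t ef(3) comp \<open>v \<in> V\<close>
    by (intro angles_at_corner[where s = s and t = t and m = m and n = n])
      (auto simp: compact_imp_closed hull_inc)
qed

lemma angles_at_convex_hull_superset:
  assumes "finite V" "v \<in> V"
    and gen: "\<And>w. w \<in> V \<Longrightarrow> w - v \<in> convex_cone hull E"
    and exch: "\<And>e. e \<in> E \<Longrightarrow> \<exists>s>0. v + s *\<^sub>R e \<in> V"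
    and \<theta>: "\<theta> \<in> extreme_angles E"
  shows "\<theta> \<in> angles_at (convex hull V) v" "aff_dim V = 2"
proof -
  obtain e f where ef: "e \<in> E" "f \<in> E" "cross e f > 0" "E \<subseteq> cone2 e f" "\<theta> = vangle e f"
    using extreme_anglesE[OF \<theta>] .
  show "\<theta> \<in> angles_at (convex hull V) v"
    using angles_at_convex_hull_corner[OF assms(1,2) gen exch ef(1-4)] ef(5) by simp
  obtain s t where st: "s > 0" "v + s *\<^sub>R e \<in> V" "t > 0" "v + t *\<^sub>R f \<in> V"
    using exch[OF ef(1)] exch[OF ef(2)] by blast
  have "UNIV = affine hull {v, v + s *\<^sub>R e, v + t *\<^sub>R f}"
    using ef(3) st by (subst affine_hull_corner) auto
  also have "\<dots> \<subseteq> affine hull V"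
    using st \<open>v \<in> V\<close> by (intro hull_mono) auto
  finally show "aff_dim V = 2"
    using aff_dim_eq_full[of V] by auto
qed

text \<open>A corner of a polytope is exposed, so a supporting line through \<open>v\<close> puts
  all of \<open>E\<close> into an open half-plane. If all vectors of \<open>E\<close> were parallel,
  \<open>V\<close> would lie on a line, contradicting \<open>full\<close>; hence the cone of
  \<open>E\<close> is proper.\<close>

lemma angles_at_convex_hull_subset:
  assumes "finite V" "v \<in> V" "finite E" "0 \<notin> E"
    and gen: "\<And>w. w \<in> V \<Longrightarrow> w - v \<in> convex_cone hull E"
    and exch: "\<And>e. e \<in> E \<Longrightarrow> \<exists>s>0. v + s *\<^sub>R e \<in> V"
    and full: "aff_dim V = 2"
  shows "angles_at (convex hull V) v \<subseteq> extreme_angles E"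
proof
  fix \<theta>
  assume \<theta>: "\<theta> \<in> angles_at (convex hull V) v"
  then have "{v} face_of convex hull V"
    unfolding angles_at_def by (auto simp: face_of_singleton)
  moreover have "polyhedron (convex hull V)"
    using \<open>finite V\<close> by (simp add: polyhedron_convex_hull)
  ultimately have "{v} exposed_face_of convex hull V"
    using exposed_face_of_polyhedron by blast
  then obtain a b where ab: "convex hull V \<subseteq> {x. a \<bullet> x \<le> b}" "{v} = convex hull V \<inter> {x. a \<bullet> x = b}"
    unfolding exposed_face_of_def by blast
  then have "a \<bullet> v = b"
    by blast
  have less: "a \<bullet> w < b" if "w \<in> V" "w \<noteq> v" for w
  proof -
    have "w \<in> convex hull V"
      using that by (simp add: hull_inc)
    then show ?thesis
      using ab that by force
  qed
  have pos: "- a \<bullet> e > 0" if e: "e \<in> E" for e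
  proof -
    obtain s where s: "s > 0" "v + s *\<^sub>R e \<in> V"
      using exch e by blast
    moreover have "e \<noteq> 0"
      using e \<open>0 \<notin> E\<close> by blast
    ultimately have "a \<bullet> (v + s *\<^sub>R e) < b"
      by (intro less) auto
    then show ?thesis
      using \<open>a \<bullet> v = b\<close> s by (simp add: inner_add_right mult_less_0_iff)
  qed
  have "\<exists>e\<in>E. \<exists>f\<in>E. cross e f \<noteq> 0"
  proof (rule ccontr)
    assume contra: "\<not> ?thesis"
    show False
    proof (cases "E = {}")
      case True
      then have "w = v" if "w \<in> V" for w
        using gen[OF that] by simp
      then have "V \<subseteq> {v}"
        by blast
      then show False
        using aff_dim_subset[of V "{v}"] full by simp
    next
      case False
      then obtain e where e: "e \<in> E" by blast
      have "V \<subseteq> {x. rot e \<bullet> x = rot e \<bullet> v}"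
      proof
        fix w
        assume "w \<in> V"
        then have "w - v \<in> convex_cone hull E"
          by (rule gen)
        also have "\<dots> \<subseteq> {x. rot e \<bullet> x = 0}"
          using contra e
          by (intro hull_minimal subspace_imp_convex_cone subspace_hyperplane) (auto simp: inner_rot)
        finally show "w \<in> {x. rot e \<bullet> x = rot e \<bullet> v}"
          by (simp add: inner_diff_right)
      qed
      then have "aff_dim V \<le> aff_dim {x. rot e \<bullet> x = rot e \<bullet> v}"
        by (rule aff_dim_subset)
      moreover have "rot e \<noteq> 0"
        using e \<open>0 \<notin> E\<close> by auto
      ultimately show False
        using full by (simp add: aff_dim_hyperplane)
    qed
  qed
  then obtain e f where ef: "e \<in> E" "f \<in> E" "cross e f > 0" "E \<subseteq> cone2 e f"
    using extreme_angles_exist[OF \<open>finite E\<close> pos] by blast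
  then show "\<theta> \<in> extreme_angles E"
    using \<theta> angles_at_convex_hull_corner[OF assms(1,2) gen exch ef]
    unfolding extreme_angles_def by fastforce
qed

section \<open>Regions defined by distance comparisons, and their corners\<close>

definition closer_region :: "(plane \<times> plane) set \<Rightarrow> plane set" where
  "closer_region R = {y. \<forall>(p, q)\<in>R. norm (y - p) \<le> norm (y - q)}"

text \<open>The inner normals of the bisectors that pass through \<open>v\<close>.\<close>

definition active_dirs :: "(plane \<times> plane) set \<Rightarrow> plane \<Rightarrow> plane set" where
  "active_dirs R v = {p - q | p q. (p, q) \<in> R \<and> norm (v - p) = norm (v - q)}"

lemma closer_iff: "norm (y - p) \<le> norm (y - q) \<longleftrightarrow> (2 *\<^sub>R (q - p)) \<bullet> y \<le> q \<bullet> q - p \<bullet> p"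
  for y p q :: plane
  unfolding norm_le by (auto simp: inner_simps inner_commute)

text \<open>The squares of \<open>w\<close> cancel, which leaves a condition affine in the
  displacement.\<close>

lemma closer_shift:
  "norm (v + w - p) \<le> norm (v + w - q) \<longleftrightarrow> (norm (v - p))\<^sup>2 - (norm (v - q))\<^sup>2 \<le> 2 * (w \<bullet> (p - q))"
  for v w p q :: plane
  unfolding norm_le power2_norm_eq_inner by (auto simp: inner_simps inner_commute)

lemma closer_region_eq_Inter:
  "closer_region R = (\<Inter>(p, q)\<in>R. {y. (2 *\<^sub>R (q - p)) \<bullet> y \<le> q \<bullet> q - p \<bullet> p})"
  unfolding closer_region_def closer_iff by auto

lemma closed_closer_region: "closed (closer_region R)"
  unfolding closer_region_eq_Inter by (intro closed_INT ballI) (auto simp del: inner_scaleR_left intro: closed_halfspace_le)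

lemma convex_closer_region: "convex (closer_region R)"
  unfolding closer_region_eq_Inter by (intro convex_INT) (auto simp del: inner_scaleR_left intro: convex_halfspace_le)

text \<open>Covers cells and zones at once. \<open>R\<close> may be infinite, but the points
  required to be nearer come from the finite set \<open>F\<close>, so only finitely many bisectors
  pass near a given point. The point \<open>b\<close>, nearer than everything outside
  \<open>F\<close>, keeps every ray from staying in the region.\<close>

locale bisector_system =
  fixes A :: "plane set" and R :: "(plane \<times> plane) set" and F :: "plane set" and b :: plane
  assumes locally_finite: "locally_finite A" and coarsely_dense: "coarsely_dense A"
    and finite_F: "finite F" and R_sub: "R \<subseteq> F \<times> A" and irrefl: "(p, p) \<notin> R"
    and b_closer: "q \<in> A - F \<Longrightarrow> (b, q) \<in> R"
begin

lemma finite_active_dirs: "finite (active_dirs R v)"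
proof -
  have "active_dirs R v \<subseteq> (\<lambda>(p, q). p - q) ` (SIGMA p:F. A \<inter> cball v (norm (v - p)))"
    using R_sub unfolding active_dirs_def by (force simp: dist_norm)
  moreover have "finite (SIGMA p:F. A \<inter> cball v (norm (v - p)))"
    using finite_F locally_finite unfolding locally_finite_def by blast
  ultimately show ?thesis
    by (meson finite_imageI finite_subset)
qed

lemma zero_notin_active_dirs: "0 \<notin> active_dirs R v"
  using irrefl unfolding active_dirs_def by auto

lemma inner_active_dirs_nonneg:
  assumes "v \<in> closer_region R" "y \<in> closer_region R" "e \<in> active_dirs R v"
  shows "(y - v) \<bullet> e \<ge> 0"
  using assms closer_shift[of v "y - v"] unfolding active_dirs_def closer_region_def by auto

text \<open>Pairs that are strict at \<open>v\<close> have a common positive gap: only finitely many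
  competitors are within \<open>\<rho> + 1\<close> of \<open>v\<close>, and for all others the gap
  exceeds 1. So only active pairs restrict the direction of a short step.\<close>

lemma exists_step_in_region:
  assumes v: "v \<in> closer_region R" and u: "\<And>e. e \<in> active_dirs R v \<Longrightarrow> u \<bullet> e \<ge> 0"
  shows "\<exists>s>0. v + s *\<^sub>R u \<in> closer_region R"
proof -
  define \<rho> where "\<rho> = (\<Sum>p\<in>F. norm (v - p))"
  define N where "N = {(p, q) \<in> R. norm (v - p) < norm (v - q) \<and> norm (v - q) \<le> \<rho> + 1}"
  have \<rho>: "norm (v - p) \<le> \<rho>" if "p \<in> F" for p
    unfolding \<rho>_def by (rule member_le_sum) (use that finite_F in auto)
  have "N \<subseteq> F \<times> (A \<inter> cball v (\<rho> + 1))"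
    using R_sub by (auto simp: N_def dist_norm)
  then have "finite N"
    using finite_F locally_finite unfolding locally_finite_def
    by (meson finite_SigmaI finite_subset)
  define D where "D = insert 1 ((\<lambda>(p, q). norm (v - q) - norm (v - p)) ` N)"
  define \<delta> where "\<delta> = Min D"
  have "finite D" "D \<noteq> {}"
    using \<open>finite N\<close> by (auto simp: D_def)
  then have "\<delta> > 0"
    unfolding \<delta>_def by (subst Min_gr_iff) (auto simp: D_def N_def)
  have gap: "norm (v - q) - norm (v - p) \<ge> \<delta>" if "(p, q) \<in> R" "norm (v - p) < norm (v - q)" for p q
  proof (cases "norm (v - q) \<le> \<rho> + 1")
    case True
    then have "norm (v - q) - norm (v - p) \<in> D"
      using that by (force simp: D_def N_def)
    then show ?thesis
      using \<open>finite D\<close> by (simp add: \<delta>_def)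
  next
    case False
    moreover have "\<delta> \<le> 1"
      unfolding \<delta>_def using \<open>finite D\<close> by (intro Min_le) (auto simp: D_def)
    ultimately show ?thesis
      using \<rho>[of p] R_sub that by force
  qed
  \<comment> \<open>The step changes a difference of squared distances by at most
    \<open>2 * s * norm u\<close> times the sum of both distances, and initially that difference is
    the gap times the same sum. The summand 1 avoids division by zero.\<close>
  define s where "s = \<delta> / (2 * (norm u + 1))"
  have "s > 0"
    using \<open>\<delta> > 0\<close> by (simp add: s_def add_nonneg_pos)
  have su: "2 * s * norm u \<le> \<delta>"
  proof -
    have "norm u + 1 \<noteq> 0"
      using norm_ge_zero[of u] by linarith
    then have "2 * s * (norm u + 1) = \<delta>"
      unfolding s_def by (metis mult.assoc mult.left_commute nonzero_divide_eq_eq mult_eq_0_iff zero_neq_numeral)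
    then show ?thesis
      using \<open>s > 0\<close> mult_left_mono[of "norm u" "norm u + 1" "2 * s"] by simp
  qed
  have "norm (v + s *\<^sub>R u - p) \<le> norm (v + s *\<^sub>R u - q)" if R: "(p, q) \<in> R" for p q
    unfolding closer_shift
  proof (cases "norm (v - p) = norm (v - q)")
    case True
    then have "p - q \<in> active_dirs R v"
      using R by (auto simp: active_dirs_def)
    then show "(norm (v - p))\<^sup>2 - (norm (v - q))\<^sup>2 \<le> 2 * (s *\<^sub>R u \<bullet> (p - q))"
      using True u \<open>s > 0\<close> by simp
  next
    case False
    then have less: "norm (v - p) < norm (v - q)"
      using v R unfolding closer_region_def by force
    have "norm (p - q) \<le> norm (v - q) + norm (v - p)"
      using norm_triangle_ineq4[of "v - q" "v - p"] by simp
    then have "- (2 * (s *\<^sub>R u \<bullet> (p - q))) \<le> (2 * s * norm u) * (norm (v - q) + norm (v - p))"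
    proof -
      have "- (u \<bullet> (p - q)) \<le> norm u * norm (p - q)"
        using Cauchy_Schwarz_ineq2[of u "p - q"] by linarith
      also have "\<dots> \<le> norm u * (norm (v - q) + norm (v - p))"
        using \<open>norm (p - q) \<le> _\<close> by (intro mult_left_mono) auto
      finally have "(2 * s) * - (u \<bullet> (p - q)) \<le> (2 * s) * (norm u * (norm (v - q) + norm (v - p)))"
        using \<open>s > 0\<close> by (intro mult_left_mono) auto
      then show ?thesis
        by (simp add: algebra_simps)
    qed
    also have "\<dots> \<le> (norm (v - q) - norm (v - p)) * (norm (v - q) + norm (v - p))"
      using su gap[OF R less] by (intro mult_right_mono) auto
    finally show "(norm (v - p))\<^sup>2 - (norm (v - q))\<^sup>2 \<le> 2 * (s *\<^sub>R u \<bullet> (p - q))"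
      by (simp add: power2_eq_square algebra_simps)
  qed
  then show ?thesis
    using \<open>s > 0\<close> unfolding closer_region_def by auto
qed

text \<open>As every half-plane contains infinitely many points of \<open>A\<close>, some
  \<open>q\<close> outside \<open>F\<close> lies beyond \<open>b\<close> in direction
  \<open>u\<close>; far out on the ray it is nearer than \<open>b\<close>.\<close>

lemma exists_step_outside:
  assumes "u \<noteq> 0"
  shows "\<exists>m>0. v + m *\<^sub>R u \<notin> closer_region R"
proof -
  have "infinite (A \<inter> {x. - u \<bullet> x \<le> - (u \<bullet> b) - 1})"
    using coarsely_dense assms unfolding coarsely_dense_def by (metis neg_equal_0_iff_equal)
  then have "infinite (A \<inter> {x. - u \<bullet> x \<le> - (u \<bullet> b) - 1} - F)"
    using finite_F by simp
  then obtain q where "q \<in> A \<inter> {x. - u \<bullet> x \<le> - (u \<bullet> b) - 1} - F"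
    using infinite_imp_nonempty by blast
  then have q: "q \<in> A - F" "u \<bullet> b + 1 \<le> u \<bullet> q"
    by auto
  \<comment> \<open>Moving by \<open>m *\<^sub>R u\<close> favors \<open>q\<close> over
    \<open>b\<close> by at least \<open>2 * m\<close> in squared distance, which exceeds the initial
    advantage of \<open>b\<close>, at most \<open>(norm (v - q))\<^sup>2\<close>.\<close>
  define m where "m = (norm (v - q))\<^sup>2 + 1"
  have "m > 0"
    by (simp add: m_def add_nonneg_pos)
  have "2 * (m *\<^sub>R u \<bullet> (b - q)) \<le> - (2 * m)"
    using q(2) \<open>m > 0\<close> mult_left_mono[of "u \<bullet> (b - q)" "- 1" m] by (simp add: inner_diff_right right_diff_distrib)
  also have "\<dots> < (norm (v - b))\<^sup>2 - (norm (v - q))\<^sup>2"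
  proof -
    have "- (2 * (x + 1)) < y - x" if "0 \<le> x" "0 \<le> y" for x y :: real
      using that by (simp add: algebra_simps)
    then show ?thesis
      unfolding m_def by (meson zero_le_power2)
  qed
  finally have "\<not> norm (v + m *\<^sub>R u - b) \<le> norm (v + m *\<^sub>R u - q)"
    unfolding closer_shift by simp
  then show ?thesis
    using b_closer[OF q(1)] \<open>m > 0\<close> unfolding closer_region_def by blast
qed

text \<open>Near \<open>v\<close> the region looks like the dual of the cone of active directions.
  Quarter turns of \<open>e\<close> and \<open>f\<close> in opposite senses span the dual cone,
  hence the supplementary angle.\<close>

lemma angles_at_closer_region_superset:
  assumes v: "v \<in> closer_region R"
    and ef: "e \<in> active_dirs R v" "f \<in> active_dirs R v" "cross e f > 0" "active_dirs R v \<subseteq> cone2 e f"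
  shows "angles_at (closer_region R) v = {pi - vangle e f}" and "interior (closer_region R) \<noteq> {}"
proof -
  have dual: "cross (- rot f) (rot e) > 0"
    using ef(3) by (simp add: cross_def mult.commute)
  have pairing: "cross w (rot e) = w \<bullet> e" "cross (- rot f) w = w \<bullet> f" for w
    by (simp_all add: cross_def inner_plane)
  have sub: "closer_region R \<subseteq> (+) v ` cone2 (- rot f) (rot e)"
  proof
    fix y
    assume "y \<in> closer_region R"
    then have "y - v \<in> cone2 (- rot f) (rot e)"
      unfolding mem_cone2_iff[OF dual] pairing using inner_active_dirs_nonneg[OF v] ef by simp
    then show "y \<in> (+) v ` cone2 (- rot f) (rot e)"
      by (intro image_eqI[of _ _ "y - v"]) simp
  qed
  have step: "\<exists>s>0. v + s *\<^sub>R u \<in> closer_region R" if "u \<bullet> e \<ge> 0" "u \<bullet> f \<ge> 0" for u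
  proof (rule exists_step_in_region[OF v])
    fix x
    assume "x \<in> active_dirs R v"
    then obtain i j where "x = i *\<^sub>R e + j *\<^sub>R f" "i \<ge> 0" "j \<ge> 0"
      using ef(4) unfolding cone2_def by blast
    then show "u \<bullet> x \<ge> 0"
      using that by (simp add: inner_add_right)
  qed
  obtain s where s: "s > 0" "v + s *\<^sub>R (- rot f) \<in> closer_region R"
    using step[of "- rot f"] ef(3) cross_commute[of f e] by (auto simp: inner_rot)
  obtain t where t: "t > 0" "v + t *\<^sub>R rot e \<in> closer_region R"
    using step[of "rot e"] ef(3) by (auto simp: inner_rot)
  have "- rot f \<noteq> 0" "rot e \<noteq> 0"
    using ef(3) by auto
  then obtain m n where "m > 0" "v + m *\<^sub>R (- rot f) \<notin> closer_region R" "n > 0" "v + n *\<^sub>R rot e \<notin> closer_region R"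
    using exists_step_outside by meson
  then have "angles_at (closer_region R) v = {vangle (- rot f) (rot e)}"
    using s t sub dual v
    by (intro angles_at_corner[where s = s and t = t and m = m and n = n])
      (auto simp: closed_closer_region convex_closer_region)
  then show "angles_at (closer_region R) v = {pi - vangle e f}"
    by (simp only: vangle_minus_left vangle_rot vangle_commute[of f e])
  have "affine hull {v, v + s *\<^sub>R (- rot f), v + t *\<^sub>R rot e} \<subseteq> affine hull (closer_region R)"
    using s t v by (intro hull_mono) auto
  then have "affine hull (closer_region R) = UNIV"
    using affine_hull_corner[of "- rot f" "rot e" s t v] dual s(1) t(1) by auto
  then have "interior (closer_region R) = rel_interior (closer_region R)"
    by (simp add: rel_interior_interior)
  then show "interior (closer_region R) \<noteq> {}"
    using rel_interior_eq_empty[OF convex_closer_region] v by force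
qed

text \<open>Seen from \<open>v\<close>, an interior point of the region has positive inner product
  with every active direction, so these lie in an open half-plane. If all were parallel, short steps
  perpendicular to them in both senses would stay in the region, and \<open>v\<close> would not be
  extreme.\<close>

lemma angles_at_closer_region_subset:
  assumes int: "interior (closer_region R) \<noteq> {}"
  shows "angles_at (closer_region R) v \<subseteq> (\<lambda>\<theta>. pi - \<theta>) ` extreme_angles (active_dirs R v)"
proof
  fix \<theta>
  assume \<theta>: "\<theta> \<in> angles_at (closer_region R) v"
  then have ext: "v extreme_point_of closer_region R"
    unfolding angles_at_def by blast
  then have v: "v \<in> closer_region R"
    by (simp add: extreme_point_of_def)
  obtain y where y: "y \<in> interior (closer_region R)"
    using int by blast
  then obtain \<epsilon> where \<epsilon>: "\<epsilon> > 0" "cball y \<epsilon> \<subseteq> closer_region R"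
    using mem_interior_cball by blast
  have pos: "(y - v) \<bullet> e > 0" if e: "e \<in> active_dirs R v" for e
  proof -
    have "e \<noteq> 0"
      using e zero_notin_active_dirs by metis
    have "y - (\<epsilon> / norm e) *\<^sub>R e \<in> cball y \<epsilon>"
      using \<epsilon>(1) \<open>e \<noteq> 0\<close> by (simp add: dist_norm)
    then have "(y - (\<epsilon> / norm e) *\<^sub>R e - v) \<bullet> e \<ge> 0"
      using \<epsilon> inner_active_dirs_nonneg[OF v _ e] by blast
    then have "(y - v) \<bullet> e \<ge> (\<epsilon> / norm e) * (e \<bullet> e)"
      by (simp add: inner_diff_left)
    moreover have "(\<epsilon> / norm e) * (e \<bullet> e) > 0"
      using \<epsilon>(1) \<open>e \<noteq> 0\<close> by simp
    ultimately show ?thesis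
      by linarith
  qed
  have "\<exists>e\<in>active_dirs R v. \<exists>f\<in>active_dirs R v. cross e f \<noteq> 0"
  proof (rule ccontr)
    assume contra: "\<not> ?thesis"
    obtain u where u: "u \<noteq> 0" "\<And>e. e \<in> active_dirs R v \<Longrightarrow> u \<bullet> e = 0"
    proof (cases "active_dirs R v = {}")
      case True
      then show ?thesis
        using that[of "axis 1 1"] by (simp add: axis_eq_0_iff)
    next
      case False
      then obtain f where f: "f \<in> active_dirs R v" by blast
      then have "rot f \<noteq> 0"
        using zero_notin_active_dirs[of v] by auto
      then show ?thesis
        using that[of "rot f"] contra f by (simp add: inner_rot)
    qed
    obtain s where s: "s > 0" "v + s *\<^sub>R u \<in> closer_region R"
      using exists_step_in_region[OF v, of u] u(2) by auto
    obtain t where t: "t > 0" "v + t *\<^sub>R (- u) \<in> closer_region R"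
      using exists_step_in_region[OF v, of "- u"] u(2) by auto
    have "v = (1 - t / (s + t)) *\<^sub>R (v + t *\<^sub>R (- u)) + (t / (s + t)) *\<^sub>R (v + s *\<^sub>R u)"
    proof -
      have "t / (s + t) * s = (1 - t / (s + t)) * t"
        using s t by (simp add: field_simps)
      then have "(t / (s + t)) *\<^sub>R s *\<^sub>R u = (1 - t / (s + t)) *\<^sub>R t *\<^sub>R u"
        by simp
      then show ?thesis
        by (simp add: algebra_simps)
    qed
    moreover have "0 < t / (s + t)" "t / (s + t) < 1"
      using s t by auto
    moreover have "v + t *\<^sub>R (- u) \<noteq> v + s *\<^sub>R u"
    proof
      assume "v + t *\<^sub>R (- u) = v + s *\<^sub>R u"
      then have "(s + t) *\<^sub>R u = 0"
        by (simp add: algebra_simps)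
      then show False
        using s t u(1) by simp
    qed
    ultimately have "v \<in> open_segment (v + t *\<^sub>R (- u)) (v + s *\<^sub>R u)"
      unfolding in_segment by blast
    then show False
      using ext s t unfolding extreme_point_of_def by blast
  qed
  then obtain e f where ef: "e \<in> active_dirs R v" "f \<in> active_dirs R v" "cross e f > 0"
      "active_dirs R v \<subseteq> cone2 e f"
    using extreme_angles_exist[OF finite_active_dirs pos] by metis
  have "\<theta> = pi - vangle e f"
    using \<theta> angles_at_closer_region_superset(1)[OF v ef] by blast
  moreover have "vangle e f \<in> extreme_angles (active_dirs R v)"
    unfolding extreme_angles_def using ef by force
  ultimately show "\<theta> \<in> (\<lambda>\<theta>. pi - \<theta>) ` extreme_angles (active_dirs R v)"
    by blast
qed

end

section \<open>Circles through two points\<close>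

text \<open>For points \<open>p\<close> of the circle with \<open>cross (b - a) (p - a)\<close>
  positive, \<open>t\<close> is the cotangent of the angle under which \<open>p\<close> sees the
  chord \<open>ab\<close>; \<open>t = 0\<close> is the circle with diameter
  \<open>ab\<close>.\<close>

definition pencil_center :: "plane \<Rightarrow> plane \<Rightarrow> real \<Rightarrow> plane" where
  "pencil_center a b t = (1/2) *\<^sub>R (a + b) + (t/2) *\<^sub>R rot (b - a)"

text \<open>The last bracket is the power of \<open>p\<close> with respect to the circle. It is
  affine in \<open>t\<close>, so as \<open>t\<close> grows a point enters or leaves the disk at most
  once.\<close>

lemma pencil_power:
  "(norm (pencil_center a b t - p))\<^sup>2 =
     (norm (pencil_center a b t - a))\<^sup>2 + ((a - p) \<bullet> (b - p) - t * cross (b - a) (p - a))"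
  unfolding power2_norm_eq_inner pencil_center_def inner_plane cross_def
  by (simp add: field_simps)

lemma pencil_through:
  assumes "a \<noteq> b" "norm (x - a) = norm (x - b)"
  shows "\<exists>t. x = pencil_center a b t"
proof -
  define w where "w = x - (1/2) *\<^sub>R (a + b)"
  have cr: "cross (b - a) (rot (b - a)) = (b - a) \<bullet> (b - a)" "cross w (rot (b - a)) = w \<bullet> (b - a)"
    by (simp_all add: cross_def inner_plane algebra_simps)
  have "(x - a) \<bullet> (x - a) = (x - b) \<bullet> (x - b)"
    using assms(2) by (simp add: norm_eq)
  then have "w \<bullet> (b - a) = 0"
    unfolding w_def inner_plane by (simp add: field_simps)
  moreover have "cross (b - a) (rot (b - a)) \<noteq> 0"
    using assms(1) by (simp add: cr)
  ultimately have "w = (cross (b - a) w / cross (b - a) (rot (b - a))) *\<^sub>R rot (b - a)"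
    using cross_decomposition[of "b - a" "rot (b - a)" w] by (simp add: cr)
  then have "x = pencil_center a b (2 * (cross (b - a) w / cross (b - a) (rot (b - a))))"
    by (simp add: w_def pencil_center_def algebra_simps)
  then show ?thesis
    by blast
qed

lemma mem_pencil_ball:
  "p \<in> ball (pencil_center a b t) (norm (pencil_center a b t - a)) \<longleftrightarrow>
     (a - p) \<bullet> (b - p) < t * cross (b - a) (p - a)"
proof -
  have "norm (pencil_center a b t - p) < norm (pencil_center a b t - a) \<longleftrightarrow>
      (norm (pencil_center a b t - p))\<^sup>2 < (norm (pencil_center a b t - a))\<^sup>2"
    unfolding not_le[symmetric] by simp
  then show ?thesis
    unfolding pencil_power[of a b t p] by (simp add: dist_norm)
qed

lemma mem_pencil_sphere:
  "p \<in> sphere (pencil_center a b t) (norm (pencil_center a b t - a)) \<longleftrightarrow>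
     (a - p) \<bullet> (b - p) = t * cross (b - a) (p - a)"
proof -
  have "norm (pencil_center a b t - p) = norm (pencil_center a b t - a) \<longleftrightarrow>
      (norm (pencil_center a b t - p))\<^sup>2 = (norm (pencil_center a b t - a))\<^sup>2"
    by simp
  then show ?thesis
    unfolding pencil_power[of a b t p] by (simp add: dist_norm)
qed

lemma circle_pencil:
  assumes "a \<noteq> b" "a \<in> sphere x r" "b \<in> sphere x r"
  obtains t where "x = pencil_center a b t" "r = norm (pencil_center a b t - a)"
proof -
  have "norm (x - a) = norm (x - b)" "r = norm (x - a)"
    using assms(2,3) by (auto simp: dist_norm)
  then show ?thesis
    using pencil_through[OF assms(1)] that by metis
qed

lemma cross_triangle: "cross (a - p) (b - p) = cross (b - a) (p - a)"
  by (simp add: cross_def algebra_simps)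

text \<open>A point \<open>c\<close> of the line \<open>ab\<close> has power
  \<open>(a - c) \<bullet> (b - c)\<close> for every circle through \<open>a\<close> and
  \<open>b\<close>. On the circle this vanishes together with \<open>cross\<close>, and Lagrange's
  identity makes \<open>c\<close> equal to \<open>a\<close> or \<open>b\<close>.\<close>

lemma cocircular_not_collinear:
  assumes "a \<in> sphere x r" "b \<in> sphere x r" "c \<in> sphere x r" "a \<noteq> b" "a \<noteq> c" "b \<noteq> c"
  shows "cross (b - a) (c - a) \<noteq> 0"
proof
  assume 0: "cross (b - a) (c - a) = 0"
  obtain t where t: "x = pencil_center a b t" "r = norm (pencil_center a b t - a)"
    using circle_pencil assms by metis
  then have "(a - c) \<bullet> (b - c) = 0"
    using assms(3) 0 unfolding t mem_pencil_sphere by simp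
  moreover have "cross (a - c) (b - c) = 0"
    using 0 cross_triangle[of a c b] by simp
  ultimately have "(norm (a - c))\<^sup>2 * (norm (b - c))\<^sup>2 = 0"
    by (simp flip: inner_cross_squares)
  then show False
    using assms by simp
qed

text \<open>\<open>t\<close> and \<open>t'\<close> are the cotangents of the two angles. The case
  \<open>t = t'\<close> contains the inscribed angle theorem.\<close>

lemma pencil_angle_mono:
  assumes "cross (b - a) (c - a) > 0" "cross (b - a) (c' - a) > 0"
    and "(a - c) \<bullet> (b - c) = t * cross (b - a) (c - a)" "(a - c') \<bullet> (b - c') = t' * cross (b - a) (c' - a)"
    and "t \<le> t'"
  shows "vangle (a - c') (b - c') \<le> vangle (a - c) (b - c)"
  using assms cross_triangle[of a c b] cross_triangle[of a c' b]
  by (intro vangle_mono) (simp_all add: mult_right_mono mult.commute mult.left_commute)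

lemma infinite_positive_side:
  assumes "coarsely_dense A" "a \<noteq> b"
  shows "infinite (A \<inter> {p. cross (b - a) (p - a) > 0})"
proof -
  have "- rot (b - a) \<noteq> 0"
    using assms(2) by simp
  then have "infinite (A \<inter> {p. - rot (b - a) \<bullet> p \<le> - cross (b - a) a - 1})"
    using assms(1) unfolding coarsely_dense_def by blast
  moreover have "A \<inter> {p. - rot (b - a) \<bullet> p \<le> - cross (b - a) a - 1} \<subseteq> A \<inter> {p. cross (b - a) (p - a) > 0}"
    by (auto simp: inner_rot cross_diff)
  ultimately show ?thesis
    using finite_subset by blast
qed

text \<open>Move the center of a circle through \<open>a\<close> and \<open>b\<close> towards \<open>c\<close>: the angle over the chord
  decreases, and the first position at which at least \<open>k\<close> points have been enclosed is the
  circle we want.\<close>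

lemma next_circle_positive:
  assumes lf: "locally_finite A" and cd: "coarsely_dense A"
    and abc: "a \<in> A \<inter> sphere x r" "b \<in> A \<inter> sphere x r" "c \<in> A \<inter> sphere x r" "a \<noteq> b"
    and pos: "cross (b - a) (c - a) > 0"
    and less: "card (A \<inter> ball x r) < k"
  shows "\<exists>x' r' c'. a \<in> sphere x' r' \<and> b \<in> sphere x' r' \<and> c' \<in> A \<inter> sphere x' r' \<and> c' \<noteq> a \<and> c' \<noteq> b \<and>
    card (A \<inter> ball x' r') < k \<and> k + 2 \<le> card (A \<inter> ball x' r') + card (A \<inter> sphere x' r') \<and>
    vangle (a - c') (b - c') \<le> vangle (a - c) (b - c)"
proof -
  define side where "side p = cross (b - a) (p - a)" for p
  define pow where "pow p = (a - p) \<bullet> (b - p)" for p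
  define \<tau> where "\<tau> p = pow p / side p" for p
  define cen where "cen = pencil_center a b"
  define rad where "rad t = norm (cen t - a)" for t
  \<comment> \<open>The points enclosed just after the center has passed position \<open>t\<close>:
    those in the open disk stay there for a moment, and those on the circle enter it if they lie on
    the side of \<open>c\<close>.\<close>
  define Q where "Q t = A \<inter> {p. pow p < t * side p \<or> (side p > 0 \<and> pow p = t * side p)}" for t
  have ball: "p \<in> ball (cen t) (rad t) \<longleftrightarrow> pow p < t * side p" for p t
    unfolding cen_def rad_def pow_def side_def by (rule mem_pencil_ball)
  have sphere: "p \<in> sphere (cen t) (rad t) \<longleftrightarrow> pow p = t * side p" for p t
    unfolding cen_def rad_def pow_def side_def by (rule mem_pencil_sphere)
  obtain t0 where t0: "x = cen t0" "r = rad t0"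
    unfolding cen_def rad_def using circle_pencil abc by (metis IntE)
  have on: "\<tau> p = t \<longleftrightarrow> pow p = t * side p" if "side p > 0" for p t
    using that by (simp add: \<tau>_def field_simps)
  have lt: "\<tau> p < t \<longleftrightarrow> pow p < t * side p" if "side p > 0" for p t
    using that by (simp add: \<tau>_def field_simps)
  have c: "c \<in> A" "side c > 0" "\<tau> c = t0"
    using abc pos sphere[of c t0] t0 on[of c t0] by (auto simp: side_def)
  have fin: "finite (A \<inter> cball (cen t) (rad t))" for t
    using lf by (simp add: locally_finite_def)
  have sub: "A \<inter> {p. side p > 0 \<and> \<tau> p \<le> t} \<subseteq> A \<inter> cball (cen t) (rad t)" for t
    using ball[of _ t] sphere[of _ t] on lt by (force simp: less_eq_real_def)
  have Q_sub: "Q t \<subseteq> A \<inter> cball (cen t) (rad t)" for t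
    using ball[of _ t] sphere[of _ t] by (force simp: Q_def less_eq_real_def)
  have finQ: "finite (Q t)" for t
    using finite_subset[OF Q_sub fin] .
  \<comment> \<open>New points are enclosed only at the parameters \<open>\<tau> z\<close> of points
    on the side of \<open>c\<close>, so the first position with enough points is sought among these;
    \<open>t0 \<le> \<tau> z\<close> allows only movement towards \<open>c\<close>.\<close>
  define C where "C = {z \<in> A. side z > 0 \<and> t0 \<le> \<tau> z \<and> k \<le> card (Q (\<tau> z))}"
  have "C \<noteq> {}"
  proof -
    have "infinite (A \<inter> {p. side p > 0})"
      unfolding side_def by (rule infinite_positive_side[OF cd abc(4)])
    then obtain Z where Z: "Z \<subseteq> A \<inter> {p. side p > 0}" "card Z = k" "finite Z"
      using infinite_arbitrarily_large by metis
    \<comment> \<open>Including \<open>c\<close> ensures \<open>t0 \<le> \<tau> z\<close> even if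
      all of \<open>Z\<close> is enclosed from the start.\<close>
    obtain z where z: "z \<in> insert c Z" "\<forall>y\<in>insert c Z. \<tau> y \<le> \<tau> z"
      using finite_argmax[of "insert c Z" \<tau>] Z(3) by auto
    have zA: "z \<in> A" "side z > 0"
      using z(1) Z(1) c by auto
    have "Z \<subseteq> Q (\<tau> z)"
    proof
      fix y
      assume "y \<in> Z"
      then have "side y > 0" "y \<in> A" "\<tau> y \<le> \<tau> z"
        using Z(1) z(2) by auto
      then show "y \<in> Q (\<tau> z)"
        using on[of y "\<tau> z"] lt[of y "\<tau> z"] by (auto simp: Q_def less_eq_real_def)
    qed
    then have "k \<le> card (Q (\<tau> z))"
      using Z(2) card_mono[OF finQ] by blast
    then show ?thesis
      using zA z(2) c by (auto simp: C_def)
  qed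
  then obtain z0 where z0: "z0 \<in> C" by blast
  have "finite {z \<in> C. \<tau> z \<le> \<tau> z0}"
    by (rule finite_subset[OF _ finite_subset[OF sub fin, of "\<tau> z0"]]) (auto simp: C_def)
  then obtain d where d: "d \<in> C" "\<tau> d \<le> \<tau> z0" "\<And>z. z \<in> C \<Longrightarrow> \<tau> z \<le> \<tau> z0 \<Longrightarrow> \<tau> d \<le> \<tau> z"
    using finite_argmin[of "{z \<in> C. \<tau> z \<le> \<tau> z0}" \<tau>] z0 by auto
  then have d_min: "\<tau> d \<le> \<tau> z" if "z \<in> C" for z
    using that by (cases "\<tau> z \<le> \<tau> z0") force+
  have dA: "d \<in> A" "side d > 0" "t0 \<le> \<tau> d" "k \<le> card (Q (\<tau> d))"
    using d(1) by (auto simp: C_def)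
  define t where "t = \<tau> d"
  \<comment> \<open>With \<open>k\<close> points already in the open disk, \<open>t\<close> would
    not be the start, and the last event \<open>z\<close> before \<open>t\<close> would qualify too:
    points on the side of \<open>c\<close> that are inside at \<open>t\<close> have entered by then,
    and those on the other side only leave. This contradicts the choice of \<open>d\<close>.\<close>
  have few: "card (A \<inter> ball (cen t) (rad t)) < k"
  proof (rule ccontr)
    assume many: "\<not> ?thesis"
    then have "t \<noteq> t0"
      using less t0 by auto
    then have "t0 < t"
      using dA by (simp add: t_def)
    define Z where "Z = {z \<in> A. side z > 0 \<and> t0 \<le> \<tau> z \<and> \<tau> z < t}"
    have "finite Z"
      by (rule finite_subset[OF _ finite_subset[OF sub fin, of t]]) (auto simp: Z_def)
    moreover have "c \<in> Z"
      using c \<open>t0 < t\<close> by (simp add: Z_def)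
    ultimately obtain z where z: "z \<in> Z" "\<forall>y\<in>Z. \<tau> y \<le> \<tau> z"
      using finite_argmax[of Z \<tau>] by auto
    have "A \<inter> ball (cen t) (rad t) \<subseteq> Q (\<tau> z)"
    proof
      fix p
      assume p: "p \<in> A \<inter> ball (cen t) (rad t)"
      then have pt: "pow p < t * side p"
        using ball by blast
      show "p \<in> Q (\<tau> z)"
      proof (cases "side p > 0")
        case True
        then have "\<tau> p < t"
          using pt lt by blast
        then have "\<tau> p \<le> \<tau> z"
          using z p True by (cases "t0 \<le> \<tau> p") (auto simp: Z_def)
        then show ?thesis
          using p True on[of p "\<tau> z"] lt[of p "\<tau> z"] by (auto simp: Q_def less_eq_real_def)
      next
        case False
        then have "t * side p \<le> \<tau> z * side p"
          using z(1) by (intro mult_right_mono_neg) (auto simp: Z_def)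
        then show ?thesis
          using pt p by (auto simp: Q_def)
      qed
    qed
    then have "k \<le> card (Q (\<tau> z))"
      using many card_mono[OF finQ] by (metis leI le_trans)
    then have "z \<in> C"
      using z(1) by (simp add: C_def Z_def)
    then show False
      using d_min z(1) by (force simp: Z_def t_def)
  qed
  have ab: "pow a = 0" "side a = 0" "pow b = 0" "side b = 0"
    by (simp_all add: pow_def side_def)
  have d_on: "pow d = t * side d"
    using on[OF dA(2), of t] by (simp add: t_def)
  \<comment> \<open>\<open>a\<close> and \<open>b\<close> lie on every circle of the pencil and
    never in \<open>Q t\<close>; they account for the summand 2.\<close>
  have "k + 2 \<le> card (insert a (insert b (Q t)))"
    using dA(4) finQ abc(4) ab by (simp add: t_def Q_def)
  also have "\<dots> \<le> card ((A \<inter> ball (cen t) (rad t)) \<union> (A \<inter> sphere (cen t) (rad t)))"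
  proof (rule card_mono)
    show "finite ((A \<inter> ball (cen t) (rad t)) \<union> (A \<inter> sphere (cen t) (rad t)))"
      by (rule finite_subset[OF _ fin[of t]]) auto
    show "insert a (insert b (Q t)) \<subseteq> (A \<inter> ball (cen t) (rad t)) \<union> (A \<inter> sphere (cen t) (rad t))"
      using ball[of _ t] sphere[of _ t] ab abc by (auto simp: Q_def)
  qed
  also have "\<dots> \<le> card (A \<inter> ball (cen t) (rad t)) + card (A \<inter> sphere (cen t) (rad t))"
    by (rule card_Un_le)
  finally have many: "k + 2 \<le> card (A \<inter> ball (cen t) (rad t)) + card (A \<inter> sphere (cen t) (rad t))" .
  have "vangle (a - d) (b - d) \<le> vangle (a - c) (b - c)"
    using c dA on[OF c(2), of t0] d_on
    by (intro pencil_angle_mono[of b a c d t0 t]) (auto simp: side_def pow_def t_def)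
  moreover have "a \<in> sphere (cen t) (rad t)" "b \<in> sphere (cen t) (rad t)" "d \<in> sphere (cen t) (rad t)"
    using sphere ab d_on by simp_all
  moreover have "d \<noteq> a" "d \<noteq> b"
    using ab dA(2) by auto
  ultimately show ?thesis
    using few many dA(1) by blast
qed

text \<open>The pencil is oriented; exchanging \<open>a\<close> and \<open>b\<close> brings
  \<open>c\<close> to the positive side.\<close>

lemma next_circle:
  assumes "locally_finite A" "coarsely_dense A"
    and abc: "a \<in> A \<inter> sphere x r" "b \<in> A \<inter> sphere x r" "c \<in> A \<inter> sphere x r" "a \<noteq> b" "a \<noteq> c" "b \<noteq> c"
    and "card (A \<inter> ball x r) < k"
  shows "\<exists>x' r' c'. a \<in> sphere x' r' \<and> b \<in> sphere x' r' \<and> c' \<in> A \<inter> sphere x' r' \<and> c' \<noteq> a \<and> c' \<noteq> b \<and>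
    card (A \<inter> ball x' r') < k \<and> k + 2 \<le> card (A \<inter> ball x' r') + card (A \<inter> sphere x' r') \<and>
    vangle (a - c') (b - c') \<le> vangle (a - c) (b - c)"
proof -
  have ne: "cross (b - a) (c - a) \<noteq> 0"
    using cocircular_not_collinear[of a x r b c] abc by auto
  have swap: "cross (a - b) (c - b) = - cross (b - a) (c - a)"
    by (simp add: cross_def algebra_simps)
  show ?thesis
  proof (cases "cross (b - a) (c - a) > 0")
    case True
    then show ?thesis
      using next_circle_positive assms by blast
  next
    case False
    then have "cross (a - b) (c - b) > 0"
      using ne swap by simp
    then have "\<exists>x' r' c'. b \<in> sphere x' r' \<and> a \<in> sphere x' r' \<and> c' \<in> A \<inter> sphere x' r' \<and> c' \<noteq> b \<and> c' \<noteq> a \<and>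
      card (A \<inter> ball x' r') < k \<and> k + 2 \<le> card (A \<inter> ball x' r') + card (A \<inter> sphere x' r') \<and>
      vangle (b - c') (a - c') \<le> vangle (b - c) (a - c)"
      using next_circle_positive[of A b x r a c k] assms by blast
    then show ?thesis
      unfolding vangle_commute[of "b - _"] by blast
  qed
qed

text \<open>Let \<open>b\<close> be a nearest neighbor of \<open>a\<close>. The disk with diameter
  \<open>ab\<close>, at parameter 0, contains no point of \<open>A\<close>. Increase the parameter
  until a first point \<open>c\<close> on the positive side is hit: no point of that side has been
  enclosed, and on the other side the disk only recedes.\<close>

lemma exists_empty_circle:
  assumes lf: "locally_finite A" and cd: "coarsely_dense A"
  shows "\<exists>x r a b c. {a, b, c} \<subseteq> A \<inter> sphere x r \<and> a \<noteq> b \<and> a \<noteq> c \<and> b \<noteq> c \<and> A \<inter> ball x r = {}"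
proof -
  have fin: "finite (A \<inter> cball x r)" for x r
    using lf by (simp add: locally_finite_def)
  have "infinite (A \<inter> {x. axis 1 1 \<bullet> x \<le> 0})"
    using cd unfolding coarsely_dense_def by (simp add: axis_eq_0_iff)
  then have "infinite A"
    using finite_Int by blast
  then obtain a where a: "a \<in> A"
    by fastforce
  have "infinite (A - {a})"
    using \<open>infinite A\<close> by simp
  then obtain b0 where b0: "b0 \<in> A - {a}"
    using infinite_imp_nonempty by blast
  obtain b where b: "b \<in> A" "b \<noteq> a" and b_min: "\<And>p. p \<in> A \<Longrightarrow> p \<noteq> a \<Longrightarrow> dist a b \<le> dist a p"
  proof -
    have "b0 \<in> A \<inter> cball a (dist a b0) - {a}"
      using b0 by simp
    then obtain b where b: "b \<in> A \<inter> cball a (dist a b0) - {a}"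
        "\<forall>p \<in> A \<inter> cball a (dist a b0) - {a}. dist a b \<le> dist a p"
      using finite_argmin[of "A \<inter> cball a (dist a b0) - {a}" "dist a"] fin by blast
    moreover have "dist a b \<le> dist a p" if "p \<in> A" "p \<noteq> a" for p
      using b that by (cases "dist a p \<le> dist a b0") auto
    ultimately show ?thesis
      using that by blast
  qed
  define side where "side p = cross (b - a) (p - a)" for p
  define pow where "pow p = (a - p) \<bullet> (b - p)" for p
  define \<tau> where "\<tau> p = pow p / side p" for p
  define cen where "cen = pencil_center a b"
  define rad where "rad t = norm (cen t - a)" for t
  have ball: "p \<in> ball (cen t) (rad t) \<longleftrightarrow> pow p < t * side p" for p t
    unfolding cen_def rad_def pow_def side_def by (rule mem_pencil_ball)
  have sphere: "p \<in> sphere (cen t) (rad t) \<longleftrightarrow> pow p = t * side p" for p t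
    unfolding cen_def rad_def pow_def side_def by (rule mem_pencil_sphere)
  \<comment> \<open>If \<open>pow p\<close> is negative, \<open>p\<close> lies inside the circle
    with diameter \<open>ab\<close> and is therefore nearer to \<open>a\<close> than
    \<open>b\<close> is.\<close>
  have pow_nonneg: "pow p \<ge> 0" if "p \<in> A" for p
  proof (rule ccontr)
    assume "\<not> pow p \<ge> 0"
    then have neg: "(p - a) \<bullet> (p - b) < 0"
      using inner_minus_left[of "p - a" "b - p"] inner_minus_right[of "p - a" "p - b"]
      by (simp add: pow_def inner_plane algebra_simps)
    then have "p \<noteq> a"
      by auto
    have "(dist a b)\<^sup>2 = (p - a) \<bullet> (p - a) + (p - b) \<bullet> (p - b) - 2 * ((p - a) \<bullet> (p - b))"
      unfolding dist_norm power2_norm_eq_inner by (simp add: inner_plane algebra_simps)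
    moreover have "(dist a p)\<^sup>2 = (p - a) \<bullet> (p - a)"
      unfolding dist_norm power2_norm_eq_inner by (simp add: inner_plane algebra_simps)
    ultimately have "(dist a p)\<^sup>2 < (dist a b)\<^sup>2"
      using neg inner_ge_zero[of "p - b"] by linarith
    then have "dist a p < dist a b"
      by (simp add: power_less_imp_less_base)
    then show False
      using b_min[OF that \<open>p \<noteq> a\<close>] by simp
  qed
  have "infinite (A \<inter> {p. side p > 0})"
    unfolding side_def by (rule infinite_positive_side[OF cd]) (use b in auto)
  then obtain c0 where "c0 \<in> A \<inter> {p. side p > 0}"
    using infinite_imp_nonempty by blast
  then have c0: "c0 \<in> A" "side c0 > 0"
    by auto
  have on: "\<tau> p = t \<longleftrightarrow> pow p = t * side p" if "side p > 0" for p t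
    using that by (simp add: \<tau>_def field_simps)
  have lt: "\<tau> p < t \<longleftrightarrow> pow p < t * side p" if "side p > 0" for p t
    using that by (simp add: \<tau>_def field_simps)
  define Z where "Z = {p \<in> A. side p > 0 \<and> \<tau> p \<le> \<tau> c0}"
  have "Z \<subseteq> A \<inter> cball (cen (\<tau> c0)) (rad (\<tau> c0))"
    using ball[of _ "\<tau> c0"] sphere[of _ "\<tau> c0"] on lt by (force simp: Z_def less_eq_real_def)
  then have "finite Z"
    using fin finite_subset by blast
  moreover have "c0 \<in> Z"
    using c0 by (simp add: Z_def)
  ultimately obtain c where c: "c \<in> Z" "\<forall>p\<in>Z. \<tau> c \<le> \<tau> p"
    using finite_argmin[of Z \<tau>] by auto
  then have cA: "c \<in> A" "side c > 0" "\<tau> c \<le> \<tau> c0"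
    by (auto simp: Z_def)
  have c_min: "\<tau> c \<le> \<tau> p" if "p \<in> A" "side p > 0" for p
    using c cA that by (cases "\<tau> p \<le> \<tau> c0") (auto simp: Z_def)
  define t where "t = \<tau> c"
  have "t \<ge> 0"
    using pow_nonneg[OF cA(1)] cA(2) by (simp add: t_def \<tau>_def)
  have "p \<notin> ball (cen t) (rad t)" if "p \<in> A" for p
  proof (cases "side p > 0")
    case True
    then show ?thesis
      using c_min[OF that True] lt[OF True, of t] ball[of p t] by (auto simp: t_def)
  next
    case False
    then have "t * side p \<le> 0"
      using \<open>t \<ge> 0\<close> by (simp add: mult_nonneg_nonpos)
    then show ?thesis
      using pow_nonneg[OF that] ball[of p t] by auto
  qed
  then have "A \<inter> ball (cen t) (rad t) = {}"
    by blast
  moreover have ab: "pow a = 0" "side a = 0" "pow b = 0" "side b = 0"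
    by (simp_all add: pow_def side_def)
  moreover have "pow c = t * side c"
    using on[OF cA(2), of t] by (simp add: t_def)
  moreover have "a \<noteq> c" "b \<noteq> c"
    using ab cA(2) by auto
  ultimately show ?thesis
    using a b cA(1) sphere[of a t] sphere[of b t] sphere[of c t]
    by (intro exI[of _ "cen t"] exI[of _ "rad t"] exI[of _ a] exI[of _ b] exI[of _ c] conjI) auto
qed

section \<open>Chords of least angle\<close>

text \<open>\<open>T\<close> holds the points of \<open>S\<close> that count as nearer than
  \<open>b\<close>. Each vector is the nearer minus the farther point of a comparison with
  \<open>b\<close>, hence an inner normal of the zone.\<close>

definition zone_dirs :: "plane set \<Rightarrow> plane set \<Rightarrow> plane \<Rightarrow> plane set" where
  "zone_dirs S T b = (\<lambda>t. t - b) ` T \<union> (\<lambda>q. b - q) ` (S - insert b T)"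

lemma exists_rank:
  fixes \<kappa> :: "'a \<Rightarrow> real"
  assumes "finite X" "inj_on \<kappa> X" "i < card X"
  shows "\<exists>c\<in>X. card {p \<in> X. \<kappa> c < \<kappa> p} = i"
  using assms
proof (induction i arbitrary: X)
  case 0
  then obtain c where c: "c \<in> X" "\<forall>p\<in>X. \<kappa> p \<le> \<kappa> c"
    using finite_argmax[of X \<kappa>] by fastforce
  then have "{p \<in> X. \<kappa> c < \<kappa> p} = {}"
    by force
  then show ?case
    using c(1) by (metis card.empty)
next
  case (Suc i)
  then have "X \<noteq> {}"
    by auto
  then obtain m where m: "m \<in> X" "\<forall>p\<in>X. \<kappa> p \<le> \<kappa> m"
    using finite_argmax[of X \<kappa>] Suc.prems by blast
  have "finite (X - {m})" "inj_on \<kappa> (X - {m})" "i < card (X - {m})"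
    using Suc.prems m(1) by (auto simp: inj_on_diff)
  from Suc.IH[OF this] obtain c where c: "c \<in> X - {m}" "card {p \<in> X - {m}. \<kappa> c < \<kappa> p} = i"
    by blast
  have "\<kappa> c \<noteq> \<kappa> m"
    using c(1) m(1) Suc.prems(2) by (auto dest: inj_onD)
  then have "{p \<in> X. \<kappa> c < \<kappa> p} = insert m {p \<in> X - {m}. \<kappa> c < \<kappa> p}"
    using c m by force
  then have "card {p \<in> X. \<kappa> c < \<kappa> p} = Suc i"
    using c(2) Suc.prems(1) by simp
  then show ?case
    using c(1) by blast
qed

text \<open>Along an arc from \<open>b\<close> to \<open>a\<close>, the order in which the points are seen from \<open>a\<close> is the
  order in which they are seen from \<open>b\<close>; \<open>\<kappa>\<close> is the cotangent of the angle at \<open>a\<close>.\<close>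

lemma arc_order:
  assumes "a \<noteq> b"
    and p: "cross (b - a) (p - a) > 0" "(a - p) \<bullet> (b - p) = t * cross (b - a) (p - a)"
    and c: "cross (b - a) (c - a) > 0" "(a - c) \<bullet> (b - c) = t * cross (b - a) (c - a)"
    and \<kappa>: "\<kappa> = (\<lambda>p. ((b - a) \<bullet> (p - a)) / cross (b - a) (p - a))"
  shows "\<kappa> c \<le> \<kappa> p \<Longrightarrow> cross (p - a) (c - a) \<ge> 0 \<and> cross (p - b) (c - b) \<ge> 0"
    and "\<kappa> c = \<kappa> p \<Longrightarrow> p = c"
proof -
  define d where "d = b - a"
  define D where "D = d \<bullet> d"
  define \<sigma> where "\<sigma> p = cross d (p - a)" for p
  have "D > 0"
    using assms(1) by (simp add: D_def d_def)
  have \<sigma>_pos: "\<sigma> p > 0" "\<sigma> c > 0"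
    using p c by (simp_all add: \<sigma>_def d_def)
  have \<kappa>\<sigma>: "d \<bullet> (q - a) = \<kappa> q * \<sigma> q" if "\<sigma> q > 0" for q
    using that by (simp add: \<kappa> \<sigma>_def d_def)
  \<comment> \<open>Eliminates the coordinates of \<open>q - a\<close> from the circle equation and
    Lagrange's identity: \<open>\<sigma> q\<close> becomes a function of \<open>\<kappa> q\<close>,
    so that \<open>\<kappa>\<close> parametrizes the arc.\<close>
  have rel: "\<sigma> q * ((\<kappa> q)\<^sup>2 + 1) = D * (t + \<kappa> q)"
    if "\<sigma> q > 0" "(a - q) \<bullet> (b - q) = t * \<sigma> q" for q
  proof -
    have "((q - a) \<bullet> (q - a)) * D = (d \<bullet> (q - a))\<^sup>2 + (\<sigma> q)\<^sup>2"
      by (simp add: D_def \<sigma>_def inner_cross_squares power2_norm_eq_inner mult.commute)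
    moreover have "(q - a) \<bullet> (q - a) = t * \<sigma> q + d \<bullet> (q - a)"
    proof -
      have "(q - a) \<bullet> (q - a) = (a - q) \<bullet> (b - q) + d \<bullet> (q - a)"
        by (simp add: d_def inner_plane algebra_simps)
      then show ?thesis
        using that(2) by simp
    qed
    ultimately have "(t * \<sigma> q + \<kappa> q * \<sigma> q) * D = (\<kappa> q * \<sigma> q)\<^sup>2 + (\<sigma> q)\<^sup>2"
      by (simp only: \<kappa>\<sigma>[OF that(1)])
    then have "\<sigma> q * (\<sigma> q * ((\<kappa> q)\<^sup>2 + 1)) = \<sigma> q * (D * (t + \<kappa> q))"
      by (simp add: algebra_simps power2_eq_square)
    then show ?thesis
      using that(1) by simp
  qed
  have relp: "\<sigma> p * ((\<kappa> p)\<^sup>2 + 1) = D * (t + \<kappa> p)" and relc: "\<sigma> c * ((\<kappa> c)\<^sup>2 + 1) = D * (t + \<kappa> c)"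
    using rel[of p] rel[of c] p c \<sigma>_pos by (simp_all add: \<sigma>_def d_def)
  have sq: "(\<kappa> q)\<^sup>2 + 1 > 0" for q
    by (simp add: add_nonneg_pos)
  have tk: "t + \<kappa> p > 0" "t + \<kappa> c > 0"
    using relp relc \<sigma>_pos \<open>D > 0\<close> sq by (metis mult_pos_pos zero_less_mult_pos)+
  have from_a: "cross (p - a) (c - a) * D = \<sigma> p * \<sigma> c * (\<kappa> p - \<kappa> c)"
  proof -
    have "cross (p - a) (c - a) * D = d \<bullet> (p - a) * \<sigma> c - \<sigma> p * (d \<bullet> (c - a))"
      unfolding D_def \<sigma>_def cross_def inner_plane by (simp add: algebra_simps)
    then show ?thesis
      unfolding \<kappa>\<sigma>[OF \<sigma>_pos(1)] \<kappa>\<sigma>[OF \<sigma>_pos(2)] by (simp add: right_diff_distrib mult_ac)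
  qed
  \<comment> \<open>After multiplication by the positive numbers \<open>t + \<kappa> p\<close> and
    \<open>t + \<kappa> c\<close>, the relations \<open>relp\<close> and \<open>relc\<close> bring
    out the factor \<open>\<kappa> p - \<kappa> c\<close>, so the order seen from \<open>b\<close>
    has the same sign as in \<open>from_a\<close>.\<close>
  have from_b: "cross (p - b) (c - b) * ((t + \<kappa> p) * (t + \<kappa> c) * D) =
      \<sigma> p * \<sigma> c * (t\<^sup>2 + 1) * (\<kappa> p - \<kappa> c)"
  proof -
    have "cross (p - b) (c - b) = cross (p - a) (c - a) + \<sigma> p - \<sigma> c"
      by (simp add: \<sigma>_def d_def cross_def algebra_simps)
    then have "cross (p - b) (c - b) * D = \<sigma> p * \<sigma> c * (\<kappa> p - \<kappa> c) + \<sigma> p * D - \<sigma> c * D"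
      unfolding from_a[symmetric] by (simp only: left_diff_distrib distrib_right)
    then have "(cross (p - b) (c - b) * D) * ((t + \<kappa> p) * (t + \<kappa> c)) =
        (\<sigma> p * \<sigma> c * (\<kappa> p - \<kappa> c) + \<sigma> p * D - \<sigma> c * D) * ((t + \<kappa> p) * (t + \<kappa> c))"
      by (simp only:)
    also have "\<dots> = \<sigma> p * \<sigma> c * (\<kappa> p - \<kappa> c) * ((t + \<kappa> p) * (t + \<kappa> c)) +
        \<sigma> p * (D * (t + \<kappa> c)) * (t + \<kappa> p) - \<sigma> c * (D * (t + \<kappa> p)) * (t + \<kappa> c)"
      by (simp add: algebra_simps)
    also have "\<dots> = \<sigma> p * \<sigma> c * (t\<^sup>2 + 1) * (\<kappa> p - \<kappa> c)"
      unfolding relp[symmetric] relc[symmetric] by (simp add: algebra_simps power2_eq_square)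
    finally show ?thesis
      by (simp add: mult_ac)
  qed
  show "cross (p - a) (c - a) \<ge> 0 \<and> cross (p - b) (c - b) \<ge> 0" if "\<kappa> c \<le> \<kappa> p"
  proof
    have "cross (p - a) (c - a) * D \<ge> 0"
      unfolding from_a using that \<sigma>_pos by simp
    then show "cross (p - a) (c - a) \<ge> 0"
      using \<open>D > 0\<close> by (simp add: zero_le_mult_iff)
    have "cross (p - b) (c - b) * ((t + \<kappa> p) * (t + \<kappa> c) * D) \<ge> 0"
      unfolding from_b using that \<sigma>_pos by simp
    moreover have "(t + \<kappa> p) * (t + \<kappa> c) * D > 0"
      using tk \<open>D > 0\<close> by simp
    ultimately show "cross (p - b) (c - b) \<ge> 0"
      by (metis zero_le_mult_iff not_less)
  qed
  show "p = c" if eq: "\<kappa> c = \<kappa> p"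
  proof -
    have "\<sigma> p * ((\<kappa> p)\<^sup>2 + 1) = \<sigma> c * ((\<kappa> p)\<^sup>2 + 1)"
      using relp relc eq by simp
    then have "\<sigma> p = \<sigma> c"
      using sq[of p] by simp
    then have "cross d (p - c) = 0" "d \<bullet> (p - c) = 0"
      using \<kappa>\<sigma>[OF \<sigma>_pos(1)] \<kappa>\<sigma>[OF \<sigma>_pos(2)] eq
      by (simp_all add: \<sigma>_def cross_diff inner_diff_right)
    then have "(norm d)\<^sup>2 * (norm (p - c))\<^sup>2 = 0"
      by (simp flip: inner_cross_squares)
    then show "p = c"
      using assms(1) by (simp add: d_def)
  qed
qed

text \<open>Take the least inscribed angle, say at \<open>c\<close> over \<open>ab\<close>. A point
  \<open>p\<close> beyond \<open>ab\<close> would see the chord under the supplement of this angle,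
  which leaves a smaller angle at \<open>a\<close> in the triangle \<open>apb\<close>.\<close>

lemma minimal_angle_supporting_chord:
  assumes S: "finite S" "S \<subseteq> sphere x r" and abc0: "{a0, b0, c0} \<subseteq> S" "a0 \<noteq> b0" "a0 \<noteq> c0" "b0 \<noteq> c0"
  obtains a b c where "{a, b, c} \<subseteq> S" "a \<noteq> b" "a \<noteq> c" "b \<noteq> c"
    and "vangle (a - c) (b - c) \<le> vangle (a0 - c0) (b0 - c0)"
    and "\<And>p. p \<in> S \<Longrightarrow> p \<noteq> a \<Longrightarrow> p \<noteq> b \<Longrightarrow> cross (b - a) (p - a) > 0"
proof -
  define Z where "Z = {(a, b, c). {a, b, c} \<subseteq> S \<and> a \<noteq> b \<and> a \<noteq> c \<and> b \<noteq> c}"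
  define ang where "ang = (\<lambda>(a, b, c). vangle (a - c) (b - c))"
  have "Z \<subseteq> S \<times> S \<times> S"
    by (auto simp: Z_def)
  then have "finite Z"
    using S(1) by (meson finite_SigmaI finite_subset)
  moreover have "(a0, b0, c0) \<in> Z"
    using abc0 by (auto simp: Z_def)
  ultimately obtain z where z: "z \<in> Z" "\<forall>y\<in>Z. ang z \<le> ang y"
    using finite_argmin[of Z ang] by blast
  obtain a1 b1 c where z_eq: "z = (a1, b1, c)"
    by (cases z)
  have noncol: "cross (b - a) (p - a) \<noteq> 0" if "{a, b, p} \<subseteq> S" "a \<noteq> b" "a \<noteq> p" "b \<noteq> p" for a b p
    using cocircular_not_collinear[of a x r b p] that S(2) by blast
  obtain a b where ab: "(a, b, c) \<in> Z" "\<forall>y\<in>Z. ang (a, b, c) \<le> ang y" "cross (b - a) (c - a) > 0"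
  proof (cases "cross (b1 - a1) (c - a1) > 0")
    case True
    then show ?thesis
      using that[of a1 b1] z unfolding z_eq by blast
  next
    case False
    have "(b1, a1, c) \<in> Z" "ang (b1, a1, c) = ang z"
      using z unfolding z_eq by (auto simp: Z_def ang_def vangle_commute)
    moreover have "cross (a1 - b1) (c - b1) = - cross (b1 - a1) (c - a1)"
      by (simp add: cross_def algebra_simps)
    moreover have "cross (b1 - a1) (c - a1) \<noteq> 0"
      using noncol z unfolding z_eq by (auto simp: Z_def)
    ultimately show ?thesis
      using that[of b1 a1] z False by simp
  qed
  have abc: "{a, b, c} \<subseteq> S" "a \<noteq> b" "a \<noteq> c" "b \<noteq> c"
    using ab(1) by (auto simp: Z_def)
  obtain t where t: "x = pencil_center a b t" "r = norm (pencil_center a b t - a)"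
    using circle_pencil[of a b x r] abc S(2) by blast
  have pw: "(a - p) \<bullet> (b - p) = t * cross (b - a) (p - a)" if "p \<in> S" for p
    using that S(2) mem_pencil_sphere[of p a b t] unfolding t by blast
  have "cross (b - a) (p - a) > 0" if p: "p \<in> S" "p \<noteq> a" "p \<noteq> b" for p
  proof (rule ccontr)
    assume "\<not> ?thesis"
    moreover have "cross (b - a) (p - a) \<noteq> 0"
      using noncol[of a b p] p abc by auto
    ultimately have neg: "cross (b - a) (p - a) < 0"
      by simp
    have "vangle (p - a) (b - a) < vangle (a - c) (b - c)"
    proof (rule vangle_strict_mono)
      show "cross (p - a) (b - a) \<noteq> 0" "cross (a - c) (b - c) \<noteq> 0"
        using neg ab(3) cross_commute[of "p - a" "b - a"] cross_triangle[of a c b] by simp_all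
      have cr: "\<bar>cross (p - a) (b - a)\<bar> = - cross (b - a) (p - a)"
        "\<bar>cross (a - c) (b - c)\<bar> = cross (b - a) (c - a)"
        using neg ab(3) cross_commute[of "p - a" "b - a"] cross_triangle[of a c b] by simp_all
      have "(p - a) \<bullet> (b - a) = - (t * cross (b - a) (p - a)) + (p - a) \<bullet> (p - a)"
        unfolding pw[OF p(1), symmetric] by (simp add: inner_plane algebra_simps)
      moreover have "(p - a) \<bullet> (p - a) > 0"
        using p by simp
      ultimately have "t * - cross (b - a) (p - a) < (p - a) \<bullet> (b - a)"
        by simp
      then have "(t * - cross (b - a) (p - a)) * cross (b - a) (c - a) < (p - a) \<bullet> (b - a) * cross (b - a) (c - a)"
        using ab(3) by (intro mult_strict_right_mono)
      then show "(a - c) \<bullet> (b - c) * \<bar>cross (p - a) (b - a)\<bar> < (p - a) \<bullet> (b - a) * \<bar>cross (a - c) (b - c)\<bar>"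
        unfolding cr using pw[of c] abc by (simp add: algebra_simps)
    qed
    moreover have "(p, b, a) \<in> Z"
      using p abc by (auto simp: Z_def)
    then have "vangle (a - c) (b - c) \<le> vangle (p - a) (b - a)"
      using ab(2) by (force simp: ang_def)
    ultimately show False
      by simp
  qed
  moreover have "vangle (a - c) (b - c) \<le> vangle (a0 - c0) (b0 - c0)"
    using ab(2) \<open>(a0, b0, c0) \<in> Z\<close> by (force simp: ang_def)
  ultimately show ?thesis
    using that[of a b c] abc by blast
qed

text \<open>Over a chord \<open>ab\<close> with all other points on one side, let \<open>T\<close>
  be the first \<open>l\<close> points of the arc starting with \<open>b\<close>, and let the next
  point \<open>c\<close> be the \<open>b\<close> of the conclusion. The vectors from
  \<open>c\<close> to earlier points and from later points to \<open>c\<close> all lie between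
  \<open>b - c\<close> and \<open>c - a\<close>, whose angle is the supplement of the least
  inscribed angle. The bounds on \<open>l\<close> put \<open>b\<close> into \<open>T\<close> and
  leave \<open>a\<close> to come after \<open>c\<close>.\<close>

lemma exists_wide_extreme_angle:
  assumes S: "finite S" "S \<subseteq> sphere x r" and abc0: "{a0, b0, c0} \<subseteq> S" "a0 \<noteq> b0" "a0 \<noteq> c0" "b0 \<noteq> c0"
    and l: "1 \<le> l" "l + 2 \<le> card S"
  shows "\<exists>T b. T \<subseteq> S \<and> b \<in> S - T \<and> card T = l \<and>
    (\<exists>\<theta>\<in>extreme_angles (zone_dirs S T b). pi - vangle (a0 - c0) (b0 - c0) \<le> \<theta>)"
proof -
  obtain a b c' where c': "{a, b, c'} \<subseteq> S" "a \<noteq> b" "a \<noteq> c'" "b \<noteq> c'"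
    and ang: "vangle (a - c') (b - c') \<le> vangle (a0 - c0) (b0 - c0)"
    and pos: "\<And>p. p \<in> S \<Longrightarrow> p \<noteq> a \<Longrightarrow> p \<noteq> b \<Longrightarrow> cross (b - a) (p - a) > 0"
    using minimal_angle_supporting_chord[OF S abc0] by metis
  obtain t where t: "x = pencil_center a b t" "r = norm (pencil_center a b t - a)"
    using circle_pencil[of a b x r] c' S(2) by blast
  have pw: "(a - p) \<bullet> (b - p) = t * cross (b - a) (p - a)" if "p \<in> S" for p
    using that S(2) mem_pencil_sphere[of p a b t] unfolding t by blast
  define \<kappa> where "\<kappa> = (\<lambda>p. ((b - a) \<bullet> (p - a)) / cross (b - a) (p - a))"
  define X where "X = S - {a, b}"
  have order: "cross (p - a) (q - a) \<ge> 0 \<and> cross (p - b) (q - b) \<ge> 0" if "p \<in> X" "q \<in> X" "\<kappa> q \<le> \<kappa> p" for p q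
    using that pos pw by (intro arc_order(1)[OF c'(2) _ _ _ _ \<kappa>_def]) (auto simp: X_def)
  have "inj_on \<kappa> X"
  proof (rule inj_onI)
    fix p q
    assume "p \<in> X" "q \<in> X" "\<kappa> p = \<kappa> q"
    then show "p = q"
      using pos pw by (intro arc_order(2)[OF c'(2) _ _ _ _ \<kappa>_def]) (auto simp: X_def)
  qed
  moreover have "card X = card S - 2"
    unfolding X_def using c' by (subst card_Diff_subset) auto
  then have "l - 1 < card X"
    using l by linarith
  moreover have "finite X"
    using S(1) by (simp add: X_def)
  \<comment> \<open>A larger \<open>\<kappa>\<close> means nearer to \<open>b\<close> along the arc;
    \<open>l - 1\<close> such points and \<open>b\<close> itself make up \<open>T\<close>.\<close>
  ultimately obtain c where c: "c \<in> X" "card {p \<in> X. \<kappa> c < \<kappa> p} = l - 1"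
    using exists_rank by metis
  define T where "T = insert b {p \<in> X. \<kappa> c < \<kappa> p}"
  have cS: "c \<in> S" "c \<noteq> a" "c \<noteq> b"
    using c(1) by (auto simp: X_def)
  have "card T = l"
    unfolding T_def using c(2) \<open>finite X\<close> l(1) by (subst card_insert_disjoint) (auto simp: X_def)
  moreover have TS: "T \<subseteq> S" "c \<in> S - T" "a \<notin> T" "b \<in> T"
    using c' cS by (auto simp: T_def X_def)
  have cr: "cross (b - c) (c - a) > 0"
    using pos[OF cS] by (simp add: cross_def algebra_simps)
  have rewr: "cross (p - c) (c - a) = cross (p - a) (c - a)" "cross (b - c) (p - c) = cross (p - b) (c - b)"
    "cross (c - p) (c - a) = cross (c - a) (p - a)" "cross (b - c) (c - p) = cross (c - b) (p - b)" for p
    by (simp_all add: cross_def algebra_simps)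
  have "zone_dirs S T c \<subseteq> cone2 (b - c) (c - a)"
  proof
    fix w
    assume "w \<in> zone_dirs S T c"
    then consider p where "p \<in> T" "w = p - c" | q where "q \<in> S - insert c T" "w = c - q"
      unfolding zone_dirs_def by blast
    then show "w \<in> cone2 (b - c) (c - a)"
    proof cases
      case 1
      then show ?thesis
        using order[of p c] c(1) pos[OF cS] unfolding mem_cone2_iff[OF cr] T_def
        by (auto simp: rewr)
    next
      case 2
      then have "q = a \<or> q \<in> X \<and> \<kappa> q \<le> \<kappa> c"
        by (auto simp: T_def X_def)
      then show ?thesis
        using order[of c q] c(1) cr 2 unfolding mem_cone2_iff[OF cr]
        by (auto simp: rewr(3,4))
    qed
  qed
  moreover have "b - c \<in> zone_dirs S T c" "c - a \<in> zone_dirs S T c"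
    using TS c' cS by (auto simp: zone_dirs_def)
  ultimately have "vangle (b - c) (c - a) \<in> extreme_angles (zone_dirs S T c)"
    unfolding extreme_angles_def using cr by force
  \<comment> \<open>Inscribed angle theorem: \<open>c\<close> and \<open>c'\<close> see
    \<open>ab\<close> from the same side of the same circle.\<close>
  moreover have "vangle (a - c) (b - c) \<le> vangle (a - c') (b - c')"
    using c' cS pos pw by (intro pencil_angle_mono[of b a c' c t t]) auto
  then have "pi - vangle (a0 - c0) (b0 - c0) \<le> vangle (b - c) (c - a)"
    using ang vangle_minus_right[of "b - c" "a - c"] by (simp add: vangle_commute)
  ultimately show ?thesis
    using TS \<open>card T = l\<close> by blast
qed

section \<open>Angles of the Voronoi and Brillouin tessellations\<close>

definition cell_dirs :: "plane set \<Rightarrow> plane set \<Rightarrow> plane set" where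
  "cell_dirs S T = {t - q | t q. t \<in> T \<and> q \<in> S - T}"

text \<open>The angles of the tilings of order \<open>k\<close>, read off from the circles through points of \<open>A\<close>.
  At the center \<open>x\<close> of a circle, \<open>T\<close> is the set of those points on it that are counted among the
  \<open>k\<close> nearest ones (for \<open>cell_angles\<close>) or among the \<open>k - 1\<close> nearest ones, \<open>b\<close> being the \<open>k\<close>-th
  (for \<open>zone_angles\<close>).\<close>

definition cell_angles :: "nat \<Rightarrow> plane set \<Rightarrow> real set" where
  "cell_angles k A = {\<theta>. \<exists>x r T. T \<subseteq> A \<inter> sphere x r \<and> card (A \<inter> ball x r) + card T = k \<and>
     \<theta> \<in> extreme_angles (cell_dirs (A \<inter> sphere x r) T)}"

definition zone_angles :: "nat \<Rightarrow> plane set \<Rightarrow> real set" where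
  "zone_angles k A = {\<theta>. \<exists>x r T b. T \<subseteq> A \<inter> sphere x r \<and> b \<in> A \<inter> sphere x r - T \<and>
     card (A \<inter> ball x r) + card T + 1 = k \<and> \<theta> \<in> extreme_angles (zone_dirs (A \<inter> sphere x r) T b)}"

text \<open>The points at distance exactly \<open>r\<close> are ties, which \<open>B\<close> may
  contain or omit; apart from them \<open>B\<close> is determined by \<open>x\<close> and
  \<open>r\<close>.\<close>

definition nearest :: "plane set \<Rightarrow> plane \<Rightarrow> real \<Rightarrow> plane set \<Rightarrow> bool" where
  "nearest A x r B \<longleftrightarrow> A \<inter> ball x r \<subseteq> B \<and> B \<subseteq> A \<inter> cball x r"

definition cell_pairs :: "plane set \<Rightarrow> plane set \<Rightarrow> (plane \<times> plane) set" where
  "cell_pairs A B = B \<times> (A - B)"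

text \<open>Comparisons of \<open>B\<close> with the remaining points follow through
  \<open>b\<close> by transitivity. Leaving them out makes every active direction a chord at
  \<open>b\<close>.\<close>

definition zone_pairs :: "plane set \<Rightarrow> plane set \<Rightarrow> plane \<Rightarrow> (plane \<times> plane) set" where
  "zone_pairs A B b = B \<times> {b} \<union> {b} \<times> (A - insert b B)"

lemma nearest_finite: "locally_finite A \<Longrightarrow> nearest A x r B \<Longrightarrow> finite B"
  unfolding nearest_def locally_finite_def using finite_subset by blast

lemma nearest_norm:
  assumes "nearest A x r B"
  shows "p \<in> B \<Longrightarrow> norm (x - p) \<le> r" and "q \<in> A - B \<Longrightarrow> r \<le> norm (x - q)"
  using assms unfolding nearest_def by (auto simp: dist_norm)

lemma nearest_card:
  assumes "locally_finite A" "nearest A x r B"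
  shows "card B = card (A \<inter> ball x r) + card (B \<inter> sphere x r)"
proof -
  have "B = (A \<inter> ball x r) \<union> (B \<inter> sphere x r)"
    using assms(2) unfolding nearest_def by force
  moreover have "(A \<inter> ball x r) \<inter> (B \<inter> sphere x r) = {}"
    by auto
  moreover have "finite B"
    using nearest_finite[OF assms] .
  ultimately show ?thesis
    using card_Un_disjoint[of "A \<inter> ball x r" "B \<inter> sphere x r"] by (metis finite_Un)
qed

lemma nearest_of_circle:
  assumes "T \<subseteq> A \<inter> sphere x r"
  shows "nearest A x r (A \<inter> ball x r \<union> T)" "(A \<inter> ball x r \<union> T) \<inter> sphere x r = T"
  using assms unfolding nearest_def by auto

lemma nearest_insert:
  assumes "nearest A x r B" "b \<in> A \<inter> sphere x r"
  shows "nearest A x r (insert b B)"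
  using assms unfolding nearest_def by auto

lemma nearest_diff_sphere:
  assumes "nearest A x r B" "nearest A x r C" "t \<in> B" "t \<notin> C"
  shows "t \<in> A \<inter> sphere x r"
proof -
  have "t \<in> A" "dist x t \<le> r" "\<not> dist x t < r"
    using assms unfolding nearest_def by auto
  then show ?thesis
    by simp
qed

lemma zone_anglesI:
  assumes "T \<subseteq> A \<inter> sphere x r" "b \<in> A \<inter> sphere x r - T" "card (A \<inter> ball x r) + card T + 1 = k"
    and "\<theta> \<in> extreme_angles (zone_dirs (A \<inter> sphere x r) T b)"
  shows "\<theta> \<in> zone_angles k A"
  unfolding zone_angles_def mem_Collect_eq using assms
  by (intro exI[of _ x] exI[of _ r] exI[of _ T] exI[of _ b] conjI)

lemma cell_anglesI:
  assumes "T \<subseteq> A \<inter> sphere x r" "card (A \<inter> ball x r) + card T = k"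
    and "\<theta> \<in> extreme_angles (cell_dirs (A \<inter> sphere x r) T)"
  shows "\<theta> \<in> cell_angles k A"
  unfolding cell_angles_def mem_Collect_eq using assms
  by (intro exI[of _ x] exI[of _ r] exI[of _ T] conjI)

lemma vdom_eq_closer_region: "vdom A B = closer_region (cell_pairs A B)"
  by (auto simp: vdom_def closer_region_def cell_pairs_def)

lemma vdom_Int_eq_closer_region:
  assumes "b \<in> A - B"
  shows "vdom A B \<inter> vdom A (insert b B) = closer_region (zone_pairs A B b)"
proof (intro equalityI subsetI)
  fix y
  assume "y \<in> vdom A B \<inter> vdom A (insert b B)"
  then show "y \<in> closer_region (zone_pairs A B b)"
    using assms by (auto simp: vdom_def closer_region_def zone_pairs_def)
next
  fix y
  assume y: "y \<in> closer_region (zone_pairs A B b)"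
  then have 1: "norm (y - p) \<le> norm (y - b)" if "p \<in> B" for p
    using that by (auto simp: closer_region_def zone_pairs_def)
  have 2: "norm (y - b) \<le> norm (y - q)" if "q \<in> A - insert b B" for q
    using y that by (auto simp: closer_region_def zone_pairs_def)
  show "y \<in> vdom A B \<inter> vdom A (insert b B)"
    unfolding vdom_def using 1 2 order_trans[OF 1 2] by blast
qed

text \<open>All points of \<open>B\<close> are within \<open>r\<close> of \<open>x\<close> and all
  others at least \<open>r\<close> away, so a bisector passes through \<open>x\<close> only if both
  of its points lie on the circle.\<close>

lemma nearest_active_cell:
  assumes "nearest A x r B"
  shows "x \<in> closer_region (cell_pairs A B)"
    and "active_dirs (cell_pairs A B) x = cell_dirs (A \<inter> sphere x r) (B \<inter> sphere x r)"
proof -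
  note near = nearest_norm[OF assms]
  have "norm (x - p) \<le> norm (x - q)" if "p \<in> B" "q \<in> A - B" for p q
    using near that by force
  then show "x \<in> closer_region (cell_pairs A B)"
    by (auto simp: closer_region_def cell_pairs_def)
  have "norm (x - p) = norm (x - q) \<longleftrightarrow> norm (x - p) = r \<and> norm (x - q) = r" if "p \<in> B" "q \<in> A - B" for p q
    using near that by force
  then have "active_dirs (cell_pairs A B) x =
      {p - q | p q. p \<in> B \<and> q \<in> A - B \<and> norm (x - p) = r \<and> norm (x - q) = r}"
    unfolding active_dirs_def cell_pairs_def by blast
  also have "\<dots> = cell_dirs (A \<inter> sphere x r) (B \<inter> sphere x r)"
    unfolding cell_dirs_def by (auto simp: dist_norm)
  finally show "active_dirs (cell_pairs A B) x = cell_dirs (A \<inter> sphere x r) (B \<inter> sphere x r)" .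
qed

lemma nearest_active_zone:
  assumes "nearest A x r B" "b \<in> A \<inter> sphere x r - B"
  shows "x \<in> closer_region (zone_pairs A B b)"
    and "active_dirs (zone_pairs A B b) x = zone_dirs (A \<inter> sphere x r) (B \<inter> sphere x r) b"
proof -
  note near = nearest_norm[OF assms(1)]
  have b: "norm (x - b) = r"
    using assms(2) by (simp add: dist_norm)
  show "x \<in> closer_region (zone_pairs A B b)"
    using near b by (auto simp: closer_region_def zone_pairs_def)
  have "active_dirs (zone_pairs A B b) x = {p - b | p. p \<in> B \<and> norm (x - p) = norm (x - b)} \<union>
      {b - q | q. q \<in> A - insert b B \<and> norm (x - b) = norm (x - q)}"
    unfolding active_dirs_def zone_pairs_def by blast
  also have "\<dots> = zone_dirs (A \<inter> sphere x r) (B \<inter> sphere x r) b"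
    unfolding zone_dirs_def b by (auto simp: dist_norm)
  finally show "active_dirs (zone_pairs A B b) x = zone_dirs (A \<inter> sphere x r) (B \<inter> sphere x r) b" .
qed

lemma bisector_system_cell:
  assumes "locally_finite A" "coarsely_dense A" "finite B" "B \<subseteq> A" "b \<in> B"
  shows "bisector_system A (cell_pairs A B) B b"
  using assms by unfold_locales (auto simp: cell_pairs_def)

lemma bisector_system_zone:
  assumes "locally_finite A" "coarsely_dense A" "finite B" "B \<subseteq> A" "b \<in> A - B"
  shows "bisector_system A (zone_pairs A B b) (insert b B) b"
  using assms by unfold_locales (auto simp: zone_pairs_def)

lemma vdom_nearest:
  assumes "x \<in> vdom A B" "finite B" "B \<subseteq> A" "B \<noteq> {}"
  shows "\<exists>r. nearest A x r B"
proof -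
  \<comment> \<open>The farthest point of \<open>B\<close> gives the radius; ties with points
    outside \<open>B\<close> then fall on the circle.\<close>
  obtain m where m: "m \<in> B" "\<forall>p\<in>B. norm (x - p) \<le> norm (x - m)"
    using finite_argmax[OF assms(2,4), of "\<lambda>p. norm (x - p)"] by blast
  have "norm (x - m) \<le> norm (x - a)" if "a \<in> A - B" for a
    using assms(1) m(1) that by (simp add: vdom_def)
  then have "A \<inter> ball x (norm (x - m)) \<subseteq> B"
    by (fastforce simp: dist_norm)
  then have "nearest A x (norm (x - m)) B"
    using assms(3) m(2) by (auto simp: nearest_def dist_norm)
  then show ?thesis
    by blast
qed

lemma angles_Vor:
  assumes lf: "locally_finite A" and cd: "coarsely_dense A" and "k \<ge> 1"
  shows "(\<Union>P\<in>Vor k A. interior_angles P) = (\<lambda>\<theta>. pi - \<theta>) ` cell_angles k A"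
proof (intro equalityI subsetI)
  fix \<phi>
  assume "\<phi> \<in> (\<Union>P\<in>Vor k A. interior_angles P)"
  then obtain B v where B: "B \<subseteq> A" "finite B" "card B = k" "interior (vdom A B) \<noteq> {}"
    and \<phi>: "\<phi> \<in> angles_at (vdom A B) v"
    by (auto simp: Vor_def interior_angles_eq_Union)
  \<comment> \<open>Some point of \<open>B\<close> has to serve as the \<open>b\<close> of
    \<open>bisector_system\<close>; for \<open>k = 0\<close> the region would be the whole
    plane.\<close>
  have "B \<noteq> {}"
    using B(3) \<open>k \<ge> 1\<close> by auto
  then obtain b where "b \<in> B" by blast
  interpret bisector_system A "cell_pairs A B" B b
    using bisector_system_cell[OF lf cd B(2,1) \<open>b \<in> B\<close>] .
  have "v \<in> vdom A B"
    using \<phi> by (auto simp: angles_at_def extreme_point_of_def)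
  then obtain r where r: "nearest A v r B"
    using vdom_nearest B \<open>B \<noteq> {}\<close> by blast
  have "\<phi> \<in> (\<lambda>\<theta>. pi - \<theta>) ` extreme_angles (cell_dirs (A \<inter> sphere v r) (B \<inter> sphere v r))"
    using \<phi> B(4) angles_at_closer_region_subset[of v]
    unfolding vdom_eq_closer_region nearest_active_cell(2)[OF r] by blast
  moreover have "B \<inter> sphere v r \<subseteq> A \<inter> sphere v r" "card (A \<inter> ball v r) + card (B \<inter> sphere v r) = k"
    using B nearest_card[OF lf r] by auto
  ultimately show "\<phi> \<in> (\<lambda>\<theta>. pi - \<theta>) ` cell_angles k A"
    unfolding cell_angles_def by blast
next
  fix \<phi>
  assume "\<phi> \<in> (\<lambda>\<theta>. pi - \<theta>) ` cell_angles k A"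
  then obtain x r T \<theta> where T: "T \<subseteq> A \<inter> sphere x r" "card (A \<inter> ball x r) + card T = k"
    and \<theta>: "\<theta> \<in> extreme_angles (cell_dirs (A \<inter> sphere x r) T)" "\<phi> = pi - \<theta>"
    unfolding cell_angles_def by blast
  define B where "B = A \<inter> ball x r \<union> T"
  have near: "nearest A x r B" and BT: "B \<inter> sphere x r = T"
    unfolding B_def using nearest_of_circle[OF T(1)] by simp_all
  have B: "B \<subseteq> A" "finite B" "card B = k"
    using T nearest_finite[OF lf near] nearest_card[OF lf near] BT by (auto simp: B_def)
  obtain e f where ef: "e \<in> cell_dirs (A \<inter> sphere x r) T" "f \<in> cell_dirs (A \<inter> sphere x r) T"
      "cross e f > 0" "cell_dirs (A \<inter> sphere x r) T \<subseteq> cone2 e f" "\<theta> = vangle e f"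
    using extreme_anglesE[OF \<theta>(1)] .
  have "B \<noteq> {}"
    using B(3) \<open>k \<ge> 1\<close> by auto
  then obtain b where "b \<in> B" by blast
  interpret bisector_system A "cell_pairs A B" B b
    using bisector_system_cell[OF lf cd B(2,1) \<open>b \<in> B\<close>] .
  note corner = angles_at_closer_region_superset[OF nearest_active_cell(1)[OF near],
      unfolded nearest_active_cell(2)[OF near] BT, OF ef(1-4)]
  have "vdom A B \<in> Vor k A"
    using B corner(2) unfolding Vor_def vdom_eq_closer_region by blast
  moreover have "\<phi> \<in> interior_angles (vdom A B)"
    using corner(1) \<theta>(2) ef(5) unfolding interior_angles_eq_Union vdom_eq_closer_region by blast
  ultimately show "\<phi> \<in> (\<Union>P\<in>Vor k A. interior_angles P)"
    by blast
qed

text \<open>Otherwise there are \<open>p\<close> in \<open>B - C\<close> and \<open>q\<close> in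
  \<open>C - B\<close>. Every common point of the regions is equidistant from them, so the overlap
  is contained in a line.\<close>

lemma overlapping_vdoms_nested:
  assumes "interior (vdom A B \<inter> vdom A C) \<noteq> {}" "B \<subseteq> A" "C \<subseteq> A" "finite B" "finite C" "card B \<le> card C"
  shows "B \<subseteq> C"
proof (rule ccontr)
  assume "\<not> B \<subseteq> C"
  then obtain p where p: "p \<in> B" "p \<notin> C" by blast
  have "\<not> C \<subseteq> B"
  proof
    assume "C \<subseteq> B"
    then have "C \<subset> B"
      using p by blast
    then show False
      using psubset_card_mono[OF assms(4) \<open>C \<subset> B\<close>] assms(6) by simp
  qed
  then obtain q where q: "q \<in> C" "q \<notin> B" by blast
  have "vdom A B \<inter> vdom A C \<subseteq> {y. (2 *\<^sub>R (q - p)) \<bullet> y = q \<bullet> q - p \<bullet> p}"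
  proof
    fix y
    assume "y \<in> vdom A B \<inter> vdom A C"
    then have "norm (y - p) \<le> norm (y - q)" "norm (y - q) \<le> norm (y - p)"
      using p q assms(2,3) by (auto simp: vdom_def)
    then show "y \<in> {y. (2 *\<^sub>R (q - p)) \<bullet> y = q \<bullet> q - p \<bullet> p}"
      unfolding closer_iff by (auto simp: inner_diff_left inner_scaleR_left)
  qed
  moreover have "interior {y. (2 *\<^sub>R (q - p)) \<bullet> y = q \<bullet> q - p \<bullet> p} = {}"
    using p q by (intro interior_hyperplane) auto
  ultimately show False
    using assms(1) interior_mono by blast
qed

lemma angles_Bri:
  assumes lf: "locally_finite A" and cd: "coarsely_dense A" and "k \<ge> 1"
  shows "(\<Union>P\<in>Bri k A. interior_angles P) = (\<lambda>\<theta>. pi - \<theta>) ` zone_angles k A"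
proof (intro equalityI subsetI)
  fix \<phi>
  assume "\<phi> \<in> (\<Union>P\<in>Bri k A. interior_angles P)"
  then obtain B C v where B: "B \<subseteq> A" "finite B" "card B = k - 1" and C: "C \<subseteq> A" "finite C" "card C = k"
    and int: "interior (vdom A B \<inter> vdom A C) \<noteq> {}"
    and \<phi>: "\<phi> \<in> angles_at (vdom A B \<inter> vdom A C) v"
    by (auto simp: Bri_def overlay_def Vor_def interior_angles_eq_Union)
  \<comment> \<open>Nested sets of sizes \<open>k - 1\<close> and \<open>k\<close> differ in a
    single point \<open>b\<close>, the \<open>k\<close>-th nearest one throughout the tile.\<close>
  have "B \<subseteq> C"
    using overlapping_vdoms_nested[OF int] B C by simp
  then have "card (C - B) = 1"
    using B C \<open>k \<ge> 1\<close> by (simp add: card_Diff_subset)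
  then obtain b where "C - B = {b}"
    using card_1_singletonE by blast
  then have C_eq: "C = insert b B" and b: "b \<in> A - B"
    using \<open>B \<subseteq> C\<close> C by blast+
  interpret bisector_system A "zone_pairs A B b" "insert b B" b
    using bisector_system_zone[OF lf cd B(2,1) b] .
  note region = vdom_Int_eq_closer_region[OF b]
  define r where "r = norm (v - b)"
  have "v \<in> closer_region (zone_pairs A B b)"
    using \<phi> unfolding C_eq region by (auto simp: angles_at_def extreme_point_of_def)
  then have near: "nearest A v r B"
    using b B by (force simp: nearest_def closer_region_def zone_pairs_def r_def dist_norm)
  have br: "b \<in> A \<inter> sphere v r - B"
    using b by (simp add: r_def dist_norm)
  have "\<phi> \<in> (\<lambda>\<theta>. pi - \<theta>) ` extreme_angles (zone_dirs (A \<inter> sphere v r) (B \<inter> sphere v r) b)"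
    using \<phi> int angles_at_closer_region_subset[of v]
    unfolding C_eq region nearest_active_zone(2)[OF near br] by blast
  moreover have "B \<inter> sphere v r \<subseteq> A \<inter> sphere v r" "b \<in> A \<inter> sphere v r - B \<inter> sphere v r"
      "card (A \<inter> ball v r) + card (B \<inter> sphere v r) + 1 = k"
    using B br nearest_card[OF lf near] \<open>k \<ge> 1\<close> by auto
  ultimately show "\<phi> \<in> (\<lambda>\<theta>. pi - \<theta>) ` zone_angles k A"
    unfolding zone_angles_def by blast
next
  fix \<phi>
  assume "\<phi> \<in> (\<lambda>\<theta>. pi - \<theta>) ` zone_angles k A"
  then obtain x r T b \<theta> where T: "T \<subseteq> A \<inter> sphere x r" "b \<in> A \<inter> sphere x r - T" "card (A \<inter> ball x r) + card T + 1 = k"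
    and \<theta>: "\<theta> \<in> extreme_angles (zone_dirs (A \<inter> sphere x r) T b)" "\<phi> = pi - \<theta>"
    unfolding zone_angles_def by blast
  define B where "B = A \<inter> ball x r \<union> T"
  have near: "nearest A x r B" and BT: "B \<inter> sphere x r = T"
    unfolding B_def using nearest_of_circle[OF T(1)] by simp_all
  have B: "B \<subseteq> A" "finite B" "card B = k - 1"
    using T nearest_finite[OF lf near] nearest_card[OF lf near] BT by (auto simp: B_def)
  have b: "b \<in> A - B" "b \<in> A \<inter> sphere x r - B"
    using T(2) by (auto simp: B_def)
  obtain e f where ef: "e \<in> zone_dirs (A \<inter> sphere x r) T b" "f \<in> zone_dirs (A \<inter> sphere x r) T b"
      "cross e f > 0" "zone_dirs (A \<inter> sphere x r) T b \<subseteq> cone2 e f" "\<theta> = vangle e f"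
    using extreme_anglesE[OF \<theta>(1)] .
  interpret bisector_system A "zone_pairs A B b" "insert b B" b
    using bisector_system_zone[OF lf cd B(2,1) b(1)] .
  note corner = angles_at_closer_region_superset[OF nearest_active_zone(1)[OF near b(2)],
      unfolded nearest_active_zone(2)[OF near b(2)] BT, OF ef(1-4), folded vdom_Int_eq_closer_region[OF b(1)]]
  have "interior (vdom A B) \<noteq> {}" "interior (vdom A (insert b B)) \<noteq> {}"
    using corner(2) interior_Int by auto
  moreover have "insert b B \<subseteq> A" "finite (insert b B)" "card (insert b B) = k"
    using B b T(3) by auto
  ultimately have "vdom A B \<in> Vor (k - 1) A" "vdom A (insert b B) \<in> Vor k A"
    using B unfolding Vor_def by blast+
  then have "vdom A B \<inter> vdom A (insert b B) \<in> Bri k A"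
    using corner(2) unfolding Bri_def overlay_def by blast
  moreover have "\<phi> \<in> interior_angles (vdom A B \<inter> vdom A (insert b B))"
    using corner(1) \<theta>(2) ef(5) unfolding interior_angles_eq_Union by blast
  ultimately show "\<phi> \<in> (\<Union>P\<in>Bri k A. interior_angles P)"
    by blast
qed

section \<open>Angles of the Delaunay mosaics\<close>

lemma convex_hull_Int_supporting_hyperplane:
  fixes a :: "'a::real_inner"
  assumes "\<And>y. y \<in> X \<Longrightarrow> a \<bullet> y \<le> c"
  shows "convex hull X \<inter> {y. a \<bullet> y = c} = convex hull (X \<inter> {y. a \<bullet> y = c})"
proof
  \<comment> \<open>A convex set containing \<open>X\<close>, hence its hull: a convex combination
    attains the bound \<open>c\<close> only if every point with positive weight does.\<close>
  define Y where "Y = {y. a \<bullet> y \<le> c \<and> (a \<bullet> y = c \<longrightarrow> y \<in> convex hull (X \<inter> {y. a \<bullet> y = c}))}"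
  have "convex Y"
  proof (rule convexI)
    fix y z :: 'a and s t :: real
    assume yz: "y \<in> Y" "z \<in> Y" and st: "0 \<le> s" "0 \<le> t" "s + t = 1"
    have le: "s * (a \<bullet> y) \<le> s * c" "t * (a \<bullet> z) \<le> t * c"
      using yz st by (auto simp: Y_def mult_left_mono)
    have sum: "a \<bullet> (s *\<^sub>R y + t *\<^sub>R z) = s * (a \<bullet> y) + t * (a \<bullet> z)"
      by (simp add: inner_add_right)
    have c: "s * c + t * c = c"
      using st(3) by (metis distrib_right mult_1)
    have "s *\<^sub>R y + t *\<^sub>R z \<in> convex hull (X \<inter> {y. a \<bullet> y = c})" if "a \<bullet> (s *\<^sub>R y + t *\<^sub>R z) = c"
    proof -
      have "s * (a \<bullet> y) = s * c" "t * (a \<bullet> z) = t * c"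
        using that le sum c by linarith+
      then consider "s = 0" "t = 1" "a \<bullet> z = c" | "t = 0" "s = 1" "a \<bullet> y = c" | "a \<bullet> y = c" "a \<bullet> z = c"
        using st by fastforce
      then show ?thesis
        using yz st by cases (auto simp: Y_def intro: convexD[OF convex_convex_hull])
    qed
    then show "s *\<^sub>R y + t *\<^sub>R z \<in> Y"
      using le sum c by (auto simp: Y_def)
  qed
  moreover have "X \<subseteq> Y"
    using assms by (auto simp: Y_def intro: hull_inc)
  ultimately have "convex hull X \<subseteq> Y"
    by (simp add: hull_minimal)
  then show "convex hull X \<inter> {y. a \<bullet> y = c} \<subseteq> convex hull (X \<inter> {y. a \<bullet> y = c})"
    by (auto simp: Y_def)
  show "convex hull (X \<inter> {y. a \<bullet> y = c}) \<subseteq> convex hull X \<inter> {y. a \<bullet> y = c}"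
    by (intro hull_minimal convex_Int convex_convex_hull convex_hyperplane) (auto intro: hull_inc)
qed

text \<open>A plane with normal \<open>(u, -1)\<close> is the graph of an affine function, so the
  vertical projection is injective on it.\<close>

lemma aff_dim_fst_hyperplane:
  fixes V :: "(plane \<times> real) set"
  assumes "V \<subseteq> {y. (u, -1) \<bullet> y = c}"
  shows "aff_dim (fst ` V) = aff_dim V"
proof -
  define L where "L = (\<lambda>z::plane. (z, u \<bullet> z))"
  have "linear L"
    unfolding L_def by (intro linearI) (auto simp: inner_add_right)
  moreover have "inj L"
    by (auto simp: L_def inj_on_def)
  moreover have "V = (+) (0, - c) ` L ` fst ` V"
  proof -
    have "(0, - c) + L (fst y) = y" if "y \<in> V" for y
      using assms that by (cases y) (auto simp: L_def)
    then show ?thesis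
      by (force simp: image_image)
  qed
  ultimately show ?thesis
    using aff_dim_injective_linear_image[of L "fst ` V"] aff_dim_translation_eq[of "(0, - c)" "L ` fst ` V"] by metis
qed

text \<open>Replaces faces of the hull by the points of \<open>X\<close> that touch the supporting
  plane; the lemmas on angles of \<open>convex hull V\<close> apply to their projections.\<close>

lemma lower_projection_iff:
  "P \<in> lower_projection X \<longleftrightarrow> (\<exists>u c. (\<forall>y\<in>X. (u, -1) \<bullet> y \<le> c) \<and>
     aff_dim (fst ` (X \<inter> {y. (u, -1) \<bullet> y = c})) = 2 \<and> P = convex hull (fst ` (X \<inter> {y. (u, -1) \<bullet> y = c})))"
proof -
  have facet: "aff_dim (convex hull X \<inter> {y. (u, -1) \<bullet> y = c}) = aff_dim (fst ` (X \<inter> {y. (u, -1) \<bullet> y = c}))"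
      "fst ` (convex hull X \<inter> {y. (u, -1) \<bullet> y = c}) = convex hull (fst ` (X \<inter> {y. (u, -1) \<bullet> y = c}))"
    if "\<forall>y\<in>X. (u, -1) \<bullet> y \<le> c" for u c
    using that convex_hull_Int_supporting_hyperplane[of X "(u, -1)" c]
      aff_dim_fst_hyperplane[of "X \<inter> {y. (u, -1) \<bullet> y = c}" u c]
    by (simp_all add: aff_dim_convex_hull convex_hull_linear_image[OF linear_fst])
  have supp: "convex hull X \<subseteq> {y. (u, -1) \<bullet> y \<le> c} \<longleftrightarrow> (\<forall>y\<in>X. (u, -1) \<bullet> y \<le> c)" for u c
    using subset_hull[of convex "{y. (u, -1) \<bullet> y \<le> c}" X] convex_halfspace_le[of "(u, -1)" c] by blast
  show ?thesis (is "_ \<longleftrightarrow> ?R")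
  proof
    assume "P \<in> lower_projection X"
    then obtain F where F: "lower_facet (convex hull X) F" "P = fst ` F"
      unfolding lower_projection_def by blast
    then obtain u c where u: "\<forall>y\<in>X. (u, -1) \<bullet> y \<le> c"
        "F = convex hull X \<inter> {y. (u, -1) \<bullet> y = c}" "aff_dim F = 2"
      unfolding lower_facet_def supp by blast
    then show ?R
      using F(2) facet[OF u(1)] by (intro exI[of _ u] exI[of _ c]) simp
  next
    assume ?R
    then obtain u c where u: "\<forall>y\<in>X. (u, -1) \<bullet> y \<le> c"
        "aff_dim (fst ` (X \<inter> {y. (u, -1) \<bullet> y = c})) = 2"
        "P = convex hull (fst ` (X \<inter> {y. (u, -1) \<bullet> y = c}))"
      by blast
    then have "lower_facet (convex hull X) (convex hull X \<inter> {y. (u, -1) \<bullet> y = c})"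
      unfolding lower_facet_def supp using facet(1)[OF u(1)] by auto
    then show "P \<in> lower_projection X"
      unfolding lower_projection_def using facet(2)[OF u(1)] u(3) by blast
  qed
qed

section \<open>Exchanges between sets of equal size\<close>

lemma sum_diff_bij:
  fixes f :: "'a \<Rightarrow> 'b::ab_group_add"
  assumes "finite B" "finite C" "bij_betw h (B - C) (C - B)"
  shows "sum f C - sum f B = (\<Sum>t\<in>B - C. f (h t) - f t)"
proof -
  have "sum f C = sum f (C - B) + sum f (B \<inter> C)" "sum f B = sum f (B - C) + sum f (B \<inter> C)"
    using assms sum.Int_Diff[of C f B] sum.Int_Diff[of B f C] by (simp_all add: Int_commute add.commute)
  moreover have "sum f (C - B) = (\<Sum>t\<in>B - C. f (h t))"
    by (rule sum.reindex_bij_betw[OF assms(3), symmetric])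
  ultimately show ?thesis
    by (simp add: sum_subtractf)
qed

lemma exchange_bij:
  assumes "finite B" "finite C" "card B = card C"
  obtains h where "bij_betw h (B - C) (C - B)"
proof -
  have "card (B - C) = card (C - B)"
    using assms card_Diff_subset_Int[of B C] card_Diff_subset_Int[of C B] by (simp add: Int_commute)
  then show ?thesis
    using finite_same_card_bij[of "B - C" "C - B"] assms that by blast
qed

lemma convex_cone_sum: "convex_cone K \<Longrightarrow> (\<And>i. i \<in> I \<Longrightarrow> f i \<in> K) \<Longrightarrow> sum f I \<in> K"
  by (induction I rule: infinite_finite_induct) (auto simp: convex_cone_contains_0 convex_cone_add)

text \<open>The difference is a sum of single exchanges, paired by a bijection between
  \<open>B - C\<close> and \<open>C - B\<close>.\<close>

lemma sum_diff_in_convex_cone: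
  fixes B C :: "'a::real_vector set"
  assumes "finite B" "finite C" "card B = card C" "convex_cone K"
    and "\<And>t q. t \<in> B - C \<Longrightarrow> q \<in> C - B \<Longrightarrow> q - t \<in> K"
  shows "\<Sum>C - \<Sum>B \<in> K"
proof -
  obtain h where h: "bij_betw h (B - C) (C - B)"
    using exchange_bij[OF assms(1-3)] .
  show ?thesis
    unfolding sum_diff_bij[OF assms(1,2) h]
    by (intro convex_cone_sum assms) (use h in \<open>auto dest: bij_betwE\<close>)
qed

definition sum_sq_dist :: "plane \<Rightarrow> plane set \<Rightarrow> real" where
  "sum_sq_dist x B = (\<Sum>a\<in>B. (norm (x - a))\<^sup>2)"

text \<open>Passing from \<open>B\<close> to \<open>C\<close> replaces, one for one, points within
  distance \<open>r\<close> by points at distance at least \<open>r\<close>. If the sum does not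
  change, all exchanged points are at distance exactly \<open>r\<close>.\<close>

lemma sum_sq_dist_nearest:
  assumes lf: "locally_finite A" and near: "nearest A x r B" and C: "C \<subseteq> A" "finite C" "card C = card B"
  shows "sum_sq_dist x B \<le> sum_sq_dist x C"
    and "sum_sq_dist x C = sum_sq_dist x B \<Longrightarrow> nearest A x r C"
proof -
  note norms = nearest_norm[OF near]
  have B: "finite B" "B \<subseteq> A"
    using nearest_finite[OF lf near] near by (auto simp: nearest_def)
  obtain h where h: "bij_betw h (B - C) (C - B)"
    using exchange_bij[OF B(1) C(2)] C(3) by metis
  then have h_in: "h t \<in> C - B" if "t \<in> B - C" for t
    using that by (auto dest: bij_betwE)
  have diff: "sum_sq_dist x C - sum_sq_dist x B = (\<Sum>t\<in>B - C. (norm (x - h t))\<^sup>2 - (norm (x - t))\<^sup>2)"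
    unfolding sum_sq_dist_def by (rule sum_diff_bij[OF B(1) C(2) h])
  have le: "norm (x - t) \<le> r" "r \<le> norm (x - h t)" if "t \<in> B - C" for t
    using norms(1)[of t] norms(2)[of "h t"] h_in[OF that] that C(1) by auto
  have nonneg: "0 \<le> (norm (x - h t))\<^sup>2 - (norm (x - t))\<^sup>2" if "t \<in> B - C" for t
    using le[OF that] by (simp add: power_mono)
  then have "0 \<le> (\<Sum>t\<in>B - C. (norm (x - h t))\<^sup>2 - (norm (x - t))\<^sup>2)"
    by (rule sum_nonneg)
  then show "sum_sq_dist x B \<le> sum_sq_dist x C"
    using diff by linarith
  show "nearest A x r C" if "sum_sq_dist x C = sum_sq_dist x B"
  proof -
    have "(norm (x - h t))\<^sup>2 - (norm (x - t))\<^sup>2 = 0" if "t \<in> B - C" for t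
      using diff \<open>sum_sq_dist x C = sum_sq_dist x B\<close> nonneg that B(1)
        sum_nonneg_eq_0_iff[of "B - C" "\<lambda>t. (norm (x - h t))\<^sup>2 - (norm (x - t))\<^sup>2"] by force
    then have eq: "norm (x - h t) = r \<and> norm (x - t) = r" if "t \<in> B - C" for t
      using le[OF that] that by force
    have "A \<inter> ball x r \<subseteq> C"
      using near eq unfolding nearest_def by (force simp: dist_norm)
    moreover have "norm (x - q) \<le> r" if "q \<in> C" for q
    proof (cases "q \<in> B")
      case False
      then have "q \<in> h ` (B - C)"
        using h that by (auto simp: bij_betw_def)
      then show ?thesis
        using eq by auto
    qed (use norms in auto)
    ultimately show ?thesis
      using C(1) unfolding nearest_def by (auto simp: dist_norm)
  qed
qed

text \<open>Lifting to the paraboloid: maximizing the functional with gradient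
  \<open>2 *\<^sub>R x\<close> over lifted points means minimizing the squared distance from
  \<open>x\<close>.\<close>

lemma inner_lift: "(2 *\<^sub>R x, -1) \<bullet> lift a = (norm x)\<^sup>2 - (norm (x - a))\<^sup>2"
  by (simp add: lift_def power2_norm_eq_inner inner_simps inner_commute)

lemma inner_sum_lift: "(2 *\<^sub>R x, -1) \<bullet> (\<Sum>a\<in>B. lift a) = real (card B) * (norm x)\<^sup>2 - sum_sq_dist x B"
  by (simp add: inner_sum_right inner_lift sum_subtractf sum_sq_dist_def)

lemma fst_sum_lift: "fst (\<Sum>a\<in>B. lift a) = \<Sum>B"
  by (simp add: fst_sum lift_def)

lemma finite_Int_sphere:
  assumes "locally_finite A"
  shows "finite (A \<inter> sphere x r)"
proof (rule finite_subset)
  show "finite (A \<inter> cball x r)"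
    using assms by (simp add: locally_finite_def)
qed auto

text \<open>The centroids of all choices of \<open>k\<close> nearest points of \<open>x\<close>. If
  they span the plane, their hull is the Delaunay tile belonging to \<open>x\<close>.\<close>

definition cell_vertices :: "nat \<Rightarrow> plane set \<Rightarrow> plane \<Rightarrow> real \<Rightarrow> plane set" where
  "cell_vertices k A x r = {(1 / real k) *\<^sub>R \<Sum>B | B. nearest A x r B \<and> card B = k}"

lemma finite_nearest_sets:
  assumes "locally_finite A"
  shows "finite {B. nearest A x r B}"
proof (rule finite_subset)
  show "{B. nearest A x r B} \<subseteq> Pow (A \<inter> cball x r)"
    by (auto simp: nearest_def)
  show "finite (Pow (A \<inter> cball x r))"
    unfolding finite_Pow_iff using assms by (simp add: locally_finite_def)
qed

text \<open>At an averaged lift the functional is \<open>(norm x)\<^sup>2\<close> minus the mean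
  squared distance from \<open>x\<close>, so it is maximal exactly at sets of nearest
  points.\<close>

lemma cell_lower_facet:
  fixes k :: nat and A :: "plane set"
  defines "X \<equiv> {(1 / real k) *\<^sub>R (\<Sum>a\<in>B. lift a) | B. B \<subseteq> A \<and> finite B \<and> card B = k}"
  assumes lf: "locally_finite A" and "k \<ge> 1" and near: "nearest A x r B" "card B = k"
  defines "c \<equiv> (2 *\<^sub>R x, -1) \<bullet> ((1 / real k) *\<^sub>R (\<Sum>a\<in>B. lift a))"
  shows "\<forall>y\<in>X. (2 *\<^sub>R x, -1) \<bullet> y \<le> c"
    and "fst ` (X \<inter> {y. (2 *\<^sub>R x, -1) \<bullet> y = c}) = cell_vertices k A x r"
proof -
  have val: "(2 *\<^sub>R x, -1) \<bullet> ((1 / real k) *\<^sub>R (\<Sum>a\<in>C. lift a)) = (norm x)\<^sup>2 - sum_sq_dist x C / real k"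
    if "card C = k" for C
    using \<open>k \<ge> 1\<close> that unfolding inner_scaleR_right inner_sum_lift by (simp add: diff_divide_distrib)
  have le: "(2 *\<^sub>R x, -1) \<bullet> ((1 / real k) *\<^sub>R (\<Sum>a\<in>C. lift a)) \<le> c"
    and eq: "(2 *\<^sub>R x, -1) \<bullet> ((1 / real k) *\<^sub>R (\<Sum>a\<in>C. lift a)) = c \<longleftrightarrow> nearest A x r C"
    if C: "C \<subseteq> A" "finite C" "card C = k" for C
  proof -
    show "(2 *\<^sub>R x, -1) \<bullet> ((1 / real k) *\<^sub>R (\<Sum>a\<in>C. lift a)) \<le> c"
      unfolding c_def val[OF C(3)] val[OF near(2)]
      using sum_sq_dist_nearest(1)[OF lf near(1) C(1,2)] C(3) near(2) \<open>k \<ge> 1\<close> by (simp add: divide_right_mono)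
    have "nearest A x r C \<Longrightarrow> sum_sq_dist x C \<le> sum_sq_dist x B"
      using sum_sq_dist_nearest(1)[OF lf, of x r C B] near nearest_finite[OF lf near(1)] C
      by (auto simp: nearest_def)
    then have "sum_sq_dist x C = sum_sq_dist x B \<longleftrightarrow> nearest A x r C"
      using sum_sq_dist_nearest[OF lf near(1) C(1,2)] C(3) near(2) by auto
    then show "(2 *\<^sub>R x, -1) \<bullet> ((1 / real k) *\<^sub>R (\<Sum>a\<in>C. lift a)) = c \<longleftrightarrow> nearest A x r C"
      unfolding c_def val[OF C(3)] val[OF near(2)] using \<open>k \<ge> 1\<close> by auto
  qed
  show "\<forall>y\<in>X. (2 *\<^sub>R x, -1) \<bullet> y \<le> c"
    unfolding X_def using le by blast
  have "X \<inter> {y. (2 *\<^sub>R x, -1) \<bullet> y = c} =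
      {(1 / real k) *\<^sub>R (\<Sum>a\<in>C. lift a) | C. C \<subseteq> A \<and> finite C \<and> card C = k \<and> nearest A x r C}"
    unfolding X_def using eq by blast
  also have "\<dots> = {(1 / real k) *\<^sub>R (\<Sum>a\<in>C. lift a) | C. nearest A x r C \<and> card C = k}"
    using nearest_finite[OF lf] unfolding nearest_def by blast
  finally show "fst ` (X \<inter> {y. (2 *\<^sub>R x, -1) \<bullet> y = c}) = cell_vertices k A x r"
    unfolding cell_vertices_def by (simp add: setcompr_eq_image image_image fst_sum_lift)
qed

text \<open>Testing against the exchange of a single \<open>b\<close> for a single \<open>a\<close>
  already compares their distances from \<open>x\<close>.\<close>

lemma maximal_cell_nearest:
  assumes B: "B \<subseteq> A" "finite B" "B \<noteq> {}"
    and max: "\<And>C. C \<subseteq> A \<Longrightarrow> finite C \<Longrightarrow> card C = card B \<Longrightarrow> sum_sq_dist x B \<le> sum_sq_dist x C"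
  shows "\<exists>r. nearest A x r B"
proof (rule vdom_nearest[OF _ B(2,1,3)])
  have "norm (x - b) \<le> norm (x - a)" if "b \<in> B" "a \<in> A - B" for a b
  proof -
    have "card B > 0"
      using that B(2) card_gt_0_iff by blast
    then have "card (insert a (B - {b})) = card B"
      using that B(2) by simp
    then have "sum_sq_dist x B \<le> sum_sq_dist x (insert a (B - {b}))"
      using max[of "insert a (B - {b})"] that B by auto
    also have "\<dots> = sum_sq_dist x B - (norm (x - b))\<^sup>2 + (norm (x - a))\<^sup>2"
      using that B(2) by (simp add: sum_sq_dist_def sum_diff1)
    finally show ?thesis
      by simp
  qed
  then show "x \<in> vdom A B"
    by (simp add: vdom_def)
qed

lemma Del_eq:
  assumes lf: "locally_finite A" and "k \<ge> 1"
  shows "Del k A = {convex hull (cell_vertices k A x r) | x r. aff_dim (cell_vertices k A x r) = 2}"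
proof (intro equalityI subsetI)
  define X where "X = {(1 / real k) *\<^sub>R (\<Sum>a\<in>B. lift a) | B. B \<subseteq> A \<and> finite B \<and> card B = k}"
  {
    fix P
    assume "P \<in> Del k A"
    then obtain u c where le: "\<forall>y\<in>X. (u, -1) \<bullet> y \<le> c"
      and dim: "aff_dim (fst ` (X \<inter> {y. (u, -1) \<bullet> y = c})) = 2"
      and P: "P = convex hull (fst ` (X \<inter> {y. (u, -1) \<bullet> y = c}))"
      unfolding Del_def X_def[symmetric] lower_projection_iff by blast
    \<comment> \<open>By \<open>inner_lift\<close>, the center that belongs to a supporting plane is
      half its gradient.\<close>
    define x where "x = (1/2) *\<^sub>R u"
    have u: "u = 2 *\<^sub>R x"
      by (simp add: x_def)
    have "X \<inter> {y. (u, -1) \<bullet> y = c} \<noteq> {}"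
      using dim by auto
    then obtain B where B: "B \<subseteq> A" "finite B" "card B = k" "(u, -1) \<bullet> ((1 / real k) *\<^sub>R (\<Sum>a\<in>B. lift a)) = c"
      unfolding X_def by blast
    have "sum_sq_dist x B \<le> sum_sq_dist x C" if "C \<subseteq> A" "finite C" "card C = card B" for C
    proof -
      have "(u, -1) \<bullet> ((1 / real k) *\<^sub>R (\<Sum>a\<in>C. lift a)) \<le> (u, -1) \<bullet> ((1 / real k) *\<^sub>R (\<Sum>a\<in>B. lift a))"
        unfolding B(4) by (rule bspec[OF le]) (use that B(3) in \<open>auto simp: X_def\<close>)
      then show ?thesis
        unfolding u inner_scaleR_right inner_sum_lift using \<open>k \<ge> 1\<close> that(3) B(3)
        by (simp add: divide_le_cancel)
    qed
    moreover have "B \<noteq> {}"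
      using B(3) \<open>k \<ge> 1\<close> by auto
    ultimately obtain r where r: "nearest A x r B"
      using maximal_cell_nearest[OF B(1,2)] by blast
    have "fst ` (X \<inter> {y. (u, -1) \<bullet> y = c}) = cell_vertices k A x r"
      using cell_lower_facet(2)[OF lf \<open>k \<ge> 1\<close> r B(3)] B(4) unfolding u X_def by simp
    then show "P \<in> {convex hull (cell_vertices k A x r) | x r. aff_dim (cell_vertices k A x r) = 2}"
      using dim P by auto
  next
    fix P
    assume "P \<in> {convex hull (cell_vertices k A x r) | x r. aff_dim (cell_vertices k A x r) = 2}"
    then obtain x r where P: "P = convex hull (cell_vertices k A x r)" "aff_dim (cell_vertices k A x r) = 2"
      by blast
    then have "cell_vertices k A x r \<noteq> {}"
      by auto
    then obtain B where "nearest A x r B" "card B = k"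
      by (auto simp: cell_vertices_def)
    note facet = cell_lower_facet[OF lf \<open>k \<ge> 1\<close> this]
    show "P \<in> Del k A"
      unfolding Del_def lower_projection_iff
      by (intro exI conjI, rule facet(1)) (simp_all only: facet(2) P)
  }
qed

text \<open>Provides the data for the lemmas on hulls. Replacing \<open>t\<close> by
  \<open>q\<close> moves the centroid along \<open>q - t\<close>, the opposite of the bisector
  normal \<open>t - q\<close>; a common change of sign preserves angles, so \<open>cell_dirs\<close>
  serves both \<open>Del\<close> and \<open>Vor\<close>.\<close>

lemma cell_vertex_dirs:
  assumes lf: "locally_finite A" and "k \<ge> 1" and near: "nearest A x r B" "card B = k"
  defines "E \<equiv> uminus ` cell_dirs (A \<inter> sphere x r) (B \<inter> sphere x r)" and "v \<equiv> (1 / real k) *\<^sub>R \<Sum>B"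
  shows "finite E" "0 \<notin> E" "v \<in> cell_vertices k A x r"
    and "w \<in> cell_vertices k A x r \<Longrightarrow> w - v \<in> convex_cone hull E"
    and "e \<in> E \<Longrightarrow> \<exists>s>0. v + s *\<^sub>R e \<in> cell_vertices k A x r"
proof -
  have fin: "finite (A \<inter> sphere x r)"
    by (rule finite_Int_sphere[OF lf])
  have "E \<subseteq> (\<lambda>(q, t). q - t) ` ((A \<inter> sphere x r) \<times> (A \<inter> sphere x r))"
    using near(1) unfolding E_def cell_dirs_def nearest_def by force
  then show "finite E"
    using fin by (meson finite_SigmaI finite_imageI finite_subset)
  show "0 \<notin> E"
    unfolding E_def cell_dirs_def by auto
  show "v \<in> cell_vertices k A x r"
    using near by (auto simp: cell_vertices_def v_def)
  have finB: "finite B"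
    using nearest_finite[OF lf near(1)] .
  show "w - v \<in> convex_cone hull E" if "w \<in> cell_vertices k A x r"
  proof -
    obtain C where C: "nearest A x r C" "card C = k" "w = (1 / real k) *\<^sub>R \<Sum>C"
      using \<open>w \<in> _\<close> by (auto simp: cell_vertices_def)
    have "\<Sum>C - \<Sum>B \<in> convex_cone hull E"
    proof (rule sum_diff_in_convex_cone)
      fix t q
      assume tq: "t \<in> B - C" "q \<in> C - B"
      then have "t \<in> B \<inter> sphere x r" "q \<in> A \<inter> sphere x r - B \<inter> sphere x r"
        using nearest_diff_sphere[OF near(1) C(1), of t] nearest_diff_sphere[OF C(1) near(1), of q] by auto
      then have "- (t - q) \<in> E"
        unfolding E_def cell_dirs_def by blast
      then show "q - t \<in> convex_cone hull E"
        by (simp add: hull_inc)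
    qed (use finB nearest_finite[OF lf C(1)] near(2) C(2) convex_cone_convex_cone_hull in auto)
    then have "(1 / real k) *\<^sub>R (\<Sum>C - \<Sum>B) \<in> convex_cone hull E"
      by (intro convex_cone_hull_mul) auto
    then show ?thesis
      by (simp add: v_def C(3) scaleR_diff_right)
  qed
  show "\<exists>s>0. v + s *\<^sub>R e \<in> cell_vertices k A x r" if "e \<in> E"
  proof -
    obtain t q where tq: "t \<in> B" "t \<in> sphere x r" "q \<in> A \<inter> sphere x r" "q \<notin> B" "e = q - t"
      using \<open>e \<in> E\<close> unfolding E_def cell_dirs_def by auto
    define C where "C = insert q (B - {t})"
    have "nearest A x r C"
      using near(1) tq unfolding nearest_def C_def by auto
    moreover have "card C = k"
      using near(2) finB tq \<open>k \<ge> 1\<close> by (simp add: C_def)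
    moreover have "\<Sum>C = \<Sum>B + e"
      using finB tq by (simp add: C_def sum_diff1)
    then have "(1 / real k) *\<^sub>R \<Sum>C = v + (1 / real k) *\<^sub>R e"
      by (simp add: v_def scaleR_add_right)
    ultimately have "v + (1 / real k) *\<^sub>R e \<in> cell_vertices k A x r"
      unfolding cell_vertices_def by (metis (mono_tags, lifting) mem_Collect_eq)
    then show ?thesis
      using \<open>k \<ge> 1\<close> by (intro exI[of _ "1 / real k"]) auto
  qed
qed

lemma finite_cell_vertices:
  assumes "locally_finite A"
  shows "finite (cell_vertices k A x r)"
proof -
  have "cell_vertices k A x r \<subseteq> (\<lambda>B. (1 / real k) *\<^sub>R \<Sum>B) ` {B. nearest A x r B}"
    by (auto simp: cell_vertices_def)
  then show ?thesis
    using finite_nearest_sets[OF assms] by (meson finite_imageI finite_subset)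
qed

lemma extreme_angles_uminus_eq: "extreme_angles (uminus ` E) = extreme_angles E"
  using extreme_angles_uminus[of E] extreme_angles_uminus[of "uminus ` E"] by (auto simp: image_image)

lemma angles_Del:
  assumes lf: "locally_finite A" and "k \<ge> 1"
  shows "(\<Union>P\<in>Del k A. interior_angles P) = cell_angles k A"
proof (intro equalityI subsetI)
  fix \<theta>
  assume "\<theta> \<in> (\<Union>P\<in>Del k A. interior_angles P)"
  then obtain x r v where dim: "aff_dim (cell_vertices k A x r) = 2"
    and \<theta>: "\<theta> \<in> angles_at (convex hull (cell_vertices k A x r)) v"
    unfolding Del_eq[OF assms] interior_angles_eq_Union by blast
  have "v extreme_point_of convex hull (cell_vertices k A x r)"
    using \<theta> by (auto simp: angles_at_def)
  then have "v \<in> cell_vertices k A x r"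
    using extreme_point_of_convex_hull by blast
  then obtain B where B: "nearest A x r B" "card B = k" and v: "v = (1 / real k) *\<^sub>R \<Sum>B"
    by (auto simp: cell_vertices_def)
  note dirs = cell_vertex_dirs[OF lf \<open>k \<ge> 1\<close> B, folded v]
  have "\<theta> \<in> extreme_angles (cell_dirs (A \<inter> sphere x r) (B \<inter> sphere x r))"
    using \<theta> angles_at_convex_hull_subset[OF finite_cell_vertices[OF lf] dirs(3,1,2,4,5) dim]
    by (auto simp: extreme_angles_uminus_eq)
  moreover have "B \<inter> sphere x r \<subseteq> A \<inter> sphere x r" "card (A \<inter> ball x r) + card (B \<inter> sphere x r) = k"
    using B nearest_card[OF lf B(1)] by (auto simp: nearest_def)
  ultimately show "\<theta> \<in> cell_angles k A"
    unfolding cell_angles_def by blast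
next
  fix \<theta>
  assume "\<theta> \<in> cell_angles k A"
  then obtain x r T where T: "T \<subseteq> A \<inter> sphere x r" "card (A \<inter> ball x r) + card T = k"
    and \<theta>: "\<theta> \<in> extreme_angles (cell_dirs (A \<inter> sphere x r) T)"
    unfolding cell_angles_def by blast
  define B where "B = A \<inter> ball x r \<union> T"
  have near: "nearest A x r B" and BT: "B \<inter> sphere x r = T"
    unfolding B_def using nearest_of_circle[OF T(1)] by simp_all
  have card: "card B = k"
    using T nearest_card[OF lf near] BT by simp
  note dirs = cell_vertex_dirs[OF lf \<open>k \<ge> 1\<close> near card]
  have "\<theta> \<in> extreme_angles (uminus ` cell_dirs (A \<inter> sphere x r) (B \<inter> sphere x r))"
    using \<theta> by (simp add: extreme_angles_uminus_eq BT)
  from angles_at_convex_hull_superset[OF finite_cell_vertices[OF lf] dirs(3,4,5) this]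
  show "\<theta> \<in> (\<Union>P\<in>Del k A. interior_angles P)"
    unfolding Del_eq[OF assms] interior_angles_eq_Union by blast
qed

section \<open>Angles of the Iglesias mosaics\<close>

definition zone_vertices :: "nat \<Rightarrow> plane set \<Rightarrow> plane \<Rightarrow> real \<Rightarrow> plane set" where
  "zone_vertices k A x r = {(1 / (2 * real k - 1)) *\<^sub>R b + (2 / (2 * real k - 1)) *\<^sub>R \<Sum>T | T b.
     nearest A x r T \<and> b \<in> A \<inter> sphere x r - T \<and> card T + 1 = k}"

definition zone_point :: "nat \<Rightarrow> plane set \<Rightarrow> plane \<Rightarrow> plane \<times> real" where
  "zone_point k T b = (1 / (2 * real k - 1)) *\<^sub>R lift b + (2 / (2 * real k - 1)) *\<^sub>R (\<Sum>a\<in>T. lift a)"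

definition zone_points :: "nat \<Rightarrow> plane set \<Rightarrow> (plane \<times> real) set" where
  "zone_points k A = {zone_point k T b | T b. T \<subseteq> A \<and> finite T \<and> b \<in> A - T \<and> card T + 1 = k}"

lemma Igl_eq_lower_projection: "Igl k A = lower_projection (zone_points k A)"
proof -
  have "{(1 / (2 * real k - 1)) *\<^sub>R lift b + (2 / (2 * real k - 1)) *\<^sub>R (\<Sum>a\<in>B - {b}. lift a) | B b.
      B \<subseteq> A \<and> finite B \<and> card B = k \<and> b \<in> B} = zone_points k A" (is "?L = _")
  proof (intro equalityI subsetI)
    fix y
    assume "y \<in> ?L"
    then obtain B b where B: "B \<subseteq> A" "finite B" "card B = k" "b \<in> B" and y: "y = zone_point k (B - {b}) b"
      unfolding zone_point_def by blast
    have "card B > 0"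
      using B card_gt_0_iff by blast
    then have "B - {b} \<subseteq> A" "finite (B - {b})" "b \<in> A - (B - {b})" "card (B - {b}) + 1 = k"
      using B by auto
    then show "y \<in> zone_points k A"
      unfolding zone_points_def y by blast
  next
    fix y
    assume "y \<in> zone_points k A"
    then obtain T b where T: "T \<subseteq> A" "finite T" "b \<in> A - T" "card T + 1 = k" and y: "y = zone_point k T b"
      unfolding zone_points_def by blast
    then have "insert b T \<subseteq> A" "finite (insert b T)" "card (insert b T) = k" "b \<in> insert b T" "insert b T - {b} = T"
      by auto
    then show "y \<in> ?L"
      unfolding y zone_point_def by (intro CollectI exI[of _ "insert b T"] exI[of _ b]) simp
  qed
  then show ?thesis
    by (simp add: Igl_def)
qed

text \<open>Weight 1 for \<open>b\<close> and 2 for \<open>T\<close> amount to the sum over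
  \<open>T\<close> plus the sum over \<open>insert b T\<close>, with \<open>2 * real k - 1\<close>
  as total weight. So the orders \<open>k - 1\<close> and \<open>k\<close> are optimized together,
  as in the overlay.\<close>

lemma inner_zone_point:
  assumes "finite T" "b \<notin> T" "card T + 1 = k"
  shows "(2 *\<^sub>R x, -1) \<bullet> zone_point k T b =
    (norm x)\<^sup>2 - (sum_sq_dist x T + sum_sq_dist x (insert b T)) / (2 * real k - 1)"
proof -
  define N where "N = 2 * real k - 1"
  have "N > 0"
    using assms(3) by (simp add: N_def)
  have card: "1 + 2 * real (card T) = N"
    using assms(3) by (simp add: N_def)
  have "(2 *\<^sub>R x, -1) \<bullet> zone_point k T b =
      (1 / N) * ((norm x)\<^sup>2 - (norm (x - b))\<^sup>2) + (2 / N) * (real (card T) * (norm x)\<^sup>2 - sum_sq_dist x T)"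
    unfolding zone_point_def N_def[symmetric] inner_add_right inner_scaleR_right inner_lift inner_sum_lift ..
  also have "\<dots> = ((1 + 2 * real (card T)) * (norm x)\<^sup>2 - (2 * sum_sq_dist x T + (norm (x - b))\<^sup>2)) / N"
    using \<open>N > 0\<close> by (simp add: field_simps)
  also have "2 * sum_sq_dist x T + (norm (x - b))\<^sup>2 = sum_sq_dist x T + sum_sq_dist x (insert b T)"
    using assms by (simp add: sum_sq_dist_def)
  finally show ?thesis
    unfolding card N_def[symmetric] using \<open>N > 0\<close> by (simp add: diff_divide_distrib)
qed

lemma zone_lower_facet:
  assumes lf: "locally_finite A" and near: "nearest A x r T" "b \<in> A \<inter> sphere x r - T" "card T + 1 = k"
  defines "c \<equiv> (2 *\<^sub>R x, -1) \<bullet> zone_point k T b"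
  shows "\<forall>y\<in>zone_points k A. (2 *\<^sub>R x, -1) \<bullet> y \<le> c"
    and "fst ` (zone_points k A \<inter> {y. (2 *\<^sub>R x, -1) \<bullet> y = c}) = zone_vertices k A x r"
proof -
  have sq_le: "sum_sq_dist x T \<le> sum_sq_dist x C" "sum_sq_dist x (insert b T) \<le> sum_sq_dist x (insert d C)"
    if "nearest A x r T" "b \<in> A \<inter> sphere x r - T" "card T + 1 = k"
      "C \<subseteq> A" "finite C" "d \<in> A - C" "card C + 1 = k" for T C b d
  proof -
    show "sum_sq_dist x T \<le> sum_sq_dist x C"
      using that by (intro sum_sq_dist_nearest(1)[OF lf, of x r]) auto
    show "sum_sq_dist x (insert b T) \<le> sum_sq_dist x (insert d C)"
      using that nearest_insert[of A x r T b] nearest_finite[OF lf that(1)]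
      by (intro sum_sq_dist_nearest(1)[OF lf, of x r]) auto
  qed
  have finT: "finite T"
    using nearest_finite[OF lf near(1)] .
  have c: "c = (norm x)\<^sup>2 - (sum_sq_dist x T + sum_sq_dist x (insert b T)) / (2 * real k - 1)"
    unfolding c_def using near by (intro inner_zone_point finT) auto
  have N: "2 * real k - 1 > 0"
    using near(3) by auto
  have le: "(2 *\<^sub>R x, -1) \<bullet> zone_point k C d \<le> c"
    and eq: "(2 *\<^sub>R x, -1) \<bullet> zone_point k C d = c \<longleftrightarrow> nearest A x r C \<and> d \<in> A \<inter> sphere x r - C"
    if C: "C \<subseteq> A" "finite C" "d \<in> A - C" "card C + 1 = k" for C d
  proof -
    have val: "(2 *\<^sub>R x, -1) \<bullet> zone_point k C d =
        (norm x)\<^sup>2 - (sum_sq_dist x C + sum_sq_dist x (insert d C)) / (2 * real k - 1)"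
      using C by (intro inner_zone_point) auto
    note sq = sq_le[OF near C]
    show "(2 *\<^sub>R x, -1) \<bullet> zone_point k C d \<le> c"
      unfolding val c using sq N by (simp add: divide_right_mono)
    have "(2 *\<^sub>R x, -1) \<bullet> zone_point k C d = c \<longleftrightarrow>
        sum_sq_dist x C + sum_sq_dist x (insert d C) = sum_sq_dist x T + sum_sq_dist x (insert b T)"
      unfolding val c using N by auto
    \<comment> \<open>Both summands are minimal for \<open>T\<close> and \<open>insert b T\<close>,
      so equality of the sums forces equality in each.\<close>
    also have "\<dots> \<longleftrightarrow> sum_sq_dist x C = sum_sq_dist x T \<and> sum_sq_dist x (insert d C) = sum_sq_dist x (insert b T)"
      using sq by auto
    also have "\<dots> \<longleftrightarrow> nearest A x r C \<and> d \<in> A \<inter> sphere x r - C"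
    proof
      assume *: "sum_sq_dist x C = sum_sq_dist x T \<and> sum_sq_dist x (insert d C) = sum_sq_dist x (insert b T)"
      have "nearest A x r C"
        using * C near by (intro sum_sq_dist_nearest(2)[OF lf near(1)]) auto
      moreover have "nearest A x r (insert d C)"
        using * C near finT
        by (intro sum_sq_dist_nearest(2)[OF lf nearest_insert[OF near(1)], of b]) auto
      \<comment> \<open>\<open>d\<close> is within distance \<open>r\<close> by the second fact, and
        not inside the circle because \<open>C\<close> contains all enclosed points but not
        \<open>d\<close>.\<close>
      ultimately show "nearest A x r C \<and> d \<in> A \<inter> sphere x r - C"
        using C(3) unfolding nearest_def by force
    next
      assume *: "nearest A x r C \<and> d \<in> A \<inter> sphere x r - C"
      have "sum_sq_dist x C \<le> sum_sq_dist x T" "sum_sq_dist x (insert d C) \<le> sum_sq_dist x (insert b T)"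
        using sq_le[of C d T b] * near C(4) finT by (auto simp: nearest_def)
      then show "sum_sq_dist x C = sum_sq_dist x T \<and> sum_sq_dist x (insert d C) = sum_sq_dist x (insert b T)"
        using sq by simp
    qed
    finally show "(2 *\<^sub>R x, -1) \<bullet> zone_point k C d = c \<longleftrightarrow> nearest A x r C \<and> d \<in> A \<inter> sphere x r - C" .
  qed
  show "\<forall>y\<in>zone_points k A. (2 *\<^sub>R x, -1) \<bullet> y \<le> c"
    unfolding zone_points_def using le by blast
  have "zone_points k A \<inter> {y. (2 *\<^sub>R x, -1) \<bullet> y = c} =
      {zone_point k C d | C d. C \<subseteq> A \<and> finite C \<and> d \<in> A - C \<and> card C + 1 = k \<and>
        nearest A x r C \<and> d \<in> A \<inter> sphere x r - C}"
    unfolding zone_points_def using eq by blast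
  also have "\<dots> = {zone_point k C d | C d. nearest A x r C \<and> d \<in> A \<inter> sphere x r - C \<and> card C + 1 = k}"
    using nearest_finite[OF lf] unfolding nearest_def by blast
  also have "\<dots> = (\<lambda>(C, d). zone_point k C d) ` {(C, d). nearest A x r C \<and> d \<in> A \<inter> sphere x r - C \<and> card C + 1 = k}"
    by (auto simp: image_def)
  finally have facet: "zone_points k A \<inter> {y. (2 *\<^sub>R x, -1) \<bullet> y = c} = (\<lambda>(C, d). zone_point k C d) `
      {(C, d). nearest A x r C \<and> d \<in> A \<inter> sphere x r - C \<and> card C + 1 = k}" .
  have pt: "fst (zone_point k C d) = (1 / (2 * real k - 1)) *\<^sub>R d + (2 / (2 * real k - 1)) *\<^sub>R \<Sum>C" for C d
    unfolding zone_point_def by (simp add: fst_sum_lift) (simp add: lift_def)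
  have "zone_vertices k A x r = (\<lambda>(C, d). fst (zone_point k C d)) `
      {(C, d). nearest A x r C \<and> d \<in> A \<inter> sphere x r - C \<and> card C + 1 = k}"
    unfolding pt by (auto simp: zone_vertices_def image_def)
  then show "fst ` (zone_points k A \<inter> {y. (2 *\<^sub>R x, -1) \<bullet> y = c}) = zone_vertices k A x r"
    unfolding facet image_image by (simp add: case_prod_unfold)
qed

text \<open>Two kinds of competitors suffice. Another last point \<open>a\<close> with the same
  \<open>T\<close> shows that \<open>b\<close> is nearest among the rest; exchanging the roles of
  \<open>b\<close> and \<open>t\<close>, which changes the total by the difference of their squared
  distances, shows that \<open>t\<close> is no farther than \<open>b\<close>.\<close>

lemma maximal_zone_nearest:
  assumes T: "T \<subseteq> A" "finite T" "b \<in> A - T"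
    and max: "\<And>C d. C \<subseteq> A \<Longrightarrow> finite C \<Longrightarrow> d \<in> A - C \<Longrightarrow> card C = card T \<Longrightarrow>
      sum_sq_dist x T + sum_sq_dist x (insert b T) \<le> sum_sq_dist x C + sum_sq_dist x (insert d C)"
  shows "nearest A x (norm (x - b)) T"
proof -
  have sq: "sum_sq_dist x C + sum_sq_dist x (insert d C) = 2 * sum_sq_dist x C + (norm (x - d))\<^sup>2"
    if "finite C" "d \<notin> C" for C d
    using that by (simp add: sum_sq_dist_def)
  have "norm (x - b) \<le> norm (x - a)" if "a \<in> A - T" for a
    using max[of T a] sq[of T a] sq[of T b] T that by simp
  moreover have "norm (x - t) \<le> norm (x - b)" if t: "t \<in> T" for t
  proof -
    define C where "C = insert b (T - {t})"
    have "card T > 0"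
      using t T(2) card_gt_0_iff by blast
    then have C: "C \<subseteq> A" "finite C" "t \<in> A - C" "card C = card T"
      using T t by (auto simp: C_def)
    have "sum_sq_dist x C = sum_sq_dist x T - (norm (x - t))\<^sup>2 + (norm (x - b))\<^sup>2"
      using T t by (simp add: C_def sum_sq_dist_def sum_diff1)
    then have "(norm (x - t))\<^sup>2 \<le> (norm (x - b))\<^sup>2"
      using max[OF C] sq[of C t] sq[of T b] C T by simp
    then show ?thesis
      by simp
  qed
  ultimately show ?thesis
    using T unfolding nearest_def by (fastforce simp: dist_norm)
qed

lemma Igl_eq:
  assumes lf: "locally_finite A"
  shows "Igl k A = {convex hull (zone_vertices k A x r) | x r. aff_dim (zone_vertices k A x r) = 2}"
proof (intro equalityI subsetI)
  fix P
  assume "P \<in> Igl k A"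
  then obtain u c where le: "\<forall>y\<in>zone_points k A. (u, -1) \<bullet> y \<le> c"
    and dim: "aff_dim (fst ` (zone_points k A \<inter> {y. (u, -1) \<bullet> y = c})) = 2"
    and P: "P = convex hull (fst ` (zone_points k A \<inter> {y. (u, -1) \<bullet> y = c}))"
    unfolding Igl_eq_lower_projection lower_projection_iff by blast
  define x where "x = (1/2) *\<^sub>R u"
  have u: "u = 2 *\<^sub>R x"
    by (simp add: x_def)
  have "zone_points k A \<inter> {y. (u, -1) \<bullet> y = c} \<noteq> {}"
    using dim by auto
  then obtain T b where T: "T \<subseteq> A" "finite T" "b \<in> A - T" "card T + 1 = k" "(u, -1) \<bullet> zone_point k T b = c"
    unfolding zone_points_def by blast
  have N: "2 * real k - 1 > 0"
    using T(4) by auto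
  have "sum_sq_dist x T + sum_sq_dist x (insert b T) \<le> sum_sq_dist x C + sum_sq_dist x (insert d C)"
    if C: "C \<subseteq> A" "finite C" "d \<in> A - C" "card C = card T" for C d
  proof -
    have "(u, -1) \<bullet> zone_point k C d \<le> (u, -1) \<bullet> zone_point k T b"
      unfolding T(5) by (rule bspec[OF le]) (use C T(4) in \<open>auto simp: zone_points_def\<close>)
    then show ?thesis
      unfolding u using C T N by (simp add: inner_zone_point divide_le_cancel)
  qed
  then have near: "nearest A x (norm (x - b)) T"
    by (intro maximal_zone_nearest T)
  have b: "b \<in> A \<inter> sphere x (norm (x - b)) - T"
    using T(3) by (simp add: dist_norm)
  have "fst ` (zone_points k A \<inter> {y. (u, -1) \<bullet> y = c}) = zone_vertices k A x (norm (x - b))"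
    using zone_lower_facet(2)[OF lf near b T(4)] T(5) unfolding u by simp
  then show "P \<in> {convex hull (zone_vertices k A x r) | x r. aff_dim (zone_vertices k A x r) = 2}"
    using dim P by auto
next
  fix P
  assume "P \<in> {convex hull (zone_vertices k A x r) | x r. aff_dim (zone_vertices k A x r) = 2}"
  then obtain x r where P: "P = convex hull (zone_vertices k A x r)" "aff_dim (zone_vertices k A x r) = 2"
    by blast
  then have "zone_vertices k A x r \<noteq> {}"
    by auto
  then obtain T b where "nearest A x r T" "b \<in> A \<inter> sphere x r - T" "card T + 1 = k"
    unfolding zone_vertices_def by blast
  note facet = zone_lower_facet[OF lf this]
  show "P \<in> Igl k A"
    unfolding Igl_eq_lower_projection lower_projection_iff
    by (intro exI conjI, rule facet(1)) (simp_all only: facet(2) P)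
qed

text \<open>There are two elementary moves: exchanging the roles of \<open>b\<close> and some
  \<open>t\<close> in \<open>T\<close> changes \<open>b + 2 *\<^sub>R \<Sum>T\<close> by
  \<open>b - t\<close>, and replacing \<open>b\<close> by \<open>q\<close> changes it by
  \<open>q - b\<close>. Up to sign these are the \<open>zone_dirs\<close>.\<close>

lemma zone_vertex_dirs:
  assumes lf: "locally_finite A" and near: "nearest A x r T" "b \<in> A \<inter> sphere x r - T" "card T + 1 = k"
  defines "E \<equiv> uminus ` zone_dirs (A \<inter> sphere x r) (T \<inter> sphere x r) b"
    and "v \<equiv> (1 / (2 * real k - 1)) *\<^sub>R b + (2 / (2 * real k - 1)) *\<^sub>R \<Sum>T"
  shows "finite E" "0 \<notin> E" "v \<in> zone_vertices k A x r"
    and "w \<in> zone_vertices k A x r \<Longrightarrow> w - v \<in> convex_cone hull E"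
    and "e \<in> E \<Longrightarrow> \<exists>s>0. v + s *\<^sub>R e \<in> zone_vertices k A x r"
proof -
  define N where "N = 2 * real k - 1"
  have "N > 0"
    using near(3) by (simp add: N_def)
  have v: "v = (1 / N) *\<^sub>R (b + 2 *\<^sub>R \<Sum>T)"
    by (simp add: v_def N_def scaleR_add_right)
  have finT: "finite T"
    using nearest_finite[OF lf near(1)] .
  have E_eq: "E = (\<lambda>t. b - t) ` (T \<inter> sphere x r) \<union> (\<lambda>q. q - b) ` (A \<inter> sphere x r - insert b T)"
    unfolding E_def zone_dirs_def by (force simp: image_Un image_image)
  show "finite E"
    unfolding E_eq using finT finite_Int_sphere[OF lf, of x r] by simp
  show "0 \<notin> E"
    unfolding E_eq using near(2) by auto
  show "v \<in> zone_vertices k A x r"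
    using near unfolding zone_vertices_def v_def by blast
  \<comment> \<open>A general exchange is composed of two elementary moves by way of
    \<open>b\<close>.\<close>
  have cone: "q - t \<in> convex_cone hull E"
    if "t \<in> insert b (T \<inter> sphere x r)" "q \<in> A \<inter> sphere x r - T" for t q
  proof -
    have "b - t \<in> convex_cone hull E"
      using that(1) by (auto simp: E_eq convex_cone_hull_contains_0 intro: hull_inc)
    moreover have "q - b \<in> convex_cone hull E"
      using that(2) by (cases "q = b") (auto simp: E_eq convex_cone_hull_contains_0 intro: hull_inc)
    ultimately have "(q - b) + (b - t) \<in> convex_cone hull E"
      by (intro convex_cone_hull_add)
    then show ?thesis
      by simp
  qed
  show "w - v \<in> convex_cone hull E" if "w \<in> zone_vertices k A x r"
  proof -
    obtain C d where C: "nearest A x r C" "d \<in> A \<inter> sphere x r - C" "card C + 1 = k"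
      and "w = (1 / N) *\<^sub>R d + (2 / N) *\<^sub>R \<Sum>C"
      using \<open>w \<in> _\<close> unfolding zone_vertices_def N_def[symmetric] by blast
    then have w: "w = (1 / N) *\<^sub>R (d + 2 *\<^sub>R \<Sum>C)"
      by (simp add: scaleR_add_right)
    have finC: "finite C"
      using nearest_finite[OF lf C(1)] .
    have "\<Sum>C - \<Sum>T \<in> convex_cone hull E"
    proof (rule sum_diff_in_convex_cone)
      fix t q
      assume "t \<in> T - C" "q \<in> C - T"
      then show "q - t \<in> convex_cone hull E"
        using nearest_diff_sphere[OF near(1) C(1), of t] nearest_diff_sphere[OF C(1) near(1), of q]
        by (intro cone) auto
    qed (use finT finC near(3) C(3) convex_cone_convex_cone_hull in auto)
    moreover have "\<Sum>(insert d C) - \<Sum>(insert b T) \<in> convex_cone hull E"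
    proof (rule sum_diff_in_convex_cone)
      fix t q
      assume tq: "t \<in> insert b T - insert d C" "q \<in> insert d C - insert b T"
      show "q - t \<in> convex_cone hull E"
      proof (rule cone)
        show "t \<in> insert b (T \<inter> sphere x r)"
          using tq nearest_diff_sphere[OF near(1) C(1), of t] by auto
        show "q \<in> A \<inter> sphere x r - T"
          using tq C(2) nearest_diff_sphere[OF C(1) near(1), of q] by auto
      qed
    qed (use finT finC near C convex_cone_convex_cone_hull in auto)
    ultimately have "(\<Sum>C - \<Sum>T) + (\<Sum>(insert d C) - \<Sum>(insert b T)) \<in> convex_cone hull E"
      by (rule convex_cone_hull_add)
    \<comment> \<open>The weights 1 and 2 again split into one set of size \<open>k - 1\<close> and
      one of size \<open>k\<close>, each changed by exchanges.\<close>
    also have "(\<Sum>C - \<Sum>T) + (\<Sum>(insert d C) - \<Sum>(insert b T)) = (d + 2 *\<^sub>R \<Sum>C) - (b + 2 *\<^sub>R \<Sum>T)"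
      using finT finC near(2) C(2) by (simp add: scaleR_2)
    finally have "(1 / N) *\<^sub>R ((d + 2 *\<^sub>R \<Sum>C) - (b + 2 *\<^sub>R \<Sum>T)) \<in> convex_cone hull E"
      using \<open>N > 0\<close> by (intro convex_cone_hull_mul) auto
    then show ?thesis
      by (simp only: v w scaleR_diff_right)
  qed
  show "\<exists>s>0. v + s *\<^sub>R e \<in> zone_vertices k A x r" if "e \<in> E"
  proof -
    have "\<exists>C d. nearest A x r C \<and> d \<in> A \<inter> sphere x r - C \<and> card C + 1 = k \<and>
        d + 2 *\<^sub>R \<Sum>C = (b + 2 *\<^sub>R \<Sum>T) + e"
    proof -
      consider t where "t \<in> T" "t \<in> sphere x r" "e = b - t"
        | q where "q \<in> A \<inter> sphere x r" "q \<noteq> b" "q \<notin> T" "e = q - b"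
        using \<open>e \<in> E\<close> unfolding E_eq by blast
      then show ?thesis
      proof cases
        case 1
        define C where "C = insert b (T - {t})"
        have "card T > 0"
          using 1 finT card_gt_0_iff by blast
        then have "card C + 1 = k"
          using 1 near finT by (simp add: C_def)
        moreover have "nearest A x r C" "t \<in> A \<inter> sphere x r - C"
          using 1 near by (auto simp: nearest_def C_def)
        moreover have "\<Sum>C = \<Sum>T - t + b"
          using 1 near finT by (simp add: C_def sum_diff1)
        then have "t + 2 *\<^sub>R \<Sum>C = (b + 2 *\<^sub>R \<Sum>T) + e"
          using 1(3) by (simp add: scaleR_2)
        ultimately show ?thesis
          by blast
      next
        case 2
        then show ?thesis
          using near by (intro exI[of _ T] exI[of _ q]) auto
      qed
    qed
    then obtain C d where C: "nearest A x r C" "d \<in> A \<inter> sphere x r - C" "card C + 1 = k"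
        "d + 2 *\<^sub>R \<Sum>C = (b + 2 *\<^sub>R \<Sum>T) + e"
      by blast
    have "v + (1 / N) *\<^sub>R e = (1 / N) *\<^sub>R (d + 2 *\<^sub>R \<Sum>C)"
      unfolding C(4) v by (simp only: scaleR_add_right)
    also have "\<dots> = (1 / N) *\<^sub>R d + (2 / N) *\<^sub>R \<Sum>C"
      by (simp add: scaleR_add_right)
    also have "\<dots> \<in> zone_vertices k A x r"
      unfolding zone_vertices_def N_def using C by blast
    finally show ?thesis
      using \<open>N > 0\<close> by (intro exI[of _ "1 / N"]) auto
  qed
qed

lemma finite_zone_vertices:
  assumes "locally_finite A"
  shows "finite (zone_vertices k A x r)"
proof -
  have "zone_vertices k A x r \<subseteq> (\<lambda>(T, b). (1 / (2 * real k - 1)) *\<^sub>R b + (2 / (2 * real k - 1)) *\<^sub>R \<Sum>T) `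
      ({T. nearest A x r T} \<times> (A \<inter> sphere x r))"
    unfolding zone_vertices_def by force
  then show ?thesis
    using finite_nearest_sets[OF assms] finite_Int_sphere[OF assms] by (meson finite_SigmaI finite_imageI finite_subset)
qed

lemma angles_Igl:
  assumes lf: "locally_finite A"
  shows "(\<Union>P\<in>Igl k A. interior_angles P) = zone_angles k A"
proof (intro equalityI subsetI)
  fix \<theta>
  assume "\<theta> \<in> (\<Union>P\<in>Igl k A. interior_angles P)"
  then obtain x r v where dim: "aff_dim (zone_vertices k A x r) = 2"
    and \<theta>: "\<theta> \<in> angles_at (convex hull (zone_vertices k A x r)) v"
    unfolding Igl_eq[OF assms] interior_angles_eq_Union by blast
  have "v extreme_point_of convex hull (zone_vertices k A x r)"
    using \<theta> by (auto simp: angles_at_def)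
  then have "v \<in> zone_vertices k A x r"
    using extreme_point_of_convex_hull by blast
  then obtain T b where T: "nearest A x r T" "b \<in> A \<inter> sphere x r - T" "card T + 1 = k"
    and v: "v = (1 / (2 * real k - 1)) *\<^sub>R b + (2 / (2 * real k - 1)) *\<^sub>R \<Sum>T"
    unfolding zone_vertices_def by blast
  note dirs = zone_vertex_dirs[OF lf T, folded v]
  have "\<theta> \<in> extreme_angles (zone_dirs (A \<inter> sphere x r) (T \<inter> sphere x r) b)"
    using \<theta> angles_at_convex_hull_subset[OF finite_zone_vertices[OF lf] dirs(3,1,2,4,5) dim]
    by (auto simp: extreme_angles_uminus_eq)
  moreover have "T \<inter> sphere x r \<subseteq> A \<inter> sphere x r" "b \<in> A \<inter> sphere x r - T \<inter> sphere x r"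
      "card (A \<inter> ball x r) + card (T \<inter> sphere x r) + 1 = k"
    using T nearest_card[OF lf T(1)] by (auto simp: nearest_def)
  ultimately show "\<theta> \<in> zone_angles k A"
    unfolding zone_angles_def by blast
next
  fix \<theta>
  assume "\<theta> \<in> zone_angles k A"
  then obtain x r T b where T: "T \<subseteq> A \<inter> sphere x r" "b \<in> A \<inter> sphere x r - T" "card (A \<inter> ball x r) + card T + 1 = k"
    and \<theta>: "\<theta> \<in> extreme_angles (zone_dirs (A \<inter> sphere x r) T b)"
    unfolding zone_angles_def by blast
  define B where "B = A \<inter> ball x r \<union> T"
  have near: "nearest A x r B" and BT: "B \<inter> sphere x r = T"
    unfolding B_def using nearest_of_circle[OF T(1)] by simp_all
  have B: "card B + 1 = k" "b \<in> A \<inter> sphere x r - B"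
    using T nearest_card[OF lf near] BT by (auto simp: B_def)
  note dirs = zone_vertex_dirs[OF lf near B(2,1)]
  have "\<theta> \<in> extreme_angles (uminus ` zone_dirs (A \<inter> sphere x r) (B \<inter> sphere x r) b)"
    using \<theta> by (simp add: extreme_angles_uminus_eq BT)
  from angles_at_convex_hull_superset[OF finite_zone_vertices[OF lf] dirs(3,4,5) this]
  show "\<theta> \<in> (\<Union>P\<in>Igl k A. interior_angles P)"
    unfolding Igl_eq[OF assms] interior_angles_eq_Union by blast
qed

section \<open>Monotonicity in the order\<close>

lemma extreme_angles_pair: "cross e f \<noteq> 0 \<Longrightarrow> vangle e f \<in> extreme_angles {e, f}"
proof -
  assume "cross e f \<noteq> 0"
  moreover have "e \<in> cone2 e f"
    unfolding cone2_def by (intro CollectI exI[of _ 1] exI[of _ 0]) simp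
  moreover have "f \<in> cone2 e f"
    unfolding cone2_def by (intro CollectI exI[of _ 0] exI[of _ 1]) simp
  ultimately show ?thesis
    unfolding extreme_angles_def by blast
qed

lemma zone_dirsE:
  assumes "e \<in> zone_dirs S T b" "T \<subseteq> S" "b \<in> S - T"
  obtains a where "a \<in> S" "a \<noteq> b" "a \<in> T \<and> e = a - b \<or> a \<notin> T \<and> e = b - a"
  using assms unfolding zone_dirs_def by blast

text \<open>In the triangle \<open>pqb\<close>, \<open>\<theta>\<close> is the angle at
  \<open>b\<close> or its supplement; the angle at \<open>b\<close> is in turn at most the
  supplement of the angle at \<open>p\<close>. The inscribed angle found in this way is decreased by
  \<open>next_circle\<close>, and a zone angle at least as large as its supplement is supplied by
  \<open>exists_wide_extreme_angle\<close>.\<close>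

lemma zone_angles_ge_ex:
  assumes lf: "locally_finite A" and cd: "coarsely_dense A" and \<theta>: "\<theta> \<in> zone_angles k A"
  shows "\<exists>\<theta>'\<in>zone_angles (k + 1) A. \<theta> \<le> \<theta>'"
proof -
  obtain x r T b where T: "T \<subseteq> A \<inter> sphere x r" "b \<in> A \<inter> sphere x r - T" "card (A \<inter> ball x r) + card T + 1 = k"
    and "\<theta> \<in> extreme_angles (zone_dirs (A \<inter> sphere x r) T b)"
    using \<theta> unfolding zone_angles_def by blast
  then obtain e f where ef: "e \<in> zone_dirs (A \<inter> sphere x r) T b" "f \<in> zone_dirs (A \<inter> sphere x r) T b"
      "cross e f > 0" "\<theta> = vangle e f"
    by (metis extreme_anglesE)
  obtain p where p: "p \<in> A \<inter> sphere x r" "p \<noteq> b" "e = p - b \<or> e = b - p"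
    using zone_dirsE[OF ef(1) T(1,2)] by blast
  obtain q where q: "q \<in> A \<inter> sphere x r" "q \<noteq> b" "f = q - b \<or> f = b - q"
    using zone_dirsE[OF ef(2) T(1,2)] by blast
  have cr: "cross (p - b) (q - b) \<noteq> 0"
    using ef(3) p(3) q(3) by (auto simp: cross_diff)
  then have "p \<noteq> q"
    by auto
  have "\<theta> = vangle (p - b) (q - b) \<or> \<theta> = pi - vangle (p - b) (q - b)"
    using ef(4) p(3) q(3) vangle_minus_left[of "p - b" "q - b"] vangle_minus_right[of "p - b" "q - b"]
      vangle_minus_right[of "b - p" "q - b"] by auto
  moreover have "vangle (p - b) (q - b) \<le> pi - vangle (b - p) (q - p)"
    by (rule triangle_two_angles_le[OF cr])
  ultimately obtain s t u where stu: "s \<in> A \<inter> sphere x r" "t \<in> A \<inter> sphere x r" "u \<in> A \<inter> sphere x r"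
      "s \<noteq> t" "s \<noteq> u" "t \<noteq> u" and le: "\<theta> \<le> pi - vangle (s - u) (t - u)"
    using p q T(2) \<open>p \<noteq> q\<close> by (metis DiffD1 order_refl)
  have "card (A \<inter> ball x r) < k"
    using T(3) by linarith
  then obtain x' r' c where c: "s \<in> sphere x' r'" "t \<in> sphere x' r'" "c \<in> A \<inter> sphere x' r'" "c \<noteq> s" "c \<noteq> t"
    and few: "card (A \<inter> ball x' r') < k"
    and many: "k + 2 \<le> card (A \<inter> ball x' r') + card (A \<inter> sphere x' r')"
    and ang: "vangle (s - c) (t - c) \<le> vangle (s - u) (t - u)"
    using next_circle[OF lf cd stu] by blast
  \<comment> \<open>With the enclosed points, \<open>l\<close> points of the circle make
    \<open>k\<close> points before the chosen one, which is order \<open>k + 1\<close>;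
    \<open>few\<close> and \<open>many\<close> give the two bounds on \<open>l\<close>.\<close>
  define l where "l = k - card (A \<inter> ball x' r')"
  have l: "1 \<le> l" "l + 2 \<le> card (A \<inter> sphere x' r')" "card (A \<inter> ball x' r') + l = k"
    using few many by (auto simp: l_def)
  have "{s, t, c} \<subseteq> A \<inter> sphere x' r'"
    using c stu by auto
  then obtain T' b' where T': "T' \<subseteq> A \<inter> sphere x' r'" "b' \<in> A \<inter> sphere x' r' - T'" "card T' = l"
    and "\<exists>\<theta>'\<in>extreme_angles (zone_dirs (A \<inter> sphere x' r') T' b'). pi - vangle (s - c) (t - c) \<le> \<theta>'"
    using exists_wide_extreme_angle[OF finite_Int_sphere[OF lf] Int_lower2 _ stu(4) c(4)[symmetric] c(5)[symmetric] l(1,2)]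
    by blast
  then obtain \<theta>' where "\<theta>' \<in> extreme_angles (zone_dirs (A \<inter> sphere x' r') T' b')" "pi - vangle (s - c) (t - c) \<le> \<theta>'"
    by blast
  moreover from this have "\<theta>' \<in> zone_angles (k + 1) A"
    using T' l(3) by (intro zone_anglesI) auto
  ultimately show ?thesis
    using le ang by (intro bexI[of _ \<theta>']) auto
qed

text \<open>Needed because \<open>Inf\<close> and \<open>Sup\<close> carry no information on the
  empty set. An empty circle settles order 1, and \<open>zone_angles_ge_ex\<close> passes the
  property on.\<close>

lemma zone_angles_nonempty:
  assumes lf: "locally_finite A" and cd: "coarsely_dense A" and "k \<ge> 1"
  shows "zone_angles k A \<noteq> {}"
  using \<open>k \<ge> 1\<close>
proof (induction k rule: dec_induct)
  case base
  obtain x r a b c where S: "{a, b, c} \<subseteq> A \<inter> sphere x r" and ne: "a \<noteq> b" "a \<noteq> c" "b \<noteq> c" and empty: "A \<inter> ball x r = {}"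
    using exists_empty_circle[OF lf cd] by blast
  define E where "E = zone_dirs (A \<inter> sphere x r) {} c"
  have E: "E = (\<lambda>q. c - q) ` (A \<inter> sphere x r - {c})"
    by (simp add: E_def zone_dirs_def)
  have "finite E"
    using finite_Int_sphere[OF lf] by (simp add: E)
  \<comment> \<open>The rest of the circle lies strictly on the inner side of the tangent at
    \<open>c\<close>, so the directions lie in an open half-plane.\<close>
  moreover have "(c - x) \<bullet> e > 0" if "e \<in> E" for e
  proof -
    obtain q where q: "q \<in> sphere x r" "q \<noteq> c" "e = c - q"
      using \<open>e \<in> E\<close> unfolding E by blast
    have "norm (q - x) = norm (c - x)"
      using q(1) S by (auto simp: dist_norm norm_minus_commute)
    then have "(q - x) \<bullet> (q - x) = (c - x) \<bullet> (c - x)"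
      by (simp add: norm_eq)
    then have "2 * ((c - x) \<bullet> e) = (c - q) \<bullet> (c - q)"
      unfolding q(3) by (simp add: inner_diff_left inner_diff_right inner_commute)
    moreover have "(c - q) \<bullet> (c - q) > 0"
      using q(2) by simp
    ultimately show ?thesis
      by linarith
  qed
  moreover have "c - a \<in> E" "c - b \<in> E"
    using S ne by (auto simp: E)
  moreover have "cross (c - a) (c - b) \<noteq> 0"
    using cocircular_not_collinear[of c x r a b] S ne by (auto simp: cross_diff)
  ultimately obtain e f where "e \<in> E" "f \<in> E" "cross e f > 0" "E \<subseteq> cone2 e f"
    using extreme_angles_exist[of E "c - x" "c - a" "c - b"] by blast
  then have "vangle e f \<in> extreme_angles (zone_dirs (A \<inter> sphere x r) {} c)"
    unfolding extreme_angles_def E_def by force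
  moreover have "{} \<subseteq> A \<inter> sphere x r" "c \<in> A \<inter> sphere x r - {}"
      "card (A \<inter> ball x r) + card ({} :: plane set) + 1 = 1"
    using S empty by auto
  ultimately have "vangle e f \<in> zone_angles 1 A"
    by (intro zone_anglesI)
  then show ?case
    by blast
next
  case (step k)
  then show ?case
    using zone_angles_ge_ex[OF lf cd] by (metis Suc_eq_plus1 empty_iff ex_in_conv)
qed

section \<open>The generic case: circles through exactly three points\<close>

definition triangle_angles :: "nat \<Rightarrow> plane set \<Rightarrow> real set" where
  "triangle_angles n A = {\<gamma>. \<exists>x r a b c. A \<inter> sphere x r = {a, b, c} \<and> a \<noteq> b \<and> a \<noteq> c \<and> b \<noteq> c \<and>
     card (A \<inter> ball x r) = n \<and> \<gamma> = vangle (a - c) (b - c)}"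

lemma triangle_anglesI:
  assumes "A \<inter> sphere x r = {a, b, c}" "a \<noteq> b" "a \<noteq> c" "b \<noteq> c" "card (A \<inter> ball x r) = n"
  shows "vangle (a - c) (b - c) \<in> triangle_angles n A"
  unfolding triangle_angles_def
  by (intro CollectI exI[of _ x] exI[of _ r] exI[of _ a] exI[of _ b] exI[of _ c] conjI refl assms)

lemma triangle_anglesE:
  assumes "\<gamma> \<in> triangle_angles n A"
  obtains x r a b c where "A \<inter> sphere x r = {a, b, c}" "a \<noteq> b" "a \<noteq> c" "b \<noteq> c"
    "card (A \<inter> ball x r) = n" "\<gamma> = vangle (a - c) (b - c)"
  using assms unfolding triangle_angles_def mem_Collect_eq by (elim exE conjE)

lemma generic_circle:
  assumes gen: "generic A" and lf: "locally_finite A"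
    and S: "{a, b, c} \<subseteq> A \<inter> sphere x r" and ne: "a \<noteq> b" "a \<noteq> c" "b \<noteq> c"
  shows "A \<inter> sphere x r = {a, b, c}"
proof -
  \<comment> \<open>\<open>generic\<close> speaks of positive radii only; a degenerate circle cannot
    hold two points.\<close>
  have "r > 0"
  proof (rule ccontr)
    assume "\<not> r > 0"
    then have "a = x" "b = x"
      using S zero_le_dist[of x a] zero_le_dist[of x b] by auto
    then show False
      using ne by simp
  qed
  have "\<not> 4 \<le> card (A \<inter> sphere x r)"
  proof
    assume "4 \<le> card (A \<inter> sphere x r)"
    then obtain U where "U \<subseteq> A \<inter> sphere x r" "card U = 4"
      using obtain_subset_with_card_n by metis
    then show False
      using gen \<open>r > 0\<close> unfolding generic_def by blast
  qed
  moreover have "card {a, b, c} = 3"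
    using ne by simp
  ultimately show ?thesis
    using card_seteq[OF finite_Int_sphere[OF lf] S] by simp
qed

lemma triangle_angles_le_ex:
  assumes gen: "generic A" and lf: "locally_finite A" and cd: "coarsely_dense A" and \<gamma>: "\<gamma> \<in> triangle_angles n A"
  shows "\<exists>\<gamma>'\<in>triangle_angles (n + 1) A. \<gamma>' \<le> \<gamma>"
proof -
  obtain x r a b c where S: "A \<inter> sphere x r = {a, b, c}" and ne: "a \<noteq> b" "a \<noteq> c" "b \<noteq> c"
    and n: "card (A \<inter> ball x r) = n" and \<gamma>_eq: "\<gamma> = vangle (a - c) (b - c)"
    using triangle_anglesE[OF \<gamma>] .
  have abc: "a \<in> A \<inter> sphere x r" "b \<in> A \<inter> sphere x r" "c \<in> A \<inter> sphere x r"
    by (simp_all add: S)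
  \<comment> \<open>With three points on the new circle, the bound \<open>n + 2\<close> makes
    \<open>few\<close> and \<open>many\<close> leave exactly \<open>n + 1\<close> enclosed
    points.\<close>
  have "card (A \<inter> ball x r) < n + 2"
    using n by simp
  then obtain x' r' d where d: "a \<in> sphere x' r'" "b \<in> sphere x' r'" "d \<in> A \<inter> sphere x' r'" "d \<noteq> a" "d \<noteq> b"
    and few: "card (A \<inter> ball x' r') < n + 2"
    and many: "n + 2 + 2 \<le> card (A \<inter> ball x' r') + card (A \<inter> sphere x' r')"
    and ang: "vangle (a - d) (b - d) \<le> vangle (a - c) (b - c)"
    using next_circle[OF lf cd abc ne] by blast
  have S': "A \<inter> sphere x' r' = {a, b, d}"
    using d abc ne by (intro generic_circle[OF gen lf]) auto
  moreover have "card {a, b, d} = 3"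
    using ne d by auto
  ultimately have "card (A \<inter> ball x' r') = n + 1"
    using few many by simp
  then have "vangle (a - d) (b - d) \<in> triangle_angles (n + 1) A"
    using S' ne d by (intro triangle_anglesI) auto
  then show ?thesis
    using ang \<gamma>_eq by blast
qed

lemma triangle_angles_nonempty:
  assumes gen: "generic A" and lf: "locally_finite A" and cd: "coarsely_dense A"
  shows "triangle_angles n A \<noteq> {}"
proof (induction n)
  case 0
  obtain x r a b c where S: "{a, b, c} \<subseteq> A \<inter> sphere x r" and ne: "a \<noteq> b" "a \<noteq> c" "b \<noteq> c" and empty: "A \<inter> ball x r = {}"
    using exists_empty_circle[OF lf cd] by blast
  have "A \<inter> sphere x r = {a, b, c}"
    using generic_circle[OF gen lf S ne] .
  moreover have "card (A \<inter> ball x r) = 0"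
    by (simp add: empty)
  ultimately have "vangle (a - c) (b - c) \<in> triangle_angles 0 A"
    using ne by (intro triangle_anglesI)
  then show ?case
    by blast
next
  case (Suc n)
  then obtain \<gamma> where "\<gamma> \<in> triangle_angles n A"
    by blast
  from triangle_angles_le_ex[OF gen lf cd this] show ?case
    by auto
qed

lemma triangle_angles_extreme:
  assumes "\<gamma> \<in> triangle_angles n A"
  obtains x r a b c where "A \<inter> sphere x r = {a, b, c}" "a \<noteq> b" "a \<noteq> c" "b \<noteq> c" "card (A \<inter> ball x r) = n"
    "\<gamma> \<in> extreme_angles {c - a, c - b}" "\<gamma> \<in> extreme_angles {a - c, b - c}"
proof -
  obtain x r a b c where S: "A \<inter> sphere x r = {a, b, c}" and ne: "a \<noteq> b" "a \<noteq> c" "b \<noteq> c"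
    and n: "card (A \<inter> ball x r) = n" and \<gamma>_eq: "\<gamma> = vangle (a - c) (b - c)"
    using triangle_anglesE[OF assms] .
  have "a \<in> sphere x r" "b \<in> sphere x r" "c \<in> sphere x r"
    using S by blast+
  then have "cross (a - c) (b - c) \<noteq> 0"
    using cocircular_not_collinear[of c x r a b] ne by simp
  moreover have "cross (c - a) (c - b) = cross (a - c) (b - c)" "vangle (c - a) (c - b) = vangle (a - c) (b - c)"
    using vangle_minus_left[of "a - c" "c - b"] vangle_minus_right[of "a - c" "b - c"]
    by (simp_all add: cross_diff)
  ultimately have "\<gamma> \<in> extreme_angles {c - a, c - b}" "\<gamma> \<in> extreme_angles {a - c, b - c}"
    using extreme_angles_pair[of "c - a" "c - b"] extreme_angles_pair[of "a - c" "b - c"] \<gamma>_eq by simp_all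
  then show ?thesis
    using that S ne n by blast
qed

text \<open>\<open>c\<close> is counted first (\<open>T\<close> empty) or last (\<open>T\<close> the
  other two). Both directions then have the same sign and enclose the angle of the triangle; with
  \<open>c\<close> in second place, at order \<open>n + 2\<close>, its supplement would
  appear.\<close>

lemma triangle_angles_subset_zone_angles:
  "triangle_angles n A \<subseteq> zone_angles (n + 1) A" "triangle_angles n A \<subseteq> zone_angles (n + 3) A"
proof -
  have "\<gamma> \<in> zone_angles (n + 1) A \<and> \<gamma> \<in> zone_angles (n + 3) A" if \<gamma>: "\<gamma> \<in> triangle_angles n A" for \<gamma>
  proof -
    obtain x r a b c where S: "A \<inter> sphere x r = {a, b, c}" and ne: "a \<noteq> b" "a \<noteq> c" "b \<noteq> c"
      and n: "card (A \<inter> ball x r) = n"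
      and ext: "\<gamma> \<in> extreme_angles {c - a, c - b}" "\<gamma> \<in> extreme_angles {a - c, b - c}"
      using triangle_angles_extreme[OF \<gamma>] .
    have "zone_dirs {a, b, c} {} c = {c - a, c - b}" "zone_dirs {a, b, c} {a, b} c = {a - c, b - c}"
      using ne by (auto simp: zone_dirs_def)
    then show ?thesis
      using zone_anglesI[of "{}" A x r c "n + 1" \<gamma>] zone_anglesI[of "{a, b}" A x r c "n + 3" \<gamma>] ext ne n
      unfolding S by simp
  qed
  then show "triangle_angles n A \<subseteq> zone_angles (n + 1) A" "triangle_angles n A \<subseteq> zone_angles (n + 3) A"
    by blast+
qed

text \<open>Separating \<open>c\<close> from \<open>a\<close> and \<open>b\<close> gives the angle
  at \<open>c\<close>, whichever part is \<open>T\<close>.\<close>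

lemma triangle_angles_subset_cell_angles:
  "triangle_angles n A \<subseteq> cell_angles (n + 1) A" "triangle_angles n A \<subseteq> cell_angles (n + 2) A"
proof -
  have "\<gamma> \<in> cell_angles (n + 1) A \<and> \<gamma> \<in> cell_angles (n + 2) A" if \<gamma>: "\<gamma> \<in> triangle_angles n A" for \<gamma>
  proof -
    obtain x r a b c where S: "A \<inter> sphere x r = {a, b, c}" and ne: "a \<noteq> b" "a \<noteq> c" "b \<noteq> c"
      and n: "card (A \<inter> ball x r) = n"
      and ext: "\<gamma> \<in> extreme_angles {c - a, c - b}" "\<gamma> \<in> extreme_angles {a - c, b - c}"
      using triangle_angles_extreme[OF \<gamma>] .
    have "cell_dirs {a, b, c} {c} = {c - a, c - b}" "cell_dirs {a, b, c} {a, b} = {a - c, b - c}"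
      using ne by (auto simp: cell_dirs_def)
    then show ?thesis
      using cell_anglesI[of "{c}" A x r "n + 1" \<gamma>] cell_anglesI[of "{a, b}" A x r "n + 2" \<gamma>] ext ne n
      unfolding S by simp
  qed
  then show "triangle_angles n A \<subseteq> cell_angles (n + 1) A" "triangle_angles n A \<subseteq> cell_angles (n + 2) A"
    by blast+
qed

text \<open>With \<open>n\<close> enclosed points, \<open>k\<close> is \<open>n + 1\<close>,
  \<open>n + 2\<close> or \<open>n + 3\<close>. In the outer cases \<open>\<theta>\<close> is an
  angle of the triangle, and a triangle with \<open>n + 1\<close> enclosed points supplies an angle
  that is not larger. In the middle case \<open>\<theta>\<close> is a supplement; another angle of
  the same triangle is at most \<open>\<theta>\<close> and occurs at order
  \<open>n + 3\<close>.\<close>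

lemma zone_angles_le_ex:
  assumes gen: "generic A" and lf: "locally_finite A" and cd: "coarsely_dense A" and \<theta>: "\<theta> \<in> zone_angles k A"
  shows "\<exists>\<theta>'\<in>zone_angles (k + 1) A. \<theta>' \<le> \<theta>"
proof -
  obtain x r T b where T: "T \<subseteq> A \<inter> sphere x r" "b \<in> A \<inter> sphere x r - T" "card (A \<inter> ball x r) + card T + 1 = k"
    and "\<theta> \<in> extreme_angles (zone_dirs (A \<inter> sphere x r) T b)"
    using \<theta> unfolding zone_angles_def by blast
  then obtain e f where ef: "e \<in> zone_dirs (A \<inter> sphere x r) T b" "f \<in> zone_dirs (A \<inter> sphere x r) T b"
      "cross e f > 0" "\<theta> = vangle e f"
    by (metis extreme_anglesE)
  obtain p where p: "p \<in> A \<inter> sphere x r" "p \<noteq> b" "p \<in> T \<and> e = p - b \<or> p \<notin> T \<and> e = b - p"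
    using zone_dirsE[OF ef(1) T(1,2)] by blast
  obtain q where q: "q \<in> A \<inter> sphere x r" "q \<noteq> b" "q \<in> T \<and> f = q - b \<or> q \<notin> T \<and> f = b - q"
    using zone_dirsE[OF ef(2) T(1,2)] by blast
  have cr: "cross (p - b) (q - b) \<noteq> 0"
    using ef(3) p(3) q(3) by (auto simp: cross_diff)
  then have "p \<noteq> q"
    by auto
  have S: "A \<inter> sphere x r = {p, q, b}"
    using p q T(2) \<open>p \<noteq> q\<close> by (intro generic_circle[OF gen lf]) auto
  define n where "n = card (A \<inter> ball x r)"
  have tri: "vangle (p - b) (q - b) \<in> triangle_angles n A"
    using S p q \<open>p \<noteq> q\<close> by (intro triangle_anglesI) (simp_all add: n_def)
  have tri': "vangle (b - p) (q - p) \<in> triangle_angles n A"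
    using S p q \<open>p \<noteq> q\<close> by (intro triangle_anglesI) (auto simp: n_def)
  have signs: "vangle (b - p) (b - q) = vangle (p - b) (q - b)"
    "vangle (b - p) (q - b) = pi - vangle (p - b) (q - b)" "vangle (p - b) (b - q) = pi - vangle (p - b) (q - b)"
    using vangle_minus_left[of "p - b" "q - b"] vangle_minus_right[of "p - b" "q - b"]
      vangle_minus_right[of "b - p" "q - b"] by simp_all
  have T_sub: "T \<subseteq> {p, q}"
    using T S by auto
  consider "T = {}" | "T = {p, q}" | "T = {p}" | "T = {q}"
    using T_sub by blast
  then show ?thesis
  proof cases
    case 1
    then have "\<theta> = vangle (p - b) (q - b)" "k = n + 1"
      using ef(4) p(3) q(3) signs T(3) by (auto simp: n_def)
    then show ?thesis
      using triangle_angles_le_ex[OF gen lf cd tri] triangle_angles_subset_zone_angles(1)[of "n + 1" A] by auto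
  next
    case 2
    then have "\<theta> = vangle (p - b) (q - b)" "k + 1 = (n + 1) + 3"
      using ef(4) p(3) q(3) T(3) \<open>p \<noteq> q\<close> by (auto simp: n_def)
    then show ?thesis
      using triangle_angles_le_ex[OF gen lf cd tri] triangle_angles_subset_zone_angles(2)[of "n + 1" A] by auto
  next
    case 3
    then have eqs: "\<theta> = pi - vangle (p - b) (q - b)" "k + 1 = n + 3"
      using ef(4) p(3) q(3) signs T(3) \<open>p \<noteq> q\<close> by (auto simp: n_def)
    then have "vangle (b - p) (q - p) \<in> zone_angles (k + 1) A"
      using tri' triangle_angles_subset_zone_angles(2)[of n A] by (metis subsetD)
    then show ?thesis
      using triangle_two_angles_le[OF cr] eqs(1) by (intro bexI) simp_all
  next
    case 4
    then have eqs: "\<theta> = pi - vangle (p - b) (q - b)" "k + 1 = n + 3"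
      using ef(4) p(3) q(3) signs T(3) \<open>p \<noteq> q\<close> by (auto simp: n_def)
    then have "vangle (b - p) (q - p) \<in> zone_angles (k + 1) A"
      using tri' triangle_angles_subset_zone_angles(2)[of n A] by (metis subsetD)
    then show ?thesis
      using triangle_two_angles_le[OF cr] eqs(1) by (intro bexI) simp_all
  qed
qed

text \<open>With only three points, the two extreme directions share an end, so
  \<open>\<theta>\<close> is an angle of the triangle for either size of \<open>T\<close>. A
  triangle enclosing one more point then gives an angle of order \<open>k + 1\<close>.\<close>

lemma cell_angles_le_ex:
  assumes gen: "generic A" and lf: "locally_finite A" and cd: "coarsely_dense A" and \<theta>: "\<theta> \<in> cell_angles k A"
  shows "\<exists>\<theta>'\<in>cell_angles (k + 1) A. \<theta>' \<le> \<theta>"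
proof -
  obtain x r T where T: "T \<subseteq> A \<inter> sphere x r" "card (A \<inter> ball x r) + card T = k"
    and "\<theta> \<in> extreme_angles (cell_dirs (A \<inter> sphere x r) T)"
    using \<theta> unfolding cell_angles_def by blast
  then obtain e f where ef: "e \<in> cell_dirs (A \<inter> sphere x r) T" "f \<in> cell_dirs (A \<inter> sphere x r) T"
      "cross e f > 0" "\<theta> = vangle e f"
    by (metis extreme_anglesE)
  obtain s p where sp: "s \<in> T" "p \<in> A \<inter> sphere x r - T" "e = s - p"
    using ef(1) unfolding cell_dirs_def by blast
  obtain t q where tq: "t \<in> T" "q \<in> A \<inter> sphere x r - T" "f = t - q"
    using ef(2) unfolding cell_dirs_def by blast
  define n where "n = card (A \<inter> ball x r)"
  have "\<theta> \<in> triangle_angles n A \<and> (k = n + 1 \<or> k = n + 2)"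
  proof (cases "s = t")
    case True
    then have "p \<noteq> q"
      using ef(3) sp tq by auto
    then have S: "A \<inter> sphere x r = {p, q, s}"
      using sp tq T(1) by (intro generic_circle[OF gen lf]) auto
    then have "T = {s}"
      using T(1) sp tq by auto
    moreover have \<theta>_eq: "\<theta> = vangle (p - s) (q - s)"
      using vangle_minus_left[of "p - s" "s - q"] vangle_minus_right[of "p - s" "q - s"]
        ef(4) sp tq True by simp
    then have "\<theta> \<in> triangle_angles n A"
      unfolding \<theta>_eq using S \<open>p \<noteq> q\<close> sp tq True by (intro triangle_anglesI) (auto simp: n_def)
    ultimately show ?thesis
      using T(2) by (simp add: n_def)
  next
    case False
    then have S: "A \<inter> sphere x r = {s, t, p}"
      using sp tq T(1) by (intro generic_circle[OF gen lf]) auto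
    then have "q = p" "T = {s, t}"
      using T(1) sp tq by auto
    moreover have "\<theta> \<in> triangle_angles n A"
      unfolding ef(4) sp(3) tq(3) \<open>q = p\<close> using S False sp tq by (intro triangle_anglesI) (auto simp: n_def)
    ultimately show ?thesis
      using T(2) False by (simp add: n_def)
  qed
  then show ?thesis
    using triangle_angles_le_ex[OF gen lf cd, of \<theta> n] triangle_angles_subset_cell_angles[of "n + 1" A] by auto
qed

section \<open>Infima and suprema of the angles\<close>

lemma min_angle_mono:
  assumes "(\<Union>P\<in>T. interior_angles P) \<noteq> {}"
    and "\<And>\<theta>. \<theta> \<in> (\<Union>P\<in>T. interior_angles P) \<Longrightarrow> \<exists>\<theta>'\<in>(\<Union>P\<in>U. interior_angles P). \<theta>' \<le> \<theta>"
  shows "\<alpha> U \<le> \<alpha> T"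
  unfolding min_angle_def
proof (rule cInf_mono)
  show "bdd_below (\<Union>P\<in>U. interior_angles P)"
    by (rule bdd_belowI[of _ 0]) (auto simp: interior_angles_def vangle_bounds)
qed (use assms in auto)

lemma max_angle_mono:
  assumes "(\<Union>P\<in>T. interior_angles P) \<noteq> {}"
    and "\<And>\<theta>. \<theta> \<in> (\<Union>P\<in>T. interior_angles P) \<Longrightarrow> \<exists>\<theta>'\<in>(\<Union>P\<in>U. interior_angles P). \<theta> \<le> \<theta>'"
  shows "\<omega> T \<le> \<omega> U"
  unfolding max_angle_def
proof (rule cSup_mono)
  show "bdd_above (\<Union>P\<in>U. interior_angles P)"
    by (rule bdd_aboveI[of _ pi]) (auto simp: interior_angles_def vangle_bounds)
qed (use assms in auto)

theorem theorem3p3: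
  fixes A :: "plane set" and k :: nat
  assumes "locally_finite A" and "coarsely_dense A" and "k \<ge> 1"
  shows "(generic A \<longrightarrow>
            (\<forall>M\<in>{Del, Igl, Bri}. \<alpha> (M k A) \<ge> \<alpha> (M (k + 1) A)) \<and>
            (\<forall>M\<in>{Vor, Bri, Igl}. \<omega> (M k A) \<le> \<omega> (M (k + 1) A))) \<and>
         \<alpha> (Bri k A) \<ge> \<alpha> (Bri (k + 1) A) \<and>
         \<omega> (Igl k A) \<le> \<omega> (Igl (k + 1) A)"
proof -
  have k1: "k + 1 \<ge> 1"
    by simp
  note lf = assms(1) and cd = assms(2)
  note angles = angles_Bri[OF lf cd assms(3)] angles_Bri[OF lf cd k1] angles_Igl[OF lf]
    angles_Vor[OF lf cd assms(3)] angles_Vor[OF lf cd k1] angles_Del[OF lf assms(3)] angles_Del[OF lf k1]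
  note zone_ne = zone_angles_nonempty[OF lf cd assms(3)]
  \<comment> \<open>The angles of \<open>Bri\<close> are supplements of \<open>zone_angles\<close>,
    so enlarging zone angles lowers this infimum and also raises the supremum for
    \<open>Igl\<close>.\<close>
  have Bri_min: "\<alpha> (Bri (k + 1) A) \<le> \<alpha> (Bri k A)"
    by (rule min_angle_mono) (unfold angles, use zone_ne zone_angles_ge_ex[OF lf cd] in \<open>auto simp: bex_simps\<close>)
  have Igl_max: "\<omega> (Igl k A) \<le> \<omega> (Igl (k + 1) A)"
    by (rule max_angle_mono) (unfold angles, use zone_ne zone_angles_ge_ex[OF lf cd] in auto)
  have "\<alpha> (Del (k + 1) A) \<le> \<alpha> (Del k A) \<and> \<alpha> (Igl (k + 1) A) \<le> \<alpha> (Igl k A) \<and>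
      \<omega> (Vor k A) \<le> \<omega> (Vor (k + 1) A) \<and> \<omega> (Bri k A) \<le> \<omega> (Bri (k + 1) A)" if gen: "generic A"
  proof (intro conjI)
    have cell_ne: "cell_angles k A \<noteq> {}"
      using triangle_angles_nonempty[OF gen lf cd, of "k - 1"]
        triangle_angles_subset_cell_angles(1)[of "k - 1" A] assms(3) by auto
    note cell = cell_angles_le_ex[OF gen lf cd] and zone = zone_angles_le_ex[OF gen lf cd]
    show "\<alpha> (Del (k + 1) A) \<le> \<alpha> (Del k A)"
      by (rule min_angle_mono) (unfold angles, use cell_ne cell in auto)
    show "\<alpha> (Igl (k + 1) A) \<le> \<alpha> (Igl k A)"
      by (rule min_angle_mono) (unfold angles, use zone_ne zone in auto)
    show "\<omega> (Vor k A) \<le> \<omega> (Vor (k + 1) A)"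
      by (rule max_angle_mono) (unfold angles, use cell_ne cell in auto)
    show "\<omega> (Bri k A) \<le> \<omega> (Bri (k + 1) A)"
      by (rule max_angle_mono) (unfold angles, use zone_ne zone in auto)
  qed
  then show ?thesis
    using Bri_min Igl_max by auto
qed

end
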